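(* Let $\Gamma=(V,E,o,t)$ be a connected finite graph with finite modulus $\rho\colon I\to V$. Applying $\mathrm{Hom}(-,\mathbb{Z})$ to the exact sequence $0\to\mathbb{Z}^I/\mathbb{Z}\to\mathrm{P}_{\mathfrak m}(\Gamma)\to\mathrm{P}(\Gamma)\to0$ gives a connecting homomorphism $\mathbb{Z}[I]_0=\mathrm{Hom}(\mathbb{Z}^I/\mathbb{Z},\mathbb{Z})\to\mathrm{Ext}^1(\mathrm{P}(\Gamma),\mathbb{Z})\cong\mathrm{Hom}(\mathrm{P}(\Gamma),\mathbb{Q}/\mathbb{Z})\cong\mathrm{J}(\Gamma)$. Up to sign, this map equals the composite $\mathbb{Z}[I]_0\xrightarrow{\rho_*}\mathbb{Z}[V]_0\xrightarrow{\widetilde{\mathrm{AJ}}}\mathrm{J}(\Gamma)$.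
   Context: Graph: $V\neq\emptyset$, $E$, $o,t\colon E\to V$; finite, connected. Modulus: nonempty finite family $(w_i)_{i\in I}$, $\rho(i)=w_i$; $\rho_*\colon\mathbb{Z}[I]\to\mathbb{Z}[V]$ its linear extension; $\mathbb{Z}[I]_0$ the degree-zero elements, identified with $\mathrm{Hom}(\mathbb{Z}^I/\mathbb{Z},\mathbb{Z})$ by evaluation. $\partial=t-o$, $H_1(\Gamma)=\ker\partial$; $(df)(e)=f(t(e))-f(o(e))$, $H^1(\Gamma)=\mathbb{Z}^E/d\mathbb{Z}^V$; $(d^*\omega)(v)=\sum_{t(e)=v}\omega(e)-\sum_{o(e)=v}\omega(e)$, $\mathcal{H}^1(\Gamma)=\ker d^*$; $\mathrm{P}(\Gamma)=H^1(\Gamma)/\mathrm{im}(\mathcal{H}^1(\Gamma))$ (finite). $M^\vee=\mathrm{Hom}(M,\mathbb{Z})$; $\alpha\colon H_1\to\mathcal{H}^1(\Gamma)^\vee$, $\gamma\mapsto(\omega\mapsto\omega(\gamma))$; $\mathrm{J}(\Gamma)=\mathcal{H}^1(\Gamma)^\vee/\alpha(H_1)$. $\widetilde{\mathrm{AJ}}(\partial\gamma)$ is the class of $\omega\mapsto\omega(\gamma)$. The isomorphism $\mathrm{Hom}(\mathrm{P}(\Gamma),\mathbb{Q}/\mathbb{Z})\cong\mathrm{J}(\Gamma)$ comes from the perfect pairing $\mathrm{J}(\Gamma)\times\mathrm{P}(\Gamma)\to\mathbb{Q}/\mathbb{Z}$: for $\varphi\in\mathcal{H}^1(\Gamma)^\vee$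 and $x\in\mathrm{P}(\Gamma)$ the class of $\omega\in\mathbb{Z}^E$, choose $n\ge1$ with $nx=0$ and write $n\omega=\eta+df$ with $\eta\in\mathcal{H}^1(\Gamma)$, $f\in\mathbb{Z}^V$; the pairing is $\frac1n\varphi(\eta)\bmod\mathbb{Z}$. Extended graph and $\mathrm{P}_{\mathfrak m}$: $\Gamma_{\mathfrak m}$ adds vertex $\star$ and edges $e_i$ ($o(e_i)=\star$, $t(e_i)=w_i$); $H^1(\Gamma_{\mathfrak m})=(\mathbb{Z}^E\oplus\mathbb{Z}^I)/\{(df,f\circ\rho-a):f\in\mathbb{Z}^V,a\in\mathbb{Z}\}$, $\mathrm{P}_{\mathfrak m}(\Gamma)=H^1(\Gamma_{\mathfrak m})/\{[(\omega,0)]:\omega\in\mathcal{H}^1(\Gamma)\}$; in the sequence, $\mathbb{Z}^I/\mathbb{Z}\to\mathrm{P}_{\mathfrak m}$ is $g\mapsto[(0,g)]$ and $\mathrm{P}_{\mathfrak m}\to\mathrm{P}$ is $[(\omega,g)]\mapsto[\omega]$. *)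

theory Defs
  imports
    "HOL-Algebra.Free_Abelian_Groups"
    "HOL-Algebra.Exact_Sequence"
    "Graph_Theory.Digraph_Component"
begin

text \<open>
  Abelian groups are commutative groups in the sense of HOL-Algebra, hence written
  multiplicatively; the concrete ones below carry addition as their group operation.
  A finite graph $(V,E,o,t)$ is a finite digraph with $o$ = \<^const>\<open>tail\<close> and
  $t$ = \<^const>\<open>head\<close>; loops and parallel arcs are allowed, and connectedness refers to the
  underlying undirected graph (and includes $V \neq \emptyset$).
\<close>

subsection \<open>Homomorphism groups, Ext and connecting homomorphisms\<close>

definition hom_group :: "('a, 'm) monoid_scheme \<Rightarrow> ('b, 'n) monoid_scheme \<Rightarrow> ('a \<Rightarrow> 'b) monoid"
  where "hom_group G M =
    \<lparr>carrier = {h \<in> hom G M. h \<in> extensional (carrier G)},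
     monoid.mult = (\<lambda>h k. \<lambda>x\<in>carrier G. h x \<otimes>\<^bsub>M\<^esub> k x),
     one = (\<lambda>x\<in>carrier G. \<one>\<^bsub>M\<^esub>)\<rparr>"

definition rat_group :: "rat monoid"
  where "rat_group = \<lparr>carrier = UNIV, monoid.mult = (+), one = 0\<rparr>"

definition rat_mod_int :: "rat set monoid"
  where "rat_mod_int = rat_group Mod \<int>"

abbreviation rat_class :: "rat \<Rightarrow> rat set"
  where "rat_class q \<equiv> \<int> #>\<^bsub>rat_group\<^esub> q"

definition rep :: "'a set \<Rightarrow> 'a"
  where "rep X = (SOME x. x \<in> X)"

text \<open>The linear extension to \<open>\<int>[S]\<close> of a map from \<open>S\<close> to an abelian group \<open>M\<close>.\<close>

definition lin_ext :: "('b, 'm) monoid_scheme \<Rightarrow> ('a \<Rightarrow> 'b) \<Rightarrow> ('a \<Rightarrow>\<^sub>0 int) \<Rightarrow> 'b"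
  where "lin_ext M s x =
    finprod M (\<lambda>c. s c [^]\<^bsub>M\<^esub> Poly_Mapping.lookup x c) (Poly_Mapping.keys x)"

text \<open>
  The standard free resolution of $C$: with $F_0 = \mathbb Z[C]$, the free abelian group on the
  underlying set of $C$, and $F_1 = \ker (F_0 \to C)$, the sequence
  $0 \to F_1 \to F_0 \to C \to 0$ is exact, and $F_1$ is free as a subgroup of a free abelian
  group. Thus $\mathrm{Ext}^1(C,M)$ is the cokernel of $\mathrm{Hom}(F_0,M) \to \mathrm{Hom}(F_1,M)$.
\<close>

definition res0 :: "('a, 'm) monoid_scheme \<Rightarrow> ('a \<Rightarrow>\<^sub>0 int) monoid"
  where "res0 C = free_Abelian_group (carrier C)"

definition res1 :: "('a, 'm) monoid_scheme \<Rightarrow> ('a \<Rightarrow>\<^sub>0 int) monoid"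
  where "res1 C = (res0 C)\<lparr>carrier := kernel (res0 C) C (lin_ext C (\<lambda>c. c))\<rparr>"

definition ext1_cobd :: "('a, 'm) monoid_scheme \<Rightarrow> ('b, 'n) monoid_scheme \<Rightarrow> (('a \<Rightarrow>\<^sub>0 int) \<Rightarrow> 'b) set"
  where "ext1_cobd C M =
    (\<lambda>h. restrict h (carrier (res1 C))) ` carrier (hom_group (res0 C) M)"

definition Ext1 :: "('a, 'm) monoid_scheme \<Rightarrow> ('b, 'n) monoid_scheme \<Rightarrow> (('a \<Rightarrow>\<^sub>0 int) \<Rightarrow> 'b) set monoid"
  where "Ext1 C M = hom_group (res1 C) M Mod ext1_cobd C M"

abbreviation ext1_class ::
    "('a, 'm) monoid_scheme \<Rightarrow> ('b, 'n) monoid_scheme \<Rightarrow> (('a \<Rightarrow>\<^sub>0 int) \<Rightarrow> 'b) \<Rightarrow> (('a \<Rightarrow>\<^sub>0 int) \<Rightarrow> 'b) set"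
  where "ext1_class C M h \<equiv> ext1_cobd C M #>\<^bsub>hom_group (res1 C) M\<^esub> h"

definition is_ses ::
    "('a, 'm) monoid_scheme \<Rightarrow> ('b, 'n) monoid_scheme \<Rightarrow> ('c, 'k) monoid_scheme
      \<Rightarrow> ('a \<Rightarrow> 'b) \<Rightarrow> ('b \<Rightarrow> 'c) \<Rightarrow> bool"
  where "is_ses A B C i p \<longleftrightarrow>
    comm_group A \<and> comm_group B \<and> comm_group C \<and>
    i \<in> mon A B \<and> p \<in> epi B C \<and> kernel B C p = i ` carrier A"

text \<open>
  For $0 \to A \to B \to C \to 0$ exact, the connecting map
  $\mathrm{Hom}(A,M) \to \mathrm{Ext}^1(C,M)$ of $\mathrm{Hom}(-,M)$: lift $F_0 \to C$ to
  $F_0 \to B$, restrict the lift to $F_1 \to A$ and compose with $A \to M$. The class does not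
  depend on the lift; the one used here comes from a set-theoretic section of $B \to C$.
\<close>

definition connecting_contra ::
    "('a, 'm) monoid_scheme \<Rightarrow> ('b, 'n) monoid_scheme \<Rightarrow> ('c, 'k) monoid_scheme
      \<Rightarrow> ('a \<Rightarrow> 'b) \<Rightarrow> ('b \<Rightarrow> 'c) \<Rightarrow> ('d, 'l) monoid_scheme \<Rightarrow> ('a \<Rightarrow> 'd) \<Rightarrow> (('c \<Rightarrow>\<^sub>0 int) \<Rightarrow> 'd) set"
  where "connecting_contra A B C i p M h =
    ext1_class C M
      (\<lambda>r\<in>carrier (res1 C).
        h (inv_into (carrier A) i (lin_ext B (inv_into (carrier B) p) r)))"

text \<open>
  For $0 \to A \to B \to D \to 0$ exact, the connecting map
  $\mathrm{Hom}(C,D) \to \mathrm{Ext}^1(C,A)$ of $\mathrm{Hom}(C,-)$: lift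
  $F_0 \to C \to D$ to $F_0 \to B$ and restrict it to $F_1 \to A$.
\<close>

definition connecting_co ::
    "('c, 'k) monoid_scheme \<Rightarrow> ('a, 'm) monoid_scheme \<Rightarrow> ('b, 'n) monoid_scheme
      \<Rightarrow> ('a \<Rightarrow> 'b) \<Rightarrow> ('b \<Rightarrow> 'd) \<Rightarrow> ('c \<Rightarrow> 'd) \<Rightarrow> (('c \<Rightarrow>\<^sub>0 int) \<Rightarrow> 'a) set"
  where "connecting_co C A B i p h =
    ext1_class C A
      (\<lambda>r\<in>carrier (res1 C).
        inv_into (carrier A) i (lin_ext B (\<lambda>c. inv_into (carrier B) p (h c)) r))"

text \<open>
  The map $\mathrm{Hom}(C,\mathbb Q/\mathbb Z) \to \mathrm{Ext}^1(C,\mathbb Z)$ coming from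
  $0 \to \mathbb Z \to \mathbb Q \to \mathbb Q/\mathbb Z \to 0$; it is bijective for finite $C$.
\<close>

definition dual_to_Ext1 ::
    "('c, 'k) monoid_scheme \<Rightarrow> ('c \<Rightarrow> rat set) \<Rightarrow> (('c \<Rightarrow>\<^sub>0 int) \<Rightarrow> int) set"
  where "dual_to_Ext1 C = connecting_co C integer_group rat_group of_int rat_class"


subsection \<open>Chains and cochains\<close>

definition int_fun :: "'a set \<Rightarrow> ('a \<Rightarrow> int) monoid"
  where "int_fun S = product_group S (\<lambda>_. integer_group)"

definition chain_eval :: "('a \<Rightarrow> int) \<Rightarrow> ('a \<Rightarrow>\<^sub>0 int) \<Rightarrow> int"
  where "chain_eval f c = (\<Sum>x\<in>Poly_Mapping.keys c. Poly_Mapping.lookup c x * f x)"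

definition chain_degree :: "('a \<Rightarrow>\<^sub>0 int) \<Rightarrow> int"
  where "chain_degree c = (\<Sum>x\<in>Poly_Mapping.keys c. Poly_Mapping.lookup c x)"

definition chains_deg0 :: "'a set \<Rightarrow> ('a \<Rightarrow>\<^sub>0 int) monoid"
  where "chains_deg0 S =
    (free_Abelian_group S)\<lparr>carrier := {c \<in> carrier (free_Abelian_group S). chain_degree c = 0}\<rparr>"

definition boundary :: "('v, 'e) pre_digraph \<Rightarrow> ('e \<Rightarrow>\<^sub>0 int) \<Rightarrow> ('v \<Rightarrow>\<^sub>0 int)"
  where "boundary G = frag_extend (\<lambda>e. frag_of (head G e) - frag_of (tail G e))"

definition cycles1 :: "('v, 'e) pre_digraph \<Rightarrow> ('e \<Rightarrow>\<^sub>0 int) set"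
  where "cycles1 G =
    kernel (free_Abelian_group (arcs G)) (free_Abelian_group (verts G)) (boundary G)"

definition diff :: "('v, 'e) pre_digraph \<Rightarrow> ('v \<Rightarrow> int) \<Rightarrow> ('e \<Rightarrow> int)"
  where "diff G f = (\<lambda>e\<in>arcs G. f (head G e) - f (tail G e))"

definition exact_forms :: "('v, 'e) pre_digraph \<Rightarrow> ('e \<Rightarrow> int) set"
  where "exact_forms G = diff G ` carrier (int_fun (verts G))"

definition H1 :: "('v, 'e) pre_digraph \<Rightarrow> ('e \<Rightarrow> int) set monoid"
  where "H1 G = int_fun (arcs G) Mod exact_forms G"

abbreviation H1_class :: "('v, 'e) pre_digraph \<Rightarrow> ('e \<Rightarrow> int) \<Rightarrow> ('e \<Rightarrow> int) set"
  where "H1_class G \<omega> \<equiv> exact_forms G #>\<^bsub>int_fun (arcs G)\<^esub> \<omega>"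

definition codiff :: "('v, 'e) pre_digraph \<Rightarrow> ('e \<Rightarrow> int) \<Rightarrow> ('v \<Rightarrow> int)"
  where "codiff G \<omega> = (\<lambda>v\<in>verts G.
    (\<Sum>e | e \<in> arcs G \<and> head G e = v. \<omega> e) - (\<Sum>e | e \<in> arcs G \<and> tail G e = v. \<omega> e))"

definition harmonic :: "('v, 'e) pre_digraph \<Rightarrow> ('e \<Rightarrow> int) monoid"
  where "harmonic G = (int_fun (arcs G))\<lparr>carrier :=
    kernel (int_fun (arcs G)) (int_fun (verts G)) (codiff G)\<rparr>"


subsection \<open>The groups P and J and their pairing\<close>

definition P_rel :: "('v, 'e) pre_digraph \<Rightarrow> ('e \<Rightarrow> int) set set"
  where "P_rel G = H1_class G ` carrier (harmonic G)"

definition P_group :: "('v, 'e) pre_digraph \<Rightarrow> ('e \<Rightarrow> int) set set monoid"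
  where "P_group G = H1 G Mod P_rel G"

abbreviation P_class :: "('v, 'e) pre_digraph \<Rightarrow> ('e \<Rightarrow> int) \<Rightarrow> ('e \<Rightarrow> int) set set"
  where "P_class G \<omega> \<equiv> P_rel G #>\<^bsub>H1 G\<^esub> H1_class G \<omega>"

text \<open>Defined on all 1-chains; on cycles this is the map defining the lattice of periods.\<close>

definition integrate :: "('v, 'e) pre_digraph \<Rightarrow> ('e \<Rightarrow>\<^sub>0 int) \<Rightarrow> (('e \<Rightarrow> int) \<Rightarrow> int)"
  where "integrate G \<gamma> = (\<lambda>\<omega>\<in>carrier (harmonic G). chain_eval \<omega> \<gamma>)"

definition harmonic_dual :: "('v, 'e) pre_digraph \<Rightarrow> (('e \<Rightarrow> int) \<Rightarrow> int) monoid"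
  where "harmonic_dual G = hom_group (harmonic G) integer_group"

definition Jac :: "('v, 'e) pre_digraph \<Rightarrow> (('e \<Rightarrow> int) \<Rightarrow> int) set monoid"
  where "Jac G = harmonic_dual G Mod (integrate G ` cycles1 G)"

abbreviation Jac_class :: "('v, 'e) pre_digraph \<Rightarrow> (('e \<Rightarrow> int) \<Rightarrow> int) \<Rightarrow> (('e \<Rightarrow> int) \<Rightarrow> int) set"
  where "Jac_class G \<phi> \<equiv> (integrate G ` cycles1 G) #>\<^bsub>harmonic_dual G\<^esub> \<phi>"

definition AJ :: "('v, 'e) pre_digraph \<Rightarrow> ('v \<Rightarrow>\<^sub>0 int) \<Rightarrow> (('e \<Rightarrow> int) \<Rightarrow> int) set"
  where "AJ G x = Jac_class G (integrate G
    (SOME \<gamma>. \<gamma> \<in> carrier (free_Abelian_group (arcs G)) \<and> boundary G \<gamma> = x))"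

definition pairing_data ::
    "('v, 'e) pre_digraph \<Rightarrow> ('e \<Rightarrow> int) \<Rightarrow> nat \<times> ('e \<Rightarrow> int) \<times> ('v \<Rightarrow> int) \<Rightarrow> bool"
  where "pairing_data G \<omega> = (\<lambda>(n, \<eta>, f).
    1 \<le> n \<and> \<eta> \<in> carrier (harmonic G) \<and> f \<in> carrier (int_fun (verts G)) \<and>
    (\<forall>e\<in>arcs G. int n * \<omega> e = \<eta> e + diff G f e))"

text \<open>The value does not depend on any of the choices (representatives, \<open>n\<close>, \<open>\<eta>\<close>, \<open>f\<close>).\<close>

definition pairing ::
    "('v, 'e) pre_digraph \<Rightarrow> (('e \<Rightarrow> int) \<Rightarrow> int) set \<Rightarrow> ('e \<Rightarrow> int) set set \<Rightarrow> rat set"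
  where "pairing G j x =
    (let (n, \<eta>, f) = (SOME y. pairing_data G (rep (rep x)) y)
     in rat_class (of_int (rep j \<eta>) / of_nat n))"

definition Jac_to_dual ::
    "('v, 'e) pre_digraph \<Rightarrow> (('e \<Rightarrow> int) \<Rightarrow> int) set \<Rightarrow> (('e \<Rightarrow> int) set set \<Rightarrow> rat set)"
  where "Jac_to_dual G j = (\<lambda>x\<in>carrier (P_group G). pairing G j x)"


subsection \<open>The modulus\<close>

definition const_funs :: "'i set \<Rightarrow> ('i \<Rightarrow> int) set"
  where "const_funs I = range (\<lambda>a. \<lambda>i\<in>I. a)"

definition fun_mod_const :: "'i set \<Rightarrow> ('i \<Rightarrow> int) set monoid"
  where "fun_mod_const I = int_fun I Mod const_funs I"

text \<open>
  The first cohomology group of the graph obtained by adding a vertex $\star$ and arcs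
  $e_i \colon \star \to w_i$, as a quotient of $\mathbb Z^E \oplus \mathbb Z^I$: the coboundary of
  the function extending $f$ by $a$ at $\star$ is $(df, f \circ \rho - a)$.
\<close>

definition exact_forms_mod ::
    "('v, 'e) pre_digraph \<Rightarrow> 'i set \<Rightarrow> ('i \<Rightarrow> 'v) \<Rightarrow> (('e \<Rightarrow> int) \<times> ('i \<Rightarrow> int)) set"
  where "exact_forms_mod G I \<rho> =
    {(diff G f, \<lambda>i\<in>I. f (\<rho> i) - a) | f a. f \<in> carrier (int_fun (verts G))}"

definition H1_mod ::
    "('v, 'e) pre_digraph \<Rightarrow> 'i set \<Rightarrow> ('i \<Rightarrow> 'v) \<Rightarrow> (('e \<Rightarrow> int) \<times> ('i \<Rightarrow> int)) set monoid"
  where "H1_mod G I \<rho> = (int_fun (arcs G) \<times>\<times> int_fun I) Mod exact_forms_mod G I \<rho>"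

abbreviation H1_mod_class ::
    "('v, 'e) pre_digraph \<Rightarrow> 'i set \<Rightarrow> ('i \<Rightarrow> 'v) \<Rightarrow> ('e \<Rightarrow> int) \<times> ('i \<Rightarrow> int)
      \<Rightarrow> (('e \<Rightarrow> int) \<times> ('i \<Rightarrow> int)) set"
  where "H1_mod_class G I \<rho> z \<equiv>
    exact_forms_mod G I \<rho> #>\<^bsub>int_fun (arcs G) \<times>\<times> int_fun I\<^esub> z"

definition P_mod_rel ::
    "('v, 'e) pre_digraph \<Rightarrow> 'i set \<Rightarrow> ('i \<Rightarrow> 'v) \<Rightarrow> (('e \<Rightarrow> int) \<times> ('i \<Rightarrow> int)) set set"
  where "P_mod_rel G I \<rho> =
    (\<lambda>\<omega>. H1_mod_class G I \<rho> (\<omega>, \<one>\<^bsub>int_fun I\<^esub>)) ` carrier (harmonic G)"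

definition P_mod ::
    "('v, 'e) pre_digraph \<Rightarrow> 'i set \<Rightarrow> ('i \<Rightarrow> 'v) \<Rightarrow> (('e \<Rightarrow> int) \<times> ('i \<Rightarrow> int)) set set monoid"
  where "P_mod G I \<rho> = H1_mod G I \<rho> Mod P_mod_rel G I \<rho>"

abbreviation P_mod_class ::
    "('v, 'e) pre_digraph \<Rightarrow> 'i set \<Rightarrow> ('i \<Rightarrow> 'v) \<Rightarrow> ('e \<Rightarrow> int) \<times> ('i \<Rightarrow> int)
      \<Rightarrow> (('e \<Rightarrow> int) \<times> ('i \<Rightarrow> int)) set set"
  where "P_mod_class G I \<rho> z \<equiv> P_mod_rel G I \<rho> #>\<^bsub>H1_mod G I \<rho>\<^esub> H1_mod_class G I \<rho> z"

definition P_mod_incl ::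
    "('v, 'e) pre_digraph \<Rightarrow> 'i set \<Rightarrow> ('i \<Rightarrow> 'v)
      \<Rightarrow> ('i \<Rightarrow> int) set \<Rightarrow> (('e \<Rightarrow> int) \<times> ('i \<Rightarrow> int)) set set"
  where "P_mod_incl G I \<rho> X = P_mod_class G I \<rho> (\<one>\<^bsub>int_fun (arcs G)\<^esub>, rep X)"

definition P_mod_proj ::
    "('v, 'e) pre_digraph \<Rightarrow> (('e \<Rightarrow> int) \<times> ('i \<Rightarrow> int)) set set \<Rightarrow> ('e \<Rightarrow> int) set set"
  where "P_mod_proj G Y = P_class G (fst (rep (rep Y)))"

text \<open>The identification of \<open>\<int>[I]\<^sub>0\<close> with the dual of \<open>\<int>\<^sup>I/\<int>\<close> by evaluation.\<close>

definition deg0_to_dual :: "'i set \<Rightarrow> ('i \<Rightarrow>\<^sub>0 int) \<Rightarrow> (('i \<Rightarrow> int) set \<Rightarrow> int)"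
  where "deg0_to_dual I D = (\<lambda>X\<in>carrier (fun_mod_const I). chain_eval (rep X) D)"

definition P_connecting ::
    "('v, 'e) pre_digraph \<Rightarrow> 'i set \<Rightarrow> ('i \<Rightarrow> 'v) \<Rightarrow> (('i \<Rightarrow> int) set \<Rightarrow> int)
      \<Rightarrow> ((('e \<Rightarrow> int) set set \<Rightarrow>\<^sub>0 int) \<Rightarrow> int) set"
  where "P_connecting G I \<rho> =
    connecting_contra (fun_mod_const I) (P_mod G I \<rho>) (P_group G)
      (P_mod_incl G I \<rho>) (P_mod_proj G) integer_group"

text \<open>
  The composite
  $\mathbb Z[I]_0 = \mathrm{Hom}(\mathbb Z^I/\mathbb Z,\mathbb Z) \to \mathrm{Ext}^1(\mathrm P,\mathbb Z)
  \cong \mathrm{Hom}(\mathrm P,\mathbb Q/\mathbb Z) \cong \mathrm J$.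
\<close>

definition connecting_to_Jac ::
    "('v, 'e) pre_digraph \<Rightarrow> 'i set \<Rightarrow> ('i \<Rightarrow> 'v) \<Rightarrow> ('i \<Rightarrow>\<^sub>0 int) \<Rightarrow> (('e \<Rightarrow> int) \<Rightarrow> int) set"
  where "connecting_to_Jac G I \<rho> D =
    inv_into (carrier (Jac G)) (Jac_to_dual G)
      (inv_into (carrier (hom_group (P_group G) rat_mod_int)) (dual_to_Ext1 (P_group G))
        (P_connecting G I \<rho> (deg0_to_dual I D)))"

definition push_chain :: "('i \<Rightarrow> 'v) \<Rightarrow> ('i \<Rightarrow>\<^sub>0 int) \<Rightarrow> ('v \<Rightarrow>\<^sub>0 int)"
  where "push_chain \<rho> = frag_extend (\<lambda>i. frag_of (\<rho> i))"

end

theory Submission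
  imports Defs
begin

text \<open>
  Over the rationals \<open>\<rat>\<^sup>E\<close> is the orthogonal sum of harmonic and exact forms, so a homomorphism
  \<open>\<phi>\<close> from harmonic forms to \<open>\<int>\<close> has a unique extension \<open>\<Phi>: \<int>\<^sup>E \<rightarrow> \<rat>\<close> vanishing on exact forms, and
  the pairing of \<open>\<phi>\<close> with the class of \<open>\<omega>\<close> is \<open>\<Phi>(\<omega>)\<close> modulo \<open>\<int>\<close>. If \<open>\<Phi>\<close> is integral, it is evaluation
  at a cycle; this is injectivity of \<open>J \<rightarrow> Hom(P, \<rat>/\<int>)\<close>.

  A homomorphism \<open>A \<rightarrow> \<int>\<close> on the kernel of an extension \<open>B\<close> of \<open>C\<close> that extends to \<open>T: B \<rightarrow> \<rat>\<close> is sent by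
  the connecting map to the image of the character of \<open>C\<close> induced by \<open>T\<close> modulo \<open>\<int>\<close>. For evaluation at
  \<open>D\<close> and a 1-chain \<open>\<gamma>\<close> with \<open>\<partial>\<gamma> = \<rho>\<^sub>*D\<close>, take \<open>T(\<omega>, g) = g(D) - \<omega>(\<gamma>) + \<Phi>(\<omega>)\<close>, where \<open>\<Phi>\<close> extends
  \<open>\<eta> \<mapsto> \<eta>(\<gamma>)\<close>. It is congruent to \<open>\<Phi>\<close> modulo \<open>\<int>\<close>, so the two maps agree with sign \<open>+1\<close>.
\<close>

subsection \<open>Quotients\<close>

text \<open>The shape of \<open>T\<close> is forced by the relations of \<open>P_mod\<close>, which
  couple the two coordinates through a common \<open>f\<close>. On a relation with first entry df,
  the term g(D) gives the value of f on the push-forward of D; the constant a is lost because D has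
  degree zero. By the discrete Stokes formula this value is df(\<gamma>), so subtracting
  \<omega>(\<gamma>) kills the relation, \<Phi> being zero on df. On (\<eta>, 0) the subtraction
  leaves -\<eta>(\<gamma>), which \<Phi> restores. Two features of the formulation shape the rest.
  The groups consist of cosets of cosets and the maps out of them read off chosen representatives,
  so every map first gets a formula on classes. And the composite into J is written with
  \<open>inv_into\<close>, so the identity rests on injectivity of \<open>Jac_to_dual\<close> and
  \<open>dual_to_Ext1\<close>. The latter is analysed on the standard resolution: over a torsion
  group, an integral cocycle is the linear extension of a rational function on the group, restricted
  to relations, and changing that function by integers does not change the class.\<close>

lemma rep_in: "x \<in> X \<Longrightarrow> rep X \<in> X"
  unfolding rep_def by (rule someI)

lemma (in comm_group) r_coset_hom:
  assumes "subgroup N G"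
  shows "(\<lambda>x. N #> x) \<in> hom G (G Mod N)"
  using assms by (intro normal.r_coset_hom_Mod) (simp add: normal_iff_subgroup)

lemma (in comm_group) r_coset_eq_iff:
  assumes N: "subgroup N G" and x: "x \<in> carrier G" and y: "y \<in> carrier G"
  shows "N #> x = N #> y \<longleftrightarrow> x \<otimes> inv y \<in> N"
proof
  assume "N #> x = N #> y"
  then show "x \<otimes> inv y \<in> N"
    by (metis N x y group_axioms rcos_self subgroup.rcos_module_imp)
next
  assume "x \<otimes> inv y \<in> N"
  then have "x \<in> N #> y"
    by (metis N x y group_axioms subgroup.rcos_module_rev)
  then show "N #> x = N #> y"
    by (metis N y repr_independence)
qed

lemma (in comm_group) rep_coset:
  assumes N: "subgroup N G" and X: "X \<in> carrier (G Mod N)"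
  shows "rep X \<in> carrier G" and "N #> rep X = X"
proof -
  obtain x where x: "x \<in> carrier G" "X = N #> x"
    using X by (auto simp: carrier_FactGroup)
  have "rep X \<in> N #> x"
    using rep_in[of x X] rcos_self[OF x(1) N] x(2) by simp
  then show "rep X \<in> carrier G" and "N #> rep X = X"
    using x N
    by (meson r_coset_subset_G subgroup.subset subsetD) (use x N \<open>rep X \<in> N #> x\<close> repr_independence in metis)
qed

lemma subgroup_hom_image:
  assumes "group G" "group H" "h \<in> hom G H" "subgroup K G"
  shows "subgroup (h ` K) H"
proof -
  interpret group_hom G H h
    using assms by (simp add: group_hom_def group_hom_axioms_def)
  show ?thesis
    by (rule subgroup_img_is_subgroup[OF assms(4)])
qed

text \<open>\<open>P_group\<close> and \<open>P_mod\<close> both arise by dividing G by N and then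
  by the image of a second subgroup K. The locale treats this shape once; \<open>cl\<close> sends an
  element of G to its double coset.\<close>

locale double_quotient = comm_group G for G (structure) +
  fixes N K
  assumes subgroup_N: "subgroup N G" and subgroup_K: "subgroup K G"
begin

definition "B = G Mod N"
definition "R = (\<lambda>x. N #> x) ` K"
definition "Q = B Mod R"
definition "cl x = R #>\<^bsub>B\<^esub> (N #> x)"

lemma comm_group_B: "comm_group B"
  unfolding B_def by (rule abelian_FactGroup[OF subgroup_N])

lemma subgroup_R: "subgroup R B"
  unfolding R_def
  by (rule subgroup_hom_image[OF group_axioms _ _ subgroup_K])
    (use comm_group_B r_coset_hom[OF subgroup_N] in \<open>simp_all add: B_def comm_group.axioms(2)\<close>)

lemma comm_group_Q: "comm_group Q"
  unfolding Q_def by (rule comm_group.abelian_FactGroup[OF comm_group_B subgroup_R])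

lemma cl_hom: "cl \<in> hom G Q"
proof -
  have "(\<lambda>X. R #>\<^bsub>B\<^esub> X) \<circ> (\<lambda>x. N #> x) \<in> hom G Q"
    using Group.hom_compose[OF r_coset_hom[OF subgroup_N]]
      comm_group.r_coset_hom[OF comm_group_B subgroup_R] by (simp add: B_def Q_def)
  moreover have "cl = (\<lambda>X. R #>\<^bsub>B\<^esub> X) \<circ> (\<lambda>x. N #> x)"
    by (auto simp: cl_def)
  ultimately show ?thesis
    by simp
qed

lemma coset_in_B: "x \<in> carrier G \<Longrightarrow> N #> x \<in> carrier B"
  by (simp add: B_def carrier_FactGroup)

lemma rep_rep:
  assumes "X \<in> carrier Q"
  shows "rep (rep X) \<in> carrier G" and "cl (rep (rep X)) = X"
proof -
  have 1: "rep X \<in> carrier B" "R #>\<^bsub>B\<^esub> rep X = X"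
    using comm_group.rep_coset[OF comm_group_B subgroup_R] assms by (auto simp: Q_def)
  then show "rep (rep X) \<in> carrier G" "cl (rep (rep X)) = X"
    using rep_coset[OF subgroup_N, of "rep X"] by (auto simp: cl_def B_def)
qed

lemma cl_epi: "cl \<in> epi G Q"
  using cl_hom rep_rep hom_in_carrier[OF cl_hom] unfolding epi_def by fastforce

text \<open>The coset of x lies in \<open>R\<close> exactly when it is the coset of some k \<in> K,
  so the kernel of \<open>cl\<close> is NK. Equality of double cosets thereby becomes an explicit
  decomposition in G.\<close>

lemma cl_eq_one_iff:
  assumes x: "x \<in> carrier G"
  shows "cl x = \<one>\<^bsub>Q\<^esub> \<longleftrightarrow> (\<exists>n\<in>N. \<exists>k\<in>K. x = n \<otimes> k)"
proof -
  interpret B: comm_group B by (rule comm_group_B)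
  have NG: "N \<subseteq> carrier G" and KG: "K \<subseteq> carrier G"
    using subgroup_N subgroup_K subgroup.subset by auto
  have "cl x = \<one>\<^bsub>Q\<^esub> \<longleftrightarrow> N #> x \<in> R"
    unfolding cl_def Q_def one_FactGroup
    using B.coset_join1[of R "N #> x"] B.coset_join2[of "N #> x" R] coset_in_B[OF x] subgroup_R
    by (metis subgroup.subset)
  also have "\<dots> \<longleftrightarrow> (\<exists>k\<in>K. N #> x = N #> k)"
    by (auto simp: R_def)
  also have "\<dots> \<longleftrightarrow> (\<exists>k\<in>K. x \<otimes> inv k \<in> N)"
    using r_coset_eq_iff[OF subgroup_N x] KG by blast
  also have "\<dots> \<longleftrightarrow> (\<exists>n\<in>N. \<exists>k\<in>K. x = n \<otimes> k)"
  proof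
    assume "\<exists>k\<in>K. x \<otimes> inv k \<in> N"
    then obtain k where k: "k \<in> K" "x \<otimes> inv k \<in> N" by blast
    have "x = (x \<otimes> inv k) \<otimes> k"
      using x k KG by (simp add: m_assoc subsetD)
    then show "\<exists>n\<in>N. \<exists>k\<in>K. x = n \<otimes> k" using k by blast
  next
    assume "\<exists>n\<in>N. \<exists>k\<in>K. x = n \<otimes> k"
    then obtain n k where "n \<in> N" "k \<in> K" "x = n \<otimes> k" by blast
    moreover from this have "x \<otimes> inv k = n"
      using NG KG by (simp add: m_assoc subsetD)
    ultimately show "\<exists>k\<in>K. x \<otimes> inv k \<in> N" by metis
  qed
  finally show ?thesis .
qed

end

section \<open>Homomorphisms between commutative groups\<close>

lemma hom_inv_comm:
  assumes "comm_group G" "comm_group H" "h \<in> hom G H" "x \<in> carrier G"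
  shows "h (inv\<^bsub>G\<^esub> x) = inv\<^bsub>H\<^esub> h x"
  using assms group_hom.hom_inv[of G H h x]
  by (simp add: group_hom_def group_hom_axioms_def comm_group.axioms(2))

lemma hom_eq_iff_quotient_one:
  assumes "comm_group G" "comm_group H" "h \<in> hom G H" "x \<in> carrier G" "y \<in> carrier G"
  shows "h x = h y \<longleftrightarrow> h (x \<otimes>\<^bsub>G\<^esub> inv\<^bsub>G\<^esub> y) = \<one>\<^bsub>H\<^esub>"
proof -
  interpret G: comm_group G by fact
  interpret H: comm_group H by fact
  have "h x \<in> carrier H" "h y \<in> carrier H"
    using assms hom_in_carrier by metis+
  then show ?thesis
    using assms by (simp add: hom_mult hom_inv_comm) (metis H.inv_closed H.inv_equality H.inv_inv H.r_inv)
qed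

text \<open>Two preimages of a point differ by an element of the kernel of q, which h kills, so h
  composed with a section of q is well defined. Applied to class maps, this reduces a homomorphism
  out of a double quotient to a formula on representatives.\<close>

lemma hom_factor_through_epi:
  assumes "comm_group G" "comm_group H" "comm_group M" "q \<in> epi G H" "h \<in> hom G M"
    and ker: "\<And>x. \<lbrakk>x \<in> carrier G; q x = \<one>\<^bsub>H\<^esub>\<rbrakk> \<Longrightarrow> h x = \<one>\<^bsub>M\<^esub>"
  obtains k where "k \<in> hom H M" "\<And>x. x \<in> carrier G \<Longrightarrow> k (q x) = h x"
proof -
  interpret G: comm_group G by fact
  interpret H: comm_group H by fact
  interpret M: comm_group M by fact
  have q: "q \<in> hom G H" "q ` carrier G = carrier H"
    using assms by (auto simp: epi_def)
  define k where "k y = h (inv_into (carrier G) q y)" for y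
  have kq: "k (q x) = h x" if x: "x \<in> carrier G" for x
  proof -
    let ?x = "inv_into (carrier G) q (q x)"
    have x': "?x \<in> carrier G" "q ?x = q x"
      using x by (auto intro: inv_into_into f_inv_into_f)
    then have "q (?x \<otimes>\<^bsub>G\<^esub> inv\<^bsub>G\<^esub> x) = \<one>\<^bsub>H\<^esub>"
      using hom_eq_iff_quotient_one[OF assms(1,2) q(1)] x by blast
    then have "h (?x \<otimes>\<^bsub>G\<^esub> inv\<^bsub>G\<^esub> x) = \<one>\<^bsub>M\<^esub>"
      using ker x x' by simp
    then show ?thesis
      using hom_eq_iff_quotient_one[OF assms(1,3,5) x'(1) x] by (simp add: k_def)
  qed
  have "k \<in> hom H M"
  proof (rule homI)
    fix y assume "y \<in> carrier H"
    then obtain x where "x \<in> carrier G" "y = q x" using q by blast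
    then show "k y \<in> carrier M" using kq assms(5) hom_in_carrier by metis
  next
    fix y z assume "y \<in> carrier H" "z \<in> carrier H"
    then obtain u v where *: "u \<in> carrier G" "y = q u" "v \<in> carrier G" "z = q v"
      using q by blast
    then have "y \<otimes>\<^bsub>H\<^esub> z = q (u \<otimes>\<^bsub>G\<^esub> v)"
      using q by (simp add: hom_mult)
    then show "k (y \<otimes>\<^bsub>H\<^esub> z) = k y \<otimes>\<^bsub>M\<^esub> k z"
      using * kq assms(5) by (simp add: hom_mult)
  qed
  then show ?thesis using kq that by blast
qed

lemma isoI_comm_group:
  assumes "comm_group G" "comm_group H" "h \<in> hom G H"
    and "\<And>x. \<lbrakk>x \<in> carrier G; h x = \<one>\<^bsub>H\<^esub>\<rbrakk> \<Longrightarrow> x = \<one>\<^bsub>G\<^esub>"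
    and "\<And>y. y \<in> carrier H \<Longrightarrow> \<exists>x\<in>carrier G. h x = y"
  shows "h \<in> iso G H"
proof -
  interpret group_hom G H h
    using assms by (simp add: group_hom_def group_hom_axioms_def comm_group.axioms(2))
  show ?thesis
    unfolding iso_iff using assms by (auto simp: inj_on_one_iff image_iff intro: hom_in_carrier)
qed

subsection \<open>Homomorphism groups and \<open>Ext\<close>\<close>

lemma carrier_hom_group: "h \<in> carrier (hom_group G M) \<longleftrightarrow> h \<in> hom G M \<and> h \<in> extensional (carrier G)"
  by (simp add: hom_group_def)

lemma mult_hom_group: "h \<otimes>\<^bsub>hom_group G M\<^esub> k = (\<lambda>x\<in>carrier G. h x \<otimes>\<^bsub>M\<^esub> k x)"
  by (simp add: hom_group_def)

lemma one_hom_group: "\<one>\<^bsub>hom_group G M\<^esub> = (\<lambda>x\<in>carrier G. \<one>\<^bsub>M\<^esub>)"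
  by (simp add: hom_group_def)

lemma restrict_in_hom_group:
  assumes "monoid G" "h \<in> hom G M"
  shows "restrict h (carrier G) \<in> carrier (hom_group G M)"
  using assms by (auto simp: carrier_hom_group hom_def monoid.m_closed)

lemma comm_group_hom_group:
  assumes "group G" "comm_group M"
  shows "comm_group (hom_group G M)"
proof -
  interpret G: group G by fact
  interpret M: comm_group M by fact
  have hom: "h x \<in> carrier M" if "h \<in> carrier (hom_group G M)" "x \<in> carrier G" for h x
    using that by (auto simp: carrier_hom_group hom_def)
  show ?thesis
  proof (rule comm_groupI)
    fix h k assume hk: "h \<in> carrier (hom_group G M)" "k \<in> carrier (hom_group G M)"
    then show "h \<otimes>\<^bsub>hom_group G M\<^esub> k \<in> carrier (hom_group G M)"
      unfolding mult_hom_group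
      by (intro restrict_in_hom_group G.is_monoid homI)
        (auto simp: carrier_hom_group hom_mult hom_in_carrier M.m_ac)
    show "h \<otimes>\<^bsub>hom_group G M\<^esub> k = k \<otimes>\<^bsub>hom_group G M\<^esub> h"
      using hk hom by (auto simp: mult_hom_group M.m_comm intro!: restrict_ext)
  next
    show "\<one>\<^bsub>hom_group G M\<^esub> \<in> carrier (hom_group G M)"
      unfolding one_hom_group by (intro restrict_in_hom_group G.is_monoid homI) auto
  next
    fix h k l
    assume "h \<in> carrier (hom_group G M)" "k \<in> carrier (hom_group G M)" "l \<in> carrier (hom_group G M)"
    then show "h \<otimes>\<^bsub>hom_group G M\<^esub> k \<otimes>\<^bsub>hom_group G M\<^esub> l
        = h \<otimes>\<^bsub>hom_group G M\<^esub> (k \<otimes>\<^bsub>hom_group G M\<^esub> l)"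
      using hom by (auto simp: mult_hom_group M.m_assoc intro!: restrict_ext)
  next
    fix h assume h: "h \<in> carrier (hom_group G M)"
    then show "\<one>\<^bsub>hom_group G M\<^esub> \<otimes>\<^bsub>hom_group G M\<^esub> h = h"
      using hom[OF h] by (auto simp: mult_hom_group one_hom_group carrier_hom_group extensional_def)
    let ?k = "\<lambda>x\<in>carrier G. inv\<^bsub>M\<^esub> h x"
    have "?k \<in> carrier (hom_group G M)"
      using h by (intro restrict_in_hom_group G.is_monoid homI)
        (auto simp: carrier_hom_group hom_mult hom_in_carrier M.inv_mult)
    moreover have "?k \<otimes>\<^bsub>hom_group G M\<^esub> h = \<one>\<^bsub>hom_group G M\<^esub>"
      using hom[OF h] by (auto simp: mult_hom_group one_hom_group)
    ultimately show "\<exists>k\<in>carrier (hom_group G M). k \<otimes>\<^bsub>hom_group G M\<^esub> h = \<one>\<^bsub>hom_group G M\<^esub>"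
      by blast
  qed
qed

lemma inv_hom_group:
  assumes "group G" "comm_group M" and h: "h \<in> carrier (hom_group G M)"
  shows "inv\<^bsub>hom_group G M\<^esub> h = (\<lambda>x\<in>carrier G. inv\<^bsub>M\<^esub> h x)"
proof -
  interpret G: group G by fact
  interpret M: comm_group M by fact
  interpret H: comm_group "hom_group G M" by (rule comm_group_hom_group[OF assms(1,2)])
  have hom: "h x \<in> carrier M" if "x \<in> carrier G" for x
    using that h by (auto simp: carrier_hom_group hom_def)
  have "(\<lambda>x\<in>carrier G. inv\<^bsub>M\<^esub> h x) \<in> carrier (hom_group G M)"
    using h by (intro restrict_in_hom_group G.is_monoid homI)
      (auto simp: carrier_hom_group hom_mult hom_in_carrier M.inv_mult)
  then show ?thesis
    using h hom by (intro H.inv_equality) (auto simp: mult_hom_group one_hom_group)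
qed

section \<open>Linear extension from free abelian groups\<close>

lemma lin_ext_superset:
  assumes "comm_group M" "s \<in> A \<rightarrow> carrier M" "finite A" "Poly_Mapping.keys x \<subseteq> A"
  shows "lin_ext M s x = finprod M (\<lambda>c. s c [^]\<^bsub>M\<^esub> Poly_Mapping.lookup x c) A"
proof -
  interpret M: comm_group M by fact
  show ?thesis
    unfolding lin_ext_def
    by (rule M.finprod_mono_neutral_cong_left) (use assms in \<open>auto simp: in_keys_iff\<close>)
qed

text \<open>The supports of x, y and x + y differ, so all three products are taken over the union of
  the first two; the extra factors have exponent zero.\<close>

lemma lin_ext_hom:
  assumes "comm_group M" "s \<in> S \<rightarrow> carrier M"
  shows "lin_ext M s \<in> hom (free_Abelian_group S) M"
proof -
  interpret M: comm_group M by fact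
  show ?thesis
  proof (rule homI)
    fix x assume "x \<in> carrier (free_Abelian_group S)"
    then show "lin_ext M s x \<in> carrier M"
      using assms(2) by (auto simp: lin_ext_def intro!: M.finprod_closed)
  next
    fix x y assume xy: "x \<in> carrier (free_Abelian_group S)" "y \<in> carrier (free_Abelian_group S)"
    let ?A = "Poly_Mapping.keys x \<union> Poly_Mapping.keys y"
    have s: "s \<in> ?A \<rightarrow> carrier M" using xy assms(2) by auto
    have "lin_ext M s (x + y) = finprod M (\<lambda>c. s c [^]\<^bsub>M\<^esub> Poly_Mapping.lookup (x + y) c) ?A"
      by (rule lin_ext_superset[OF assms(1) s]) (use keys_add[of x y] in auto)
    also have "\<dots> = finprod M (\<lambda>c. s c [^]\<^bsub>M\<^esub> Poly_Mapping.lookup x c \<otimes>\<^bsub>M\<^esub> s c [^]\<^bsub>M\<^esub> Poly_Mapping.lookup y c) ?A"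
      by (rule M.finprod_cong') (use s in \<open>auto simp: lookup_add M.int_pow_mult Pi_iff\<close>)
    also have "\<dots> = finprod M (\<lambda>c. s c [^]\<^bsub>M\<^esub> Poly_Mapping.lookup x c) ?A
        \<otimes>\<^bsub>M\<^esub> finprod M (\<lambda>c. s c [^]\<^bsub>M\<^esub> Poly_Mapping.lookup y c) ?A"
      by (rule M.finprod_multf) (use s in auto)
    also have "\<dots> = lin_ext M s x \<otimes>\<^bsub>M\<^esub> lin_ext M s y"
      using lin_ext_superset[OF assms(1) s, of x] lin_ext_superset[OF assms(1) s, of y] by simp
    finally show "lin_ext M s (x \<otimes>\<^bsub>free_Abelian_group S\<^esub> y) = lin_ext M s x \<otimes>\<^bsub>M\<^esub> lin_ext M s y"
      by simp
  qed
qed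

lemma lin_ext_frag_of:
  assumes "comm_group M" "s c \<in> carrier M"
  shows "lin_ext M s (frag_of c) = s c"
proof -
  interpret M: comm_group M by fact
  show ?thesis
    using assms(2) M.finprod_insert[of "{}" c "\<lambda>c. s c"] by (simp add: lin_ext_def)
qed

lemma free_hom_diff:
  assumes "comm_group M" "h \<in> hom (free_Abelian_group S) M"
    and "Poly_Mapping.keys x \<subseteq> S" "Poly_Mapping.keys y \<subseteq> S"
  shows "h (x - y) = h x \<otimes>\<^bsub>M\<^esub> inv\<^bsub>M\<^esub> h y"
proof -
  have "h (x \<otimes>\<^bsub>free_Abelian_group S\<^esub> inv\<^bsub>free_Abelian_group S\<^esub> y) = h x \<otimes>\<^bsub>M\<^esub> inv\<^bsub>M\<^esub> h y"
    using assms group.inv_closed[OF group_free_Abelian_group, of y S]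
      hom_inv_comm[OF abelian_free_Abelian_group assms(1,2), of y]
    by (simp only: hom_mult[OF assms(2)] carrier_free_Abelian_group_iff)
  then show ?thesis using assms by simp
qed

text \<open>Induction on a free abelian group passes through differences, which homomorphisms
  respect. Identities between linear extensions are reduced to \<open>frag_of c\<close> in this way
  throughout.\<close>

lemma free_hom_eqI:
  assumes "comm_group M" "h \<in> hom (free_Abelian_group S) M" "k \<in> hom (free_Abelian_group S) M"
    and "\<And>c. c \<in> S \<Longrightarrow> h (frag_of c) = k (frag_of c)" and "Poly_Mapping.keys x \<subseteq> S"
  shows "h x = k x"
proof (rule free_Abelian_group_induct[OF assms(5), of "\<lambda>x. h x = k x"])
  have "group (free_Abelian_group S)" "group M"
    using assms(1) by (simp_all add: comm_group.axioms(2))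
  then show "h 0 = k 0"
    using hom_one[OF assms(2)] hom_one[OF assms(3)] by simp
next
  fix x y
  assume "Poly_Mapping.keys x \<subseteq> S" "Poly_Mapping.keys y \<subseteq> S" "h x = k x" "h y = k y"
  then show "h (x - y) = k (x - y)"
    using free_hom_diff[OF assms(1,2)] free_hom_diff[OF assms(1,3)] by simp
qed (use assms(4) in auto)

section \<open>The standard resolution and classes in Ext\<close>

lemma carrier_res1:
  "r \<in> carrier (res1 C) \<longleftrightarrow> Poly_Mapping.keys r \<subseteq> carrier C \<and> lin_ext C (\<lambda>c. c) r = \<one>\<^bsub>C\<^esub>"
  by (simp add: res1_def res0_def kernel_def)

lemma mult_res1 [simp]: "x \<otimes>\<^bsub>res1 C\<^esub> y = x + y"
  by (simp add: res1_def res0_def)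

lemma one_res1 [simp]: "\<one>\<^bsub>res1 C\<^esub> = 0"
  by (simp add: res1_def res0_def)

lemma lin_ext_id_hom: "comm_group C \<Longrightarrow> lin_ext C (\<lambda>c. c) \<in> hom (free_Abelian_group (carrier C)) C"
  by (rule lin_ext_hom) auto

lemma subgroup_res1:
  assumes "comm_group C"
  shows "subgroup (carrier (res1 C)) (res0 C)"
proof -
  interpret group_hom "res0 C" C "lin_ext C (\<lambda>c. c)"
    using assms lin_ext_id_hom[OF assms]
    by (simp add: res0_def group_hom_def group_hom_axioms_def comm_group.axioms(2))
  show ?thesis using subgroup_kernel by (simp add: res1_def)
qed

lemma comm_group_res1:
  assumes "comm_group C"
  shows "comm_group (res1 C)"
proof -
  have "group (res1 C)"
    using subgroup.subgroup_is_group[OF subgroup_res1[OF assms]] by (simp add: res1_def res0_def)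
  then show ?thesis
    by (rule group.group_comm_groupI) (simp add: add.commute)
qed

lemma group_res1: "comm_group C \<Longrightarrow> group (res1 C)"
  using comm_group_res1 comm_group.axioms(2) by blast

lemma hom_res1: "h \<in> hom (free_Abelian_group (carrier C)) M \<Longrightarrow> h \<in> hom (res1 C) M"
  by (auto simp: hom_def carrier_res1)

text \<open>Members of \<open>hom_group\<close> are extensional, while linear extensions are not.
  Restricting to \<open>res0\<close> and then to \<open>res1\<close> agrees with restricting to
  \<open>res1\<close> at once, so any homomorphism g can witness a coboundary.\<close>

lemma ext1_cobd_iff:
  assumes "comm_group C" "comm_group M"
  shows "k \<in> ext1_cobd C M \<longleftrightarrow>
    (\<exists>g \<in> hom (free_Abelian_group (carrier C)) M. k = restrict g (carrier (res1 C)))"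
proof
  assume "k \<in> ext1_cobd C M"
  then show "\<exists>g \<in> hom (free_Abelian_group (carrier C)) M. k = restrict g (carrier (res1 C))"
    by (auto simp: ext1_cobd_def carrier_hom_group res0_def)
next
  assume "\<exists>g \<in> hom (free_Abelian_group (carrier C)) M. k = restrict g (carrier (res1 C))"
  then obtain g where g: "g \<in> hom (free_Abelian_group (carrier C)) M" "k = restrict g (carrier (res1 C))"
    by blast
  have "restrict g (carrier (res0 C)) \<in> carrier (hom_group (res0 C) M)"
    using g by (intro restrict_in_hom_group) (auto simp: res0_def group.is_monoid)
  moreover have "k = restrict (restrict g (carrier (res0 C))) (carrier (res1 C))"
    using g subgroup.subset[OF subgroup_res1[OF assms(1)]] by (auto simp: fun_eq_iff restrict_def)
  ultimately show "k \<in> ext1_cobd C M"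
    unfolding ext1_cobd_def by blast
qed

lemma subgroup_ext1_cobd:
  assumes "comm_group C" "comm_group M"
  shows "subgroup (ext1_cobd C M) (hom_group (res1 C) M)"
proof -
  have sub: "carrier (res1 C) \<subseteq> carrier (res0 C)"
    using subgroup.subset[OF subgroup_res1[OF assms(1)]] .
  have 0: "group (res0 C)" by (simp add: res0_def)
  have H0: "comm_group (hom_group (res0 C) M)" and H1: "comm_group (hom_group (res1 C) M)"
    using comm_group_hom_group[OF 0 assms(2)] comm_group_hom_group[OF group_res1[OF assms(1)] assms(2)] .
  have "(\<lambda>h. restrict h (carrier (res1 C))) \<in> hom (hom_group (res0 C) M) (hom_group (res1 C) M)"
  proof (rule homI)
    fix h assume "h \<in> carrier (hom_group (res0 C) M)"
    then show "restrict h (carrier (res1 C)) \<in> carrier (hom_group (res1 C) M)"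
      using group_res1[OF assms(1)]
      by (intro restrict_in_hom_group hom_res1) (auto simp: res0_def carrier_hom_group group.is_monoid)
  qed (use sub in \<open>auto simp: mult_hom_group fun_eq_iff\<close>)
  from subgroup_hom_image[OF _ _ this group.subgroup_self] show ?thesis
    using H0 H1 by (simp add: ext1_cobd_def comm_group.axioms(2))
qed

lemma comm_group_Ext1:
  assumes "comm_group C" "comm_group M"
  shows "comm_group (Ext1 C M)"
  unfolding Ext1_def
  by (rule comm_group.abelian_FactGroup[OF comm_group_hom_group subgroup_ext1_cobd])
    (use assms group_res1 in auto)

lemma ext1_class_hom:
  assumes "comm_group C" "comm_group M"
  shows "ext1_class C M \<in> hom (hom_group (res1 C) M) (Ext1 C M)"
  unfolding Ext1_def
  by (rule comm_group.r_coset_hom[OF comm_group_hom_group subgroup_ext1_cobd])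
    (use assms group_res1 in auto)

text \<open>The quotient of h and k is a coboundary; written pointwise on relations with k moved to
  the other side, this is the form in which cocycles are compared.\<close>

lemma ext1_class_eq_iff:
  assumes C: "comm_group C" and M: "comm_group M"
    and h: "h \<in> carrier (hom_group (res1 C) M)" and k: "k \<in> carrier (hom_group (res1 C) M)"
  shows "ext1_class C M h = ext1_class C M k \<longleftrightarrow>
    (\<exists>g \<in> hom (free_Abelian_group (carrier C)) M. \<forall>r\<in>carrier (res1 C). h r = g r \<otimes>\<^bsub>M\<^esub> k r)"
proof -
  interpret M: comm_group M by fact
  let ?H = "hom_group (res1 C) M"
  have H: "comm_group ?H" using comm_group_hom_group[OF group_res1] C M by blast
  have val: "h r \<in> carrier M" "k r \<in> carrier M" if "r \<in> carrier (res1 C)" for r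
    using h k that by (auto simp: carrier_hom_group hom_def)
  have quot: "h \<otimes>\<^bsub>?H\<^esub> inv\<^bsub>?H\<^esub> k = (\<lambda>r\<in>carrier (res1 C). h r \<otimes>\<^bsub>M\<^esub> inv\<^bsub>M\<^esub> k r)"
    using k by (auto simp: mult_hom_group inv_hom_group[OF group_res1[OF C] M])
  have *: "h r \<otimes>\<^bsub>M\<^esub> inv\<^bsub>M\<^esub> k r = g r \<longleftrightarrow> h r = g r \<otimes>\<^bsub>M\<^esub> k r"
    if "r \<in> carrier (res1 C)" "g \<in> hom (free_Abelian_group (carrier C)) M" for r g
  proof -
    have "g r \<in> carrier M"
      using that hom_res1 hom_in_carrier by metis
    then show ?thesis
      using val[OF that(1)] by (metis M.inv_solve_right)
  qed
  have "ext1_class C M h = ext1_class C M k \<longleftrightarrow> h \<otimes>\<^bsub>?H\<^esub> inv\<^bsub>?H\<^esub> k \<in> ext1_cobd C M"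
    by (rule comm_group.r_coset_eq_iff[OF H subgroup_ext1_cobd[OF C M] h k])
  also have "\<dots> \<longleftrightarrow> (\<exists>g \<in> hom (free_Abelian_group (carrier C)) M.
      \<forall>r\<in>carrier (res1 C). h r \<otimes>\<^bsub>M\<^esub> inv\<^bsub>M\<^esub> k r = g r)"
    unfolding ext1_cobd_iff[OF C M] quot by (auto simp: fun_eq_iff restrict_def)
  finally show ?thesis using * by auto
qed

lemma ext1_class_rep:
  assumes "comm_group C" "comm_group M" "X \<in> carrier (Ext1 C M)"
  obtains h where "h \<in> carrier (hom_group (res1 C) M)" "X = ext1_class C M h"
  using assms(3) by (auto simp: Ext1_def carrier_FactGroup)

text \<open>On generators, p after the lift is the identity of C, so on all chains it is the
  augmentation to C. On relations it is therefore trivial, and the lift lands in the kernel of p,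
  which is the image of i. Injectivity of i makes the resulting map \<open>l\<close>
  additive.\<close>

lemma ses_lift:
  assumes ses: "is_ses A B C i p"
  defines "l \<equiv> (\<lambda>r. inv_into (carrier A) i (lin_ext B (inv_into (carrier B) p) r))"
  shows "lin_ext B (inv_into (carrier B) p) \<in> hom (free_Abelian_group (carrier C)) B"
    and "l \<in> hom (res1 C) A"
    and "r \<in> carrier (res1 C) \<Longrightarrow> i (l r) = lin_ext B (inv_into (carrier B) p) r"
proof -
  let ?L = "lin_ext B (inv_into (carrier B) p)"
  have A: "comm_group A" and B: "comm_group B" and C: "comm_group C"
    and i: "i \<in> hom A B" "inj_on i (carrier A)"
    and p: "p \<in> hom B C" "p ` carrier B = carrier C" and ker: "kernel B C p = i ` carrier A"
    using ses by (auto simp: is_ses_def mon_def epi_def)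
  interpret A: comm_group A by fact
  have s: "inv_into (carrier B) p \<in> carrier C \<rightarrow> carrier B"
    using p(2) by (auto intro: inv_into_into)
  show L: "?L \<in> hom (free_Abelian_group (carrier C)) B"
    by (rule lin_ext_hom[OF B s])
  have pL: "p (?L r) = lin_ext C (\<lambda>c. c) r" if "Poly_Mapping.keys r \<subseteq> carrier C" for r
  proof -
    have "(p \<circ> ?L) r = lin_ext C (\<lambda>c. c) r"
    proof (rule free_hom_eqI[OF C Group.hom_compose[OF L p(1)] lin_ext_id_hom[OF C] _ that])
      fix c assume c: "c \<in> carrier C"
      then show "(p \<circ> ?L) (frag_of c) = lin_ext C (\<lambda>c. c) (frag_of c)"
        using lin_ext_frag_of[OF B, of "inv_into (carrier B) p" c] lin_ext_frag_of[OF C, of "\<lambda>c. c" c] s p(2)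
        by (simp add: f_inv_into_f Pi_iff)
    qed
    then show ?thesis by simp
  qed
  have im: "?L r \<in> i ` carrier A" if "r \<in> carrier (res1 C)" for r
  proof -
    have "?L r \<in> kernel B C p"
      using that pL[of r] L by (auto simp: carrier_res1 kernel_def hom_def)
    then show ?thesis using ker by simp
  qed
  show il: "i (l r) = ?L r" if "r \<in> carrier (res1 C)" for r
    unfolding l_def by (rule f_inv_into_f[OF im[OF that]])
  have l_in: "l r \<in> carrier A" if "r \<in> carrier (res1 C)" for r
    unfolding l_def by (rule inv_into_into[OF im[OF that]])
  show "l \<in> hom (res1 C) A"
  proof (rule homI)
    fix x y assume xy: "x \<in> carrier (res1 C)" "y \<in> carrier (res1 C)"
    have xy': "x + y \<in> carrier (res1 C)"
      using xy group_res1[OF C] monoid.m_closed[of "res1 C" x y] by (simp add: group.is_monoid)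
    have "i (l (x + y)) = ?L x \<otimes>\<^bsub>B\<^esub> ?L y"
      using il[OF xy'] xy hom_mult[OF L, of x y] by (simp add: carrier_res1)
    also have "\<dots> = i (l x \<otimes>\<^bsub>A\<^esub> l y)"
      using il xy l_in i(1) by (simp add: hom_mult)
    finally show "l (x \<otimes>\<^bsub>res1 C\<^esub> y) = l x \<otimes>\<^bsub>A\<^esub> l y"
      using i(2) l_in xy xy' by (simp add: inj_on_eq_iff)
  qed (rule l_in)
qed

text \<open>On cocycles the map is precomposition with the fixed homomorphism \<open>l\<close> of
  \<open>ses_lift\<close>; the section of p enters only through \<open>l\<close>, so additivity in h
  is pointwise.\<close>

theorem connecting_contra_hom:
  fixes A :: "('a, 'm) monoid_scheme" and M :: "('d, 'l) monoid_scheme"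
  assumes ses: "is_ses A B C i p" and M: "comm_group M"
  shows "connecting_contra A B C i p M \<in> hom (hom_group A M) (Ext1 C M)"
proof -
  have C: "comm_group C" and A: "comm_group A"
    using ses by (auto simp: is_ses_def)
  define l where "l r = inv_into (carrier A) i (lin_ext B (inv_into (carrier B) p) r)" for r
  have l: "l \<in> hom (res1 C) A"
    using ses_lift(2)[OF ses] by (simp add: l_def[abs_def])
  define c where "c h = (\<lambda>r\<in>carrier (res1 C). h (l r))" for h :: "'a \<Rightarrow> 'd"
  have c: "c h \<in> carrier (hom_group (res1 C) M)" if "h \<in> carrier (hom_group A M)" for h
    unfolding c_def
  proof (rule restrict_in_hom_group)
    show "(\<lambda>r. h (l r)) \<in> hom (res1 C) M"
      using Group.hom_compose[OF l, of h M] that by (simp add: carrier_hom_group comp_def)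
  qed (use group_res1[OF C] in \<open>simp add: group.is_monoid\<close>)
  have "c \<in> hom (hom_group A M) (hom_group (res1 C) M)"
    by (rule homI[OF c]) (use hom_in_carrier[OF l] in \<open>auto simp: c_def mult_hom_group fun_eq_iff restrict_def\<close>)
  from Group.hom_compose[OF this ext1_class_hom[OF C M]] show ?thesis
    by (simp add: connecting_contra_def[abs_def] comp_def c_def l_def cong: restrict_cong)
qed


subsection \<open>The dual of a torsion group\<close>

lemma rat_group_simps [simp]:
  "carrier rat_group = UNIV" "x \<otimes>\<^bsub>rat_group\<^esub> y = x + y" "\<one>\<^bsub>rat_group\<^esub> = 0"
  by (simp_all add: rat_group_def)

lemma comm_group_rat_group: "comm_group rat_group"
  by (rule comm_groupI) (auto intro: exI[of _ "- _"])

lemma inv_rat_group [simp]: "inv\<^bsub>rat_group\<^esub> x = - x"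
  by (rule group.inv_equality[OF comm_group.axioms(2)[OF comm_group_rat_group]]) auto

lemma subgroup_Ints_rat_group: "subgroup \<int> rat_group"
  by (rule group.subgroupI[OF comm_group.axioms(2)[OF comm_group_rat_group]]) auto

lemma comm_group_rat_mod_int: "comm_group rat_mod_int"
  unfolding rat_mod_int_def
  by (rule comm_group.abelian_FactGroup[OF comm_group_rat_group subgroup_Ints_rat_group])

lemma rat_class_hom: "rat_class \<in> hom rat_group rat_mod_int"
  unfolding rat_mod_int_def
  by (rule comm_group.r_coset_hom[OF comm_group_rat_group subgroup_Ints_rat_group])

lemma rat_class_eq_iff: "rat_class x = rat_class y \<longleftrightarrow> x - y \<in> \<int>"
  using comm_group.r_coset_eq_iff[OF comm_group_rat_group subgroup_Ints_rat_group, of x y] by simp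

lemma rat_class_eq_one_iff: "rat_class x = \<one>\<^bsub>rat_mod_int\<^esub> \<longleftrightarrow> x \<in> \<int>"
proof -
  have "rat_class 0 = \<one>\<^bsub>rat_mod_int\<^esub>"
    using hom_one[OF rat_class_hom] comm_group.axioms(2)[OF comm_group_rat_group]
      comm_group.axioms(2)[OF comm_group_rat_mod_int] by simp
  then show ?thesis using rat_class_eq_iff[of x 0] by simp
qed

lemma rat_class_surj: "X \<in> carrier rat_mod_int \<Longrightarrow> \<exists>q. rat_class q = X"
  by (auto simp: rat_mod_int_def carrier_FactGroup)

lemma rat_class_in_carrier [simp]: "rat_class q \<in> carrier rat_mod_int"
  by (auto simp: rat_mod_int_def carrier_FactGroup)

lemma rat_class_add: "rat_class (x + y) = rat_class x \<otimes>\<^bsub>rat_mod_int\<^esub> rat_class y"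
  using hom_mult[OF rat_class_hom, of x y] by simp

lemma of_int_hom: "h \<in> hom G integer_group \<Longrightarrow> (\<lambda>x. rat_of_int (h x)) \<in> hom G rat_group"
  by (simp add: hom_def)

lemma lin_ext_rat_hom: "lin_ext rat_group s \<in> hom (free_Abelian_group S) rat_group"
  by (rule lin_ext_hom[OF comm_group_rat_group]) auto

lemma lin_ext_rat_frag_of [simp]: "lin_ext rat_group s (frag_of c) = s c"
  by (rule lin_ext_frag_of[OF comm_group_rat_group]) auto

text \<open>The linear extension of the integer function s - t is a homomorphism g on all chains,
  and g plus the extension of t is the extension of s. Hence h and k differ by the coboundary of
  g.\<close>

lemma ext1_class_int_eqI:
  assumes C: "comm_group C"
    and h: "h \<in> carrier (hom_group (res1 C) integer_group)"
    and k: "k \<in> carrier (hom_group (res1 C) integer_group)"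
    and s: "\<And>c. c \<in> carrier C \<Longrightarrow> s c - t c \<in> \<int>"
    and hs: "\<And>r. r \<in> carrier (res1 C) \<Longrightarrow> of_int (h r) = lin_ext rat_group s r"
    and kt: "\<And>r. r \<in> carrier (res1 C) \<Longrightarrow> of_int (k r) = lin_ext rat_group t r"
  shows "ext1_class C integer_group h = ext1_class C integer_group k"
proof -
  let ?F = "free_Abelian_group (carrier C)"
  define g where "g = lin_ext integer_group (\<lambda>c. \<lfloor>s c - t c\<rfloor>)"
  have g: "g \<in> hom ?F integer_group"
    unfolding g_def by (rule lin_ext_hom[OF abelian_integer_group]) auto
  have gst: "rat_of_int (g r) + lin_ext rat_group t r = lin_ext rat_group s r"
    if "Poly_Mapping.keys r \<subseteq> carrier C" for r
  proof (rule free_hom_eqI[OF comm_group_rat_group _ lin_ext_rat_hom _ that])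
    show "(\<lambda>r. rat_of_int (g r) + lin_ext rat_group t r) \<in> hom ?F rat_group"
      using of_int_hom[OF g] lin_ext_rat_hom[of t "carrier C"] by (simp add: hom_def)
    fix c assume "c \<in> carrier C"
    then show "rat_of_int (g (frag_of c)) + lin_ext rat_group t (frag_of c) = lin_ext rat_group s (frag_of c)"
      using s[of c] lin_ext_frag_of[OF abelian_integer_group, of "\<lambda>c. \<lfloor>s c - t c\<rfloor>" c]
      by (simp add: g_def)
  qed
  have "h r = g r + k r" if "r \<in> carrier (res1 C)" for r
  proof -
    have "rat_of_int (h r) = rat_of_int (g r + k r)"
      using that gst[of r] hs kt by (simp add: carrier_res1)
    then show ?thesis by linarith
  qed
  then show ?thesis
    using g by (subst ext1_class_eq_iff[OF C abelian_integer_group h k]) auto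
qed

text \<open>Modulo \<int>, the extension of s is \<chi> composed with the augmentation to C, which
  is trivial on relations.\<close>

lemma lin_ext_rat_res1_Ints:
  assumes C: "comm_group C" and \<chi>: "\<chi> \<in> hom C rat_mod_int"
    and s: "\<forall>c\<in>carrier C. rat_class (s c) = \<chi> c" and r: "r \<in> carrier (res1 C)"
  shows "lin_ext rat_group s r \<in> \<int>"
proof -
  have "(rat_class \<circ> lin_ext rat_group s) r = (\<chi> \<circ> lin_ext C (\<lambda>c. c)) r"
  proof (rule free_hom_eqI[OF comm_group_rat_mod_int])
    show "rat_class \<circ> lin_ext rat_group s \<in> hom (free_Abelian_group (carrier C)) rat_mod_int"
      by (rule Group.hom_compose[OF lin_ext_rat_hom rat_class_hom])
    show "\<chi> \<circ> lin_ext C (\<lambda>c. c) \<in> hom (free_Abelian_group (carrier C)) rat_mod_int"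
      by (rule Group.hom_compose[OF lin_ext_id_hom[OF C] \<chi>])
  qed (use s r lin_ext_frag_of[OF C, of "\<lambda>c. c"] in \<open>auto simp: carrier_res1\<close>)
  also have "\<dots> = \<one>\<^bsub>rat_mod_int\<^esub>"
    using r hom_one[OF \<chi>] C comm_group_rat_mod_int by (simp add: carrier_res1 comm_group.axioms(2))
  finally show ?thesis by (simp add: rat_class_eq_one_iff)
qed

text \<open>The floor only changes the type: values on relations are already integral, so it is
  exact there and additivity survives. Off the relations it would not be additive.\<close>

lemma floor_lin_ext_cocycle:
  assumes C: "comm_group C" and \<chi>: "\<chi> \<in> hom C rat_mod_int"
    and s: "\<forall>c\<in>carrier C. rat_class (s c) = \<chi> c"
  defines "h \<equiv> (\<lambda>r\<in>carrier (res1 C). \<lfloor>lin_ext rat_group s r\<rfloor>)"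
  shows "h \<in> carrier (hom_group (res1 C) integer_group)"
    and "\<forall>r\<in>carrier (res1 C). of_int (h r) = lin_ext rat_group s r"
proof -
  have int: "rat_of_int \<lfloor>lin_ext rat_group s r\<rfloor> = lin_ext rat_group s r" if "r \<in> carrier (res1 C)" for r
    using lin_ext_rat_res1_Ints[OF C \<chi> s that] by simp
  show "\<forall>r\<in>carrier (res1 C). of_int (h r) = lin_ext rat_group s r"
    using int by (simp add: h_def)
  have "(\<lambda>r. \<lfloor>lin_ext rat_group s r\<rfloor>) \<in> hom (res1 C) integer_group"
  proof (rule homI)
    fix x y assume xy: "x \<in> carrier (res1 C)" "y \<in> carrier (res1 C)"
    then have "x + y \<in> carrier (res1 C)"
      using group_res1[OF C] monoid.m_closed[of "res1 C" x y] by (simp add: group.is_monoid)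
    moreover have "lin_ext rat_group s (x + y) = lin_ext rat_group s x + lin_ext rat_group s y"
      using hom_mult[OF lin_ext_rat_hom, of x "carrier C" y s] xy by (simp add: carrier_res1)
    ultimately have "rat_of_int \<lfloor>lin_ext rat_group s (x + y)\<rfloor>
        = rat_of_int (\<lfloor>lin_ext rat_group s x\<rfloor> + \<lfloor>lin_ext rat_group s y\<rfloor>)"
      using int[of "x + y"] int[OF xy(1)] int[OF xy(2)] by (simp del: of_int_floor_cancel)
    then show "\<lfloor>lin_ext rat_group s (x \<otimes>\<^bsub>res1 C\<^esub> y)\<rfloor>
        = \<lfloor>lin_ext rat_group s x\<rfloor> \<otimes>\<^bsub>integer_group\<^esub> \<lfloor>lin_ext rat_group s y\<rfloor>"
      by (simp only: of_int_eq_iff mult_res1 mult_integer_group)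
  qed simp
  then show "h \<in> carrier (hom_group (res1 C) integer_group)"
    unfolding h_def using group_res1[OF C] by (intro restrict_in_hom_group) (auto simp: group.is_monoid)
qed

text \<open>The definition lifts \<chi> to the rationals by \<open>inv_into\<close>. Any other lift
  s differs from that one by integers, so by \<open>ext1_class_int_eqI\<close> it gives the same
  class; later proofs choose s to suit.\<close>

lemma dual_to_Ext1_eqI:
  assumes C: "comm_group C" and \<chi>: "\<chi> \<in> hom C rat_mod_int"
    and s: "\<forall>c\<in>carrier C. rat_class (s c) = \<chi> c"
    and h: "h \<in> carrier (hom_group (res1 C) integer_group)"
    and hs: "\<forall>r\<in>carrier (res1 C). of_int (h r) = lin_ext rat_group s r"
  shows "dual_to_Ext1 C \<chi> = ext1_class C integer_group h"
proof -
  let ?t = "\<lambda>c. inv_into UNIV rat_class (\<chi> c)"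
  have t: "\<forall>c\<in>carrier C. rat_class (?t c) = \<chi> c"
    using rat_class_surj[OF hom_in_carrier[OF \<chi>]] by (metis UNIV_I f_inv_into_f image_eqI)
  \<comment> \<open>The definition recovers an integer by inverting the inclusion into the
    rationals; at the integral values taken on relations this inverse is the floor.\<close>
  have fl: "inv_into UNIV rat_of_int (lin_ext rat_group ?t r) = \<lfloor>lin_ext rat_group ?t r\<rfloor>"
    if r: "r \<in> carrier (res1 C)" for r
  proof -
    have "inj rat_of_int" by (simp add: inj_on_def)
    moreover obtain m where "lin_ext rat_group ?t r = of_int m"
      using lin_ext_rat_res1_Ints[OF C \<chi> t r] by (rule Ints_cases)
    ultimately show ?thesis by simp
  qed
  have "dual_to_Ext1 C \<chi> = ext1_class C integer_group (\<lambda>r\<in>carrier (res1 C). \<lfloor>lin_ext rat_group ?t r\<rfloor>)"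
    using fl by (simp add: dual_to_Ext1_def connecting_co_def cong: restrict_cong)
  also have "\<dots> = ext1_class C integer_group h"
    by (rule ext1_class_int_eqI[OF C floor_lin_ext_cocycle(1)[OF C \<chi> t] h, of ?t s])
      (use s t hs floor_lin_ext_cocycle(2)[OF C \<chi> t] in \<open>auto simp flip: rat_class_eq_iff\<close>)
  finally show ?thesis .
qed

lemma hom_rat_pow:
  assumes "group G" "h \<in> hom G rat_group" "x \<in> carrier G"
  shows "h (x [^]\<^bsub>G\<^esub> (n::nat)) = of_nat n * h x"
proof (induction n)
  case 0
  then show ?case
    using hom_one[OF assms(2)] assms comm_group.axioms(2)[OF comm_group_rat_group] by simp
next
  case (Suc n)
  then show ?case
    using hom_mult[OF assms(2)] assms
    by (simp add: group.is_monoid monoid.nat_pow_closed algebra_simps)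
qed

text \<open>The augmentation sends n[c] to the n-th power of c. These relations are where cocycles
  see torsion.\<close>

lemma frag_cmul_res1:
  assumes "comm_group C" "c \<in> carrier C" "c [^]\<^bsub>C\<^esub> (n::nat) = \<one>\<^bsub>C\<^esub>"
  shows "frag_cmul (int n) (frag_of c) \<in> carrier (res1 C)"
proof -
  have "lin_ext C (\<lambda>c. c) (frag_of c [^]\<^bsub>free_Abelian_group (carrier C)\<^esub> n) = lin_ext C (\<lambda>c. c) (frag_of c) [^]\<^bsub>C\<^esub> n"
    using assms group_hom.hom_nat_pow[of "free_Abelian_group (carrier C)" C "lin_ext C (\<lambda>c. c)" "frag_of c" n]
      lin_ext_id_hom[OF assms(1)]
    by (simp add: group_hom_def group_hom_axioms_def comm_group.axioms(2))
  then have "lin_ext C (\<lambda>c. c) (frag_cmul (int n) (frag_of c)) = \<one>\<^bsub>C\<^esub>"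
    using assms lin_ext_frag_of[OF assms(1), of "\<lambda>c. c" c] by simp
  moreover have "Poly_Mapping.keys (frag_cmul (int n) (frag_of c)) \<subseteq> carrier C"
    using keys_cmul[of "int n" "frag_of c"] assms by auto
  ultimately show ?thesis by (simp add: carrier_res1)
qed

text \<open>Torsion puts a multiple of every chain into the relations, so a cocycle determines a
  unique rational linear extension to all chains. If the cocycle is a coboundary, this extension is
  integral and the character is trivial; conversely, the extension of an arbitrary integral cocycle,
  read modulo \<int> on generators, is a character that maps to it.\<close>

theorem dual_to_Ext1_iso:
  assumes C: "comm_group C"
    and tors: "\<And>c. c \<in> carrier C \<Longrightarrow> \<exists>n::nat. n \<ge> 1 \<and> c [^]\<^bsub>C\<^esub> n = \<one>\<^bsub>C\<^esub>"
  shows "dual_to_Ext1 C \<in> iso (hom_group C rat_mod_int) (Ext1 C integer_group)"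
proof -
  interpret C: comm_group C by fact
  let ?E = "Ext1 C integer_group" and ?F = "free_Abelian_group (carrier C)"
  let ?H = "hom_group (res1 C) integer_group"
  note Z = abelian_integer_group
  have lift: "\<exists>s. (\<forall>c\<in>carrier C. rat_class (s c) = \<chi> c)" if "\<chi> \<in> hom C rat_mod_int" for \<chi>
    by (intro bchoice ballI) (use rat_class_surj hom_in_carrier[OF that] in blast)
  have R1: "comm_group (res1 C)" by (rule comm_group_res1[OF C])
  interpret R1: comm_group "res1 C" by fact
  have pow_res1: "x [^]\<^bsub>res1 C\<^esub> n = frag_cmul (int n) x" for x and n :: nat
    by (induction n) (auto simp: frag_cmul_distrib)
  show ?thesis
  proof (rule isoI_comm_group)
    show "comm_group (hom_group C rat_mod_int)"
      by (rule comm_group_hom_group[OF C.group_axioms comm_group_rat_mod_int])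
    show "comm_group ?E" by (rule comm_group_Ext1[OF C Z])
    show "dual_to_Ext1 C \<in> hom (hom_group C rat_mod_int) ?E"
    proof (rule homI)
      fix \<chi> assume "\<chi> \<in> carrier (hom_group C rat_mod_int)"
      then have \<chi>: "\<chi> \<in> hom C rat_mod_int" by (simp add: carrier_hom_group)
      obtain s where s: "\<forall>c\<in>carrier C. rat_class (s c) = \<chi> c" using lift[OF \<chi>] by blast
      define h where "h = (\<lambda>r\<in>carrier (res1 C). \<lfloor>lin_ext rat_group s r\<rfloor>)"
      note h = floor_lin_ext_cocycle[OF C \<chi> s, folded h_def]
      show "dual_to_Ext1 C \<chi> \<in> carrier ?E"
        using dual_to_Ext1_eqI[OF C \<chi> s h] hom_in_carrier[OF ext1_class_hom[OF C Z] h(1)] by simp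
    next
      fix \<chi> \<psi> assume "\<chi> \<in> carrier (hom_group C rat_mod_int)" "\<psi> \<in> carrier (hom_group C rat_mod_int)"
      then have \<chi>: "\<chi> \<in> hom C rat_mod_int" and \<psi>: "\<psi> \<in> hom C rat_mod_int"
        and \<chi>\<psi>: "\<chi> \<otimes>\<^bsub>hom_group C rat_mod_int\<^esub> \<psi> \<in> hom C rat_mod_int"
        using monoid.m_closed[OF group.is_monoid[OF comm_group.axioms(2)[OF
            comm_group_hom_group[OF C.group_axioms comm_group_rat_mod_int]]], of \<chi> \<psi>]
        by (auto simp: carrier_hom_group)
      obtain s t where s: "\<forall>c\<in>carrier C. rat_class (s c) = \<chi> c"
        and t: "\<forall>c\<in>carrier C. rat_class (t c) = \<psi> c" using lift[OF \<chi>] lift[OF \<psi>] by blast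
      define h k where "h = (\<lambda>r\<in>carrier (res1 C). \<lfloor>lin_ext rat_group s r\<rfloor>)"
        and "k = (\<lambda>r\<in>carrier (res1 C). \<lfloor>lin_ext rat_group t r\<rfloor>)"
      note h = floor_lin_ext_cocycle[OF C \<chi> s, folded h_def]
        and k = floor_lin_ext_cocycle[OF C \<psi> t, folded k_def]
      have lin: "lin_ext rat_group (\<lambda>c. s c + t c) r = lin_ext rat_group s r + lin_ext rat_group t r"
        if "Poly_Mapping.keys r \<subseteq> carrier C" for r
      proof (rule free_hom_eqI[OF comm_group_rat_group lin_ext_rat_hom _ _ that])
        show "(\<lambda>r. lin_ext rat_group s r + lin_ext rat_group t r) \<in> hom ?F rat_group"
          using lin_ext_rat_hom[of s "carrier C"] lin_ext_rat_hom[of t "carrier C"] by (simp add: hom_def)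
      qed simp
      have hk: "h \<otimes>\<^bsub>?H\<^esub> k \<in> carrier ?H"
        by (rule monoid.m_closed[OF _ h(1) k(1)])
          (rule group.is_monoid[OF comm_group.axioms(2)[OF comm_group_hom_group[OF group_res1[OF C] Z]]])
      have "dual_to_Ext1 C (\<chi> \<otimes>\<^bsub>hom_group C rat_mod_int\<^esub> \<psi>) = ext1_class C integer_group (h \<otimes>\<^bsub>?H\<^esub> k)"
        by (rule dual_to_Ext1_eqI[OF C \<chi>\<psi> _ hk, of "\<lambda>c. s c + t c"])
          (use lin h(2) k(2) s t in \<open>auto simp: mult_hom_group rat_class_add carrier_res1\<close>)
      also have "\<dots> = ext1_class C integer_group h \<otimes>\<^bsub>?E\<^esub> ext1_class C integer_group k"
        by (rule hom_mult[OF ext1_class_hom[OF C Z] h(1) k(1)])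
      also have "\<dots> = dual_to_Ext1 C \<chi> \<otimes>\<^bsub>?E\<^esub> dual_to_Ext1 C \<psi>"
        using dual_to_Ext1_eqI[OF C \<chi> s h] dual_to_Ext1_eqI[OF C \<psi> t k] by simp
      finally show "dual_to_Ext1 C (\<chi> \<otimes>\<^bsub>hom_group C rat_mod_int\<^esub> \<psi>)
          = dual_to_Ext1 C \<chi> \<otimes>\<^bsub>?E\<^esub> dual_to_Ext1 C \<psi>" .
    qed
  next
    fix \<chi> assume \<chi>_in: "\<chi> \<in> carrier (hom_group C rat_mod_int)" and one: "dual_to_Ext1 C \<chi> = \<one>\<^bsub>?E\<^esub>"
    then have \<chi>: "\<chi> \<in> hom C rat_mod_int" by (simp add: carrier_hom_group)
    obtain s where s: "\<forall>c\<in>carrier C. rat_class (s c) = \<chi> c" using lift[OF \<chi>] by blast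
    define h where "h = (\<lambda>r\<in>carrier (res1 C). \<lfloor>lin_ext rat_group s r\<rfloor>)"
    note h = floor_lin_ext_cocycle[OF C \<chi> s, folded h_def]
    have H: "comm_group ?H" by (rule comm_group_hom_group[OF group_res1[OF C] Z])
    have "ext1_class C integer_group h = ext1_class C integer_group \<one>\<^bsub>?H\<^esub>"
      using one dual_to_Ext1_eqI[OF C \<chi> s h] hom_one[OF ext1_class_hom[OF C Z]] H comm_group_Ext1[OF C Z]
      by (simp add: comm_group.axioms(2))
    then obtain g where g: "g \<in> hom ?F integer_group" "\<And>r. r \<in> carrier (res1 C) \<Longrightarrow> h r = g r"
      using ext1_class_eq_iff[OF C Z h(1), of "\<one>\<^bsub>?H\<^esub>"]
        monoid.one_closed[OF group.is_monoid[OF comm_group.axioms(2)[OF H]]]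
      by (auto simp: one_hom_group)
    have "\<chi> c = \<one>\<^bsub>rat_mod_int\<^esub>" if c: "c \<in> carrier C" for c
    proof -
      obtain n :: nat where n: "n \<ge> 1" "c [^]\<^bsub>C\<^esub> n = \<one>\<^bsub>C\<^esub>" using tors[OF c] by blast
      \<comment> \<open>Comparing h and g on the relation n[c] gives n s(c) = n g([c]), so s(c) is
        an integer.\<close>
      let ?r = "frag_cmul (int n) (frag_of c)"
      have r: "?r \<in> carrier (res1 C)" by (rule frag_cmul_res1[OF C c n(2)])
      have "rat_of_int (h ?r) = of_nat n * s c"
        using bspec[OF h(2) r] c hom_rat_pow[OF _ lin_ext_rat_hom, of "carrier C" "frag_of c" s n] by simp
      moreover have "rat_of_int (g ?r) = of_nat n * of_int (g (frag_of c))"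
        using c hom_rat_pow[OF _ of_int_hom[OF g(1)], of "frag_of c" n] by simp
      ultimately have "s c = of_int (g (frag_of c))"
        using g(2)[OF r] n(1) by simp
      then have "s c \<in> \<int>" by simp
      then show ?thesis using bspec[OF s c] rat_class_eq_one_iff by metis
    qed
    then show "\<chi> = \<one>\<^bsub>hom_group C rat_mod_int\<^esub>"
      using \<chi>_in by (auto simp: one_hom_group carrier_hom_group extensional_def fun_eq_iff)
  next
    fix X assume "X \<in> carrier ?E"
    then obtain g where g: "g \<in> carrier ?H" "X = ext1_class C integer_group g"
      using ext1_class_rep[OF C Z] by blast
    then have ghom: "g \<in> hom (res1 C) integer_group" by (simp add: carrier_hom_group)
    have gmul: "rat_of_int (g (frag_cmul (int n) r)) = of_nat n * of_int (g r)" if "r \<in> carrier (res1 C)" for n r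
      using hom_rat_pow[OF R1.group_axioms of_int_hom[OF ghom] that, of n] by (simp add: pow_res1)
    have gdiff: "g (x - y) = g x - g y" if "x \<in> carrier (res1 C)" "y \<in> carrier (res1 C)"
      "x - y \<in> carrier (res1 C)" for x y
      using hom_mult[OF ghom that(3,2)] by simp
    have res1_mul: "frag_cmul (int n) r \<in> carrier (res1 C)" if "r \<in> carrier (res1 C)" for n r
      using R1.nat_pow_closed[OF that, of n] by (simp add: pow_res1)
    have res1_diff: "x - y \<in> carrier (res1 C)" if "x \<in> carrier (res1 C)" "y \<in> carrier (res1 C)" for x y
      using subgroup.m_closed[OF subgroup_res1[OF C] that(1) subgroup.m_inv_closed[OF subgroup_res1[OF C] that(2)]] that
      by (simp add: res0_def carrier_res1)
    obtain n :: "_ \<Rightarrow> nat" where n: "\<And>c. c \<in> carrier C \<Longrightarrow> n c \<ge> 1"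
      "\<And>c. c \<in> carrier C \<Longrightarrow> c [^]\<^bsub>C\<^esub> n c = \<one>\<^bsub>C\<^esub>" using tors by metis
    \<comment> \<open>Since n[c] is a relation, a rational function whose linear extension is g on
      relations can take no other value at c.\<close>
    define s where "s c = rat_of_int (g (frag_cmul (int (n c)) (frag_of c))) / of_nat (n c)" for c
    let ?L = "lin_ext rat_group s"
    \<comment> \<open>Induction over generators leaves the group of relations, so it runs over all
      chains and claims agreement only after multiplication by some N. For a difference, the product
      of the two multipliers works.\<close>
    have mult: "\<exists>N::nat. N \<ge> 1 \<and> frag_cmul (int N) r \<in> carrier (res1 C) \<and>
        of_int (g (frag_cmul (int N) r)) = of_nat N * ?L r" if "Poly_Mapping.keys r \<subseteq> carrier C" for r
      using that
    proof (rule free_Abelian_group_induct)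
      have "g 0 = 0" using hom_one[OF ghom] R1.group_axioms by simp
      moreover have "?L 0 = 0" by (simp add: lin_ext_def comm_monoid.finprod_empty comm_group.axioms(1)[OF comm_group_rat_group])
      ultimately show "\<exists>N::nat. N \<ge> 1 \<and> frag_cmul (int N) 0 \<in> carrier (res1 C) \<and>
        of_int (g (frag_cmul (int N) 0)) = of_nat N * ?L 0"
        using R1.one_closed by (intro exI[of _ 1]) simp
    next
      fix a assume a: "a \<in> carrier C"
      then show "\<exists>N::nat. N \<ge> 1 \<and> frag_cmul (int N) (frag_of a) \<in> carrier (res1 C) \<and>
        of_int (g (frag_cmul (int N) (frag_of a))) = of_nat N * ?L (frag_of a)"
        using n[OF a] frag_cmul_res1[OF C a n(2)[OF a]] by (intro exI[of _ "n a"]) (simp add: s_def)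
    next
      fix x y assume xy: "Poly_Mapping.keys x \<subseteq> carrier C" "Poly_Mapping.keys y \<subseteq> carrier C"
        and "\<exists>N::nat. N \<ge> 1 \<and> frag_cmul (int N) x \<in> carrier (res1 C) \<and> of_int (g (frag_cmul (int N) x)) = of_nat N * ?L x"
        and "\<exists>N::nat. N \<ge> 1 \<and> frag_cmul (int N) y \<in> carrier (res1 C) \<and> of_int (g (frag_cmul (int N) y)) = of_nat N * ?L y"
      then obtain M N :: nat where
        M: "M \<ge> 1" "frag_cmul (int M) x \<in> carrier (res1 C)" "of_int (g (frag_cmul (int M) x)) = of_nat M * ?L x" and
        N: "N \<ge> 1" "frag_cmul (int N) y \<in> carrier (res1 C)" "of_int (g (frag_cmul (int N) y)) = of_nat N * ?L y"
        by blast
      have L: "?L (x - y) = ?L x - ?L y"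
        using free_hom_diff[OF comm_group_rat_group lin_ext_rat_hom xy, of s] by simp
      let ?x = "frag_cmul (int N) (frag_cmul (int M) x)" and ?y = "frag_cmul (int M) (frag_cmul (int N) y)"
      have eq: "frag_cmul (int (M * N)) (x - y) = ?x - ?y"
        by (rule poly_mapping_eqI) (simp add: lookup_minus algebra_simps)
      have x: "?x \<in> carrier (res1 C)" and y: "?y \<in> carrier (res1 C)"
        by (rule res1_mul[OF M(2)], rule res1_mul[OF N(2)])
      have "rat_of_int (g (?x - ?y)) = of_nat (M * N) * ?L (x - y)"
        unfolding gdiff[OF x y res1_diff[OF x y]] of_int_diff gmul[OF M(2)] gmul[OF N(2)] M(3) N(3) L
        by (simp add: algebra_simps)
      then show "\<exists>N::nat. N \<ge> 1 \<and> frag_cmul (int N) (x - y) \<in> carrier (res1 C) \<and>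
          of_int (g (frag_cmul (int N) (x - y))) = of_nat N * ?L (x - y)"
        using M(1) N(1) res1_diff[OF x y] eq by (intro exI[of _ "M * N"]) (simp del: of_nat_mult frag_cmul_cmul)
    qed
    have gL: "of_int (g r) = ?L r" if r: "r \<in> carrier (res1 C)" for r
    proof -
      obtain N :: nat where "N \<ge> 1" "of_int (g (frag_cmul (int N) r)) = of_nat N * ?L r"
        using mult[of r] r by (auto simp: carrier_res1)
      then show ?thesis using gmul[OF r, of N] by simp
    qed
    define \<chi> where "\<chi> = (\<lambda>c\<in>carrier C. rat_class (s c))"
    have \<chi>: "\<chi> \<in> carrier (hom_group C rat_mod_int)"
      unfolding \<chi>_def
    proof (rule restrict_in_hom_group[OF C.is_monoid homI])
      fix c d assume c: "c \<in> carrier C" and d: "d \<in> carrier C"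
      \<comment> \<open>The relation expressing the product of c and d: integrality of the extension
        of s on it is additivity of s modulo \<int>.\<close>
      let ?r = "frag_of (c \<otimes>\<^bsub>C\<^esub> d) - frag_of c - frag_of d"
      have k: "Poly_Mapping.keys (frag_of (c \<otimes>\<^bsub>C\<^esub> d) - frag_of c) \<subseteq> carrier C"
        using c d keys_diff[of "frag_of (c \<otimes>\<^bsub>C\<^esub> d)" "frag_of c"] by auto
      have k': "Poly_Mapping.keys ?r \<subseteq> carrier C"
        using k d keys_diff[of "frag_of (c \<otimes>\<^bsub>C\<^esub> d) - frag_of c" "frag_of d"] by auto
      have val: "h ?r = h (frag_of (c \<otimes>\<^bsub>C\<^esub> d)) \<otimes>\<^bsub>M\<^esub> inv\<^bsub>M\<^esub> h (frag_of c) \<otimes>\<^bsub>M\<^esub> inv\<^bsub>M\<^esub> h (frag_of d)"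
        if "comm_group M" "h \<in> hom ?F M" for M :: "('z, 'w) monoid_scheme" and h
        using free_hom_diff[OF that k, of "frag_of d"] free_hom_diff[OF that, of "frag_of (c \<otimes>\<^bsub>C\<^esub> d)" "frag_of c"] c d
        by simp
      have "c \<otimes>\<^bsub>C\<^esub> d \<otimes>\<^bsub>C\<^esub> inv\<^bsub>C\<^esub> c \<otimes>\<^bsub>C\<^esub> inv\<^bsub>C\<^esub> d = c \<otimes>\<^bsub>C\<^esub> d \<otimes>\<^bsub>C\<^esub> inv\<^bsub>C\<^esub> (c \<otimes>\<^bsub>C\<^esub> d)"
        using c d by (simp add: C.inv_mult C.m_assoc)
      then have "lin_ext C (\<lambda>c. c) ?r = \<one>\<^bsub>C\<^esub>"
        using val[OF C lin_ext_id_hom[OF C]] c d lin_ext_frag_of[OF C, of "\<lambda>c. c"] by simp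
      then have "?r \<in> carrier (res1 C)"
        using k' by (simp add: carrier_res1)
      then have "?L ?r \<in> \<int>"
        using gL[of ?r] by (metis Ints_of_int)
      moreover have "?L ?r = s (c \<otimes>\<^bsub>C\<^esub> d) - (s c + s d)"
        using val[OF comm_group_rat_group lin_ext_rat_hom, of s] by simp
      ultimately have "s (c \<otimes>\<^bsub>C\<^esub> d) - (s c + s d) \<in> \<int>" by simp
      then show "rat_class (s (c \<otimes>\<^bsub>C\<^esub> d)) = rat_class (s c) \<otimes>\<^bsub>rat_mod_int\<^esub> rat_class (s d)"
        unfolding rat_class_add[symmetric] rat_class_eq_iff .
    qed simp
    have "dual_to_Ext1 C \<chi> = X"
      unfolding g(2)
      by (rule dual_to_Ext1_eqI[OF C _ _ g(1), of _ s]) (use \<chi> gL in \<open>simp_all add: carrier_hom_group \<chi>_def\<close>)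
    then show "\<exists>\<chi>\<in>carrier (hom_group C rat_mod_int). dual_to_Ext1 C \<chi> = X"
      using \<chi> by blast
  qed
qed

text \<open>T composed with a section of p is a rational lift of \<chi>. Its linear extension at a
  relation r is T of the lifted chain, which lies in the image of i, where T is h. Both sides are
  thus represented by the same cocycle, with no change of sign.\<close>

theorem connecting_contra_eq_dual_to_Ext1:
  assumes ses: "is_ses A B C i p"
    and h: "h \<in> hom A integer_group" and T: "T \<in> hom B rat_group"
    and Ti: "\<And>a. a \<in> carrier A \<Longrightarrow> T (i a) = of_int (h a)"
    and \<chi>: "\<chi> \<in> hom C rat_mod_int" and \<chi>p: "\<And>b. b \<in> carrier B \<Longrightarrow> \<chi> (p b) = rat_class (T b)"
  shows "connecting_contra A B C i p integer_group h = dual_to_Ext1 C \<chi>"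
proof -
  let ?\<sigma> = "inv_into (carrier B) p"
  have B: "comm_group B" and C: "comm_group C" and p: "p ` carrier B = carrier C"
    using ses by (auto simp: is_ses_def epi_def)
  define l where "l r = inv_into (carrier A) i (lin_ext B ?\<sigma> r)" for r
  note l = ses_lift[OF ses, folded l_def]
  have l2: "l \<in> hom (res1 C) A"
    using ses_lift(2)[OF ses] by (simp add: l_def[abs_def])
  have c: "(\<lambda>r\<in>carrier (res1 C). h (l r)) \<in> carrier (hom_group (res1 C) integer_group)"
    using Group.hom_compose[OF l2 h] group_res1[OF C]
    by (intro restrict_in_hom_group) (simp_all add: comp_def group.is_monoid)
  have \<sigma>: "?\<sigma> c \<in> carrier B" "p (?\<sigma> c) = c" if "c \<in> carrier C" for c
    using p that by (auto intro: inv_into_into f_inv_into_f)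
  have TL: "T (lin_ext B ?\<sigma> r) = lin_ext rat_group (\<lambda>c. T (?\<sigma> c)) r" if "Poly_Mapping.keys r \<subseteq> carrier C" for r
  proof -
    have "(T \<circ> lin_ext B ?\<sigma>) r = lin_ext rat_group (\<lambda>c. T (?\<sigma> c)) r"
      by (rule free_hom_eqI[OF comm_group_rat_group Group.hom_compose[OF l(1) T] lin_ext_rat_hom _ that])
        (use \<sigma> lin_ext_frag_of[OF B, of ?\<sigma>] in auto)
    then show ?thesis by simp
  qed
  have "dual_to_Ext1 C \<chi> = ext1_class C integer_group (\<lambda>r\<in>carrier (res1 C). h (l r))"
  proof (rule dual_to_Ext1_eqI[OF C \<chi> _ c, of "\<lambda>c. T (?\<sigma> c)"])
    show "\<forall>c\<in>carrier C. rat_class (T (?\<sigma> c)) = \<chi> c"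
      using \<chi>p \<sigma> by metis
    have "rat_of_int (h (l r)) = lin_ext rat_group (\<lambda>c. T (?\<sigma> c)) r" if "r \<in> carrier (res1 C)" for r
      using that Ti[OF hom_in_carrier[OF l2 that]] l(3)[OF that] TL[of r] by (simp add: carrier_res1)
    then show "\<forall>r\<in>carrier (res1 C). rat_of_int ((\<lambda>r\<in>carrier (res1 C). h (l r)) r)
        = lin_ext rat_group (\<lambda>c. T (?\<sigma> c)) r"
      by simp
  qed
  then show ?thesis
    by (simp add: connecting_contra_def l_def)
qed

subsection \<open>Integer functions and chains\<close>

lemma carrier_int_fun: "f \<in> carrier (int_fun S) \<longleftrightarrow> f \<in> extensional S"
  by (simp add: int_fun_def PiE_def)

lemma restrict_in_int_fun [simp]: "restrict f S \<in> carrier (int_fun S)"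
  by (simp add: carrier_int_fun)

lemma mult_int_fun: "f \<otimes>\<^bsub>int_fun S\<^esub> g = (\<lambda>x\<in>S. f x + g x)"
  by (simp add: int_fun_def)

lemma one_int_fun: "\<one>\<^bsub>int_fun S\<^esub> = (\<lambda>x\<in>S. 0)"
  by (simp add: int_fun_def)

lemma comm_group_int_fun: "comm_group (int_fun S)"
  by (rule group.group_comm_groupI) (auto simp: int_fun_def intro!: restrict_ext)

lemma group_int_fun: "group (int_fun S)"
  by (rule comm_group.axioms(2)[OF comm_group_int_fun])

lemma inv_int_fun: "f \<in> carrier (int_fun S) \<Longrightarrow> inv\<^bsub>int_fun S\<^esub> f = (\<lambda>x\<in>S. - f x)"
  by (simp add: int_fun_def)

lemma pow_int_fun: "f \<in> carrier (int_fun S) \<Longrightarrow> f [^]\<^bsub>int_fun S\<^esub> (n::nat) = (\<lambda>x\<in>S. int n * f x)"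
  by (induction n) (auto simp: mult_int_fun one_int_fun fun_eq_iff algebra_simps)

section \<open>Evaluation of functions on chains\<close>

lemma chain_eval_superset:
  assumes "finite A" "Poly_Mapping.keys c \<subseteq> A"
  shows "chain_eval f c = (\<Sum>x\<in>A. Poly_Mapping.lookup c x * f x)"
  unfolding chain_eval_def
  by (rule sum.mono_neutral_left) (use assms in \<open>auto simp: in_keys_iff\<close>)

lemma chain_eval_add: "chain_eval f (c + d) = chain_eval f c + chain_eval f d"
proof -
  let ?A = "Poly_Mapping.keys c \<union> Poly_Mapping.keys d"
  have "chain_eval f (c + d) = (\<Sum>x\<in>?A. Poly_Mapping.lookup (c + d) x * f x)"
    by (rule chain_eval_superset) (use keys_add[of c d] in auto)
  also have "\<dots> = (\<Sum>x\<in>?A. Poly_Mapping.lookup c x * f x) + (\<Sum>x\<in>?A. Poly_Mapping.lookup d x * f x)"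
    by (simp add: lookup_add algebra_simps sum.distrib)
  also have "\<dots> = chain_eval f c + chain_eval f d"
    using chain_eval_superset[of ?A c f] chain_eval_superset[of ?A d f] by simp
  finally show ?thesis .
qed

lemma chain_eval_zero [simp]: "chain_eval f 0 = 0"
  by (simp add: chain_eval_def)

lemma chain_eval_diff: "chain_eval f (c - d) = chain_eval f c - chain_eval f d"
  using chain_eval_add[of f "c - d" d] by simp

lemma chain_eval_frag_of [simp]: "chain_eval f (frag_of x) = f x"
  by (simp add: chain_eval_def)

lemma chain_eval_cong:
  "(\<And>x. x \<in> Poly_Mapping.keys c \<Longrightarrow> f x = g x) \<Longrightarrow> chain_eval f c = chain_eval g c"
  by (simp add: chain_eval_def)

lemma chain_eval_fun_add: "chain_eval (\<lambda>x. f x + g x) c = chain_eval f c + chain_eval g c"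
  by (simp add: chain_eval_def algebra_simps sum.distrib)

lemma chain_eval_const: "chain_eval (\<lambda>_. k) c = k * chain_degree c"
  by (simp add: chain_eval_def chain_degree_def algebra_simps sum_distrib_left)

lemma chain_eval_int_fun_hom:
  assumes "Poly_Mapping.keys c \<subseteq> S"
  shows "(\<lambda>f. chain_eval f c) \<in> hom (int_fun S) integer_group"
proof (rule homI)
  fix f g
  have "chain_eval (f \<otimes>\<^bsub>int_fun S\<^esub> g) c = chain_eval (\<lambda>x. f x + g x) c"
    by (rule chain_eval_cong) (use assms in \<open>auto simp: mult_int_fun\<close>)
  then show "chain_eval (f \<otimes>\<^bsub>int_fun S\<^esub> g) c = chain_eval f c \<otimes>\<^bsub>integer_group\<^esub> chain_eval g c"
    by (simp add: chain_eval_fun_add)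
qed simp

text \<open>The indicator of x, cut off outside S because elements of \<open>int_fun\<close> are
  extensional. For finite S these are the standard basis.\<close>

definition delta :: "'a set \<Rightarrow> 'a \<Rightarrow> 'a \<Rightarrow> int"
  where "delta S x = (\<lambda>y\<in>S. if y = x then 1 else 0)"

lemma delta_in [simp]: "delta S x \<in> carrier (int_fun S)"
  by (simp add: delta_def)

lemma chain_eval_delta:
  assumes "Poly_Mapping.keys c \<subseteq> S" "x \<in> S"
  shows "chain_eval (delta S x) c = Poly_Mapping.lookup c x"
proof -
  have "chain_eval (delta S x) c = chain_eval (\<lambda>y. if y = x then 1 else 0) c"
    by (rule chain_eval_cong) (use assms in \<open>auto simp: delta_def\<close>)
  also have "\<dots> = Poly_Mapping.lookup c x"
    by (simp add: chain_eval_def if_distrib in_keys_iff cong: if_cong)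
  finally show ?thesis .
qed

lemma chain_with_coefficients:
  assumes "finite S"
  obtains c :: "'a \<Rightarrow>\<^sub>0 int" where "Poly_Mapping.keys c \<subseteq> S" "\<And>x. x \<in> S \<Longrightarrow> Poly_Mapping.lookup c x = f x"
proof
  let ?g = "\<lambda>x. if x \<in> S then f x else 0"
  have "finite {x. ?g x \<noteq> 0}" by (rule finite_subset[OF _ assms]) auto
  then have l: "Poly_Mapping.lookup (Abs_poly_mapping ?g) = ?g"
    by simp
  show "Poly_Mapping.keys (Abs_poly_mapping ?g) \<subseteq> S"
    by (auto simp: in_keys_iff l split: if_splits)
  show "Poly_Mapping.lookup (Abs_poly_mapping ?g) x = f x" if "x \<in> S" for x
    using that by (simp add: l)
qed

text \<open>For finite S, every function is the coefficient function of a chain, and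
  \<open>frag_of x\<close> corresponds to \<open>delta S x\<close>. Pulled back to chains, the claim
  is agreement on generators.\<close>

lemma int_fun_hom_eqI:
  assumes S: "finite S" and M: "comm_group M" and h: "h \<in> hom (int_fun S) M" and k: "k \<in> hom (int_fun S) M"
    and eq: "\<And>x. x \<in> S \<Longrightarrow> h (delta S x) = k (delta S x)" and f: "f \<in> carrier (int_fun S)"
  shows "h f = k f"
proof -
  let ?J = "\<lambda>c. restrict (Poly_Mapping.lookup c) S"
  have J: "?J \<in> hom (free_Abelian_group S) (int_fun S)"
    by (rule homI) (auto simp: mult_int_fun lookup_add)
  have J\<delta>: "?J (frag_of x) = delta S x" for x
    by (auto simp: delta_def lookup_single when_def fun_eq_iff)
  obtain c where c: "Poly_Mapping.keys c \<subseteq> S" "\<And>x. x \<in> S \<Longrightarrow> Poly_Mapping.lookup c x = f x"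
    using chain_with_coefficients[OF S, of f] by blast
  have fc: "f = ?J c"
    using c(2) f by (auto simp: carrier_int_fun extensional_def fun_eq_iff)
  have "(h \<circ> ?J) c = (k \<circ> ?J) c"
    by (rule free_hom_eqI[OF M Group.hom_compose[OF J h] Group.hom_compose[OF J k] _ c(1)])
      (use eq J\<delta> in \<open>simp del: restrict_apply\<close>)
  then show ?thesis by (simp add: fc)
qed

text \<open>The coefficient of the chain at x is the value of h on \<open>delta S x\<close>. This
  produces the 1-chains, 0-chains and chains on I in the three surjectivity and injectivity
  arguments to come.\<close>

lemma int_fun_hom_eq_chain_eval:
  assumes "finite S" "h \<in> hom (int_fun S) integer_group"
  obtains c where "Poly_Mapping.keys c \<subseteq> S" "\<And>f. f \<in> carrier (int_fun S) \<Longrightarrow> h f = chain_eval f c"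
proof -
  obtain c where c: "Poly_Mapping.keys c \<subseteq> S" "\<And>x. x \<in> S \<Longrightarrow> Poly_Mapping.lookup c x = h (delta S x)"
    using chain_with_coefficients[OF assms(1), of "\<lambda>x. h (delta S x)"] by blast
  have "h f = chain_eval f c" if "f \<in> carrier (int_fun S)" for f
    by (rule int_fun_hom_eqI[OF assms(1) abelian_integer_group assms(2) chain_eval_int_fun_hom[OF c(1)] _ that])
      (use c in \<open>simp add: chain_eval_delta\<close>)
  then show ?thesis using c that by blast
qed

text \<open>Gram-Schmidt, cleared of denominators.\<close>

lemma integral_orthogonal_projection:
  fixes a :: "'s \<Rightarrow> 'e \<Rightarrow> int" and w :: "'e \<Rightarrow> int"
  assumes "finite E" "finite S"
  shows "\<exists>n::nat. n \<ge> 1 \<and> (\<exists>c. \<forall>t\<in>S. (\<Sum>e\<in>E. (int n * w e - (\<Sum>s\<in>S. c s * a s e)) * a t e) = 0)"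
  using assms(2)
proof (induction S arbitrary: w rule: finite_induct)
  case empty
  then show ?case by auto
next
  case (insert s S)
  define ip where "ip u v = (\<Sum>e\<in>E. u e * v e)" for u v :: "'e \<Rightarrow> int"
  obtain n :: nat and c where n: "n \<ge> 1"
    and c: "\<And>t. t \<in> S \<Longrightarrow> ip (\<lambda>e. int n * w e - (\<Sum>s\<in>S. c s * a s e)) (a t) = 0"
    using insert.IH[of w] unfolding ip_def by blast
  \<comment> \<open>The induction hypothesis a second time, now for the new vector
    \<open>a s\<close>: this is why w is arbitrary. The vector b is a multiple of the part of
    \<open>a s\<close> orthogonal to the old vectors.\<close>
  obtain m :: nat and d where m: "m \<ge> 1"
    and d: "\<And>t. t \<in> S \<Longrightarrow> ip (\<lambda>e. int m * a s e - (\<Sum>s\<in>S. d s * a s e)) (a t) = 0"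
    using insert.IH[of "a s"] unfolding ip_def by blast
  define u where "u e = int n * w e - (\<Sum>s\<in>S. c s * a s e)" for e
  define b where "b e = int m * a s e - (\<Sum>s\<in>S. d s * a s e)" for e
  have ipu: "ip u (a t) = 0" and ipb: "ip b (a t) = 0" if "t \<in> S" for t
    using c d that by (simp_all add: u_def[abs_def] b_def[abs_def])
  \<comment> \<open>b and m times \<open>a s\<close> differ by a combination of old vectors, which v
    does not see; orthogonality to \<open>a s\<close> may be tested on b.\<close>
  have ip_s: "int m * ip v (a s) = ip v b" if "\<And>t. t \<in> S \<Longrightarrow> ip v (a t) = 0" for v
  proof -
    have "(\<Sum>e\<in>E. v e * (\<Sum>t\<in>S. d t * a t e)) = (\<Sum>e\<in>E. \<Sum>t\<in>S. d t * (v e * a t e))"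
      by (intro sum.cong refl) (simp add: sum_distrib_left algebra_simps)
    also have "\<dots> = (\<Sum>t\<in>S. d t * ip v (a t))"
      by (subst sum.swap) (simp add: ip_def sum_distrib_left)
    also have "\<dots> = 0" using that by simp
    finally show ?thesis
      by (simp add: ip_def b_def algebra_simps sum_subtractf sum_distrib_left)
  qed
  show ?case
  proof (cases "ip b b = 0")
    case True
    \<comment> \<open>Positivity makes b vanish on E: a nonzero multiple of \<open>a s\<close> is a
      combination of the old vectors, u is already orthogonal to it, and the new coefficient is
      zero.\<close>
    have b0: "b e = 0" if "e \<in> E" for e
      using True that assms(1) unfolding ip_def by (subst (asm) sum_nonneg_eq_0_iff) auto
    have "int m * ip u (a s) = 0"
      using ip_s[OF ipu] b0 by (simp add: ip_def)
    then have "ip u (a s) = 0" using m by simp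
    then have "\<forall>t\<in>insert s S. ip u (a t) = 0" using ipu by blast
    moreover have "int n * w e - (\<Sum>t\<in>insert s S. (c(s := 0)) t * a t e) = u e" for e
      using insert.hyps by (simp add: u_def) (intro sum.cong refl, auto)
    ultimately show ?thesis
      using n by (intro exI[of _ n] conjI exI[of _ "c(s := 0)"]) (simp_all add: ip_def)
  next
    case False
    then have N: "ip b b > 0"
      by (metis ip_def less_le sum_nonneg zero_le_square)
    define N where "N = nat (ip b b)"
    have N': "int N = ip b b" "N \<ge> 1" using N by (auto simp: N_def)
    \<comment> \<open>The coefficient of u along b is k/N with N the square length of b. Multiplying
      by N keeps everything integral: v = N u - k b is orthogonal to b, and \<open>c'\<close>
      collects its coefficients.\<close>
    define k where "k = ip u b"
    define v where "v e = int N * u e - k * b e" for e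
    define c' where "c' = (\<lambda>t. int N * c t - k * d t)(s := k * int m)"
    have ipv: "ip v x = int N * ip u x - k * ip b x" for x
      by (simp add: v_def ip_def algebra_simps sum_subtractf sum_distrib_left)
    have v1: "ip v (a t) = 0" if "t \<in> S" for t
      using that by (simp add: ipv ipu ipb)
    have "ip v b = 0" by (simp add: ipv k_def N')
    then have "ip v (a s) = 0" using ip_s[OF v1] m by simp
    then have "\<forall>t\<in>insert s S. ip v (a t) = 0" using v1 by blast
    moreover have "int (N * n) * w e - (\<Sum>t\<in>insert s S. c' t * a t e) = v e" for e
    proof -
      have "(\<Sum>t\<in>S. c' t * a t e) = (\<Sum>t\<in>S. int N * (c t * a t e) - k * (d t * a t e))"
        by (rule sum.cong) (use insert.hyps in \<open>auto simp: c'_def algebra_simps\<close>)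
      also have "\<dots> = int N * (\<Sum>t\<in>S. c t * a t e) - k * (\<Sum>t\<in>S. d t * a t e)"
        by (simp add: sum_subtractf sum_distrib_left)
      finally show ?thesis
        using insert.hyps by (simp add: v_def u_def b_def c'_def algebra_simps)
    qed
    ultimately show ?thesis
      using n N' by (intro exI[of _ "N * n"] conjI exI[of _ c']) (simp_all add: ip_def)
  qed
qed

subsection \<open>Harmonic forms and the boundary map\<close>

lemma diff_in [simp]: "diff G f \<in> carrier (int_fun (arcs G))"
  by (simp add: diff_def)

lemma boundary_frag_of [simp]: "boundary G (frag_of e) = frag_of (head G e) - frag_of (tail G e)"
  by (simp add: boundary_def)

lemma boundary_diff: "boundary G (x - y) = boundary G x - boundary G y"
  by (simp add: boundary_def frag_extend_diff)

lemma boundary_add: "boundary G (x + y) = boundary G x + boundary G y"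
  by (simp add: boundary_def frag_extend_add)

lemma push_chain_frag_of [simp]: "push_chain \<rho> (frag_of i) = frag_of (\<rho> i)"
  by (simp add: push_chain_def)

lemma push_chain_diff: "push_chain \<rho> (x - y) = push_chain \<rho> x - push_chain \<rho> y"
  by (simp add: push_chain_def frag_extend_diff)

text \<open>Push-forward of chains is adjoint to pull-back of functions, as generators show.\<close>

lemma chain_eval_push_chain: "chain_eval f (push_chain \<rho> D) = chain_eval (\<lambda>i. f (\<rho> i)) D"
proof (rule free_Abelian_group_induct[of D UNIV "\<lambda>D. chain_eval f (push_chain \<rho> D) = chain_eval (\<lambda>i. f (\<rho> i)) D"])
  show "chain_eval f (push_chain \<rho> 0) = chain_eval (\<lambda>i. f (\<rho> i)) 0" by (simp add: push_chain_def)
qed (auto simp: push_chain_diff chain_eval_diff)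

lemma keys_push_chain:
  assumes "\<rho> \<in> I \<rightarrow> S" "Poly_Mapping.keys D \<subseteq> I"
  shows "Poly_Mapping.keys (push_chain \<rho> D) \<subseteq> S"
  unfolding push_chain_def using keys_frag_extend[of "\<lambda>i. frag_of (\<rho> i)" D] assms by auto

text \<open>The discrete Stokes formula; on a single arc it is the definition of the
  differential.\<close>

lemma chain_eval_diff_boundary:
  assumes "Poly_Mapping.keys \<gamma> \<subseteq> arcs G"
  shows "chain_eval (diff G f) \<gamma> = chain_eval f (boundary G \<gamma>)"
  using assms
proof (rule free_Abelian_group_induct)
  show "chain_eval (diff G f) 0 = chain_eval f (boundary G 0)" by (simp add: boundary_def)
qed (auto simp: boundary_diff chain_eval_diff diff_def)

lemma carrier_harmonic:
  "\<eta> \<in> carrier (harmonic G) \<longleftrightarrow> \<eta> \<in> carrier (int_fun (arcs G)) \<and> (\<forall>v\<in>verts G. codiff G \<eta> v = 0)"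
  by (auto simp: harmonic_def kernel_def one_int_fun codiff_def fun_eq_iff)

lemma mult_harmonic: "x \<otimes>\<^bsub>harmonic G\<^esub> y = x \<otimes>\<^bsub>int_fun (arcs G)\<^esub> y"
  by (simp add: harmonic_def)

lemma one_harmonic: "\<one>\<^bsub>harmonic G\<^esub> = (\<lambda>e\<in>arcs G. 0)"
  by (simp add: harmonic_def one_int_fun)

context fin_digraph
begin

lemma keys_boundary:
  assumes "Poly_Mapping.keys \<gamma> \<subseteq> arcs G"
  shows "Poly_Mapping.keys (boundary G \<gamma>) \<subseteq> verts G"
  using assms
proof (rule free_Abelian_group_induct)
  fix e assume "e \<in> arcs G"
  then show "Poly_Mapping.keys (boundary G (frag_of e)) \<subseteq> verts G"
    using keys_diff[of "frag_of (head G e)" "frag_of (tail G e)"] by auto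
next
  fix x y assume "Poly_Mapping.keys (boundary G x) \<subseteq> verts G" "Poly_Mapping.keys (boundary G y) \<subseteq> verts G"
  then show "Poly_Mapping.keys (boundary G (x - y)) \<subseteq> verts G"
    using keys_diff[of "boundary G x" "boundary G y"] by (auto simp: boundary_diff)
qed (simp add: boundary_def)

text \<open>Adjointness of differential and codifferential: the arcs are grouped once by head and
  once by tail.\<close>

lemma sum_diff_eq_sum_codiff:
  "(\<Sum>e\<in>arcs G. \<omega> e * diff G f e) = (\<Sum>v\<in>verts G. f v * codiff G \<omega> v)"
proof -
  have g: "(\<Sum>e\<in>arcs G. \<omega> e * f (h e)) = (\<Sum>v\<in>verts G. f v * (\<Sum>e | e \<in> arcs G \<and> h e = v. \<omega> e))"
    if "h ` arcs G \<subseteq> verts G" for h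
  proof -
    have "(\<Sum>e\<in>arcs G. \<omega> e * f (h e)) = (\<Sum>v\<in>verts G. \<Sum>e | e \<in> arcs G \<and> h e = v. \<omega> e * f (h e))"
      by (rule sum.group[OF finite_arcs finite_verts that, symmetric])
    also have "\<dots> = (\<Sum>v\<in>verts G. f v * (\<Sum>e | e \<in> arcs G \<and> h e = v. \<omega> e))"
      by (intro sum.cong refl) (simp add: sum_distrib_left mult.commute)
    finally show ?thesis .
  qed
  have "(\<Sum>e\<in>arcs G. \<omega> e * diff G f e) = (\<Sum>e\<in>arcs G. \<omega> e * f (head G e)) - (\<Sum>e\<in>arcs G. \<omega> e * f (tail G e))"
    by (simp add: diff_def algebra_simps sum_subtractf)
  also have "\<dots> = (\<Sum>v\<in>verts G. f v * codiff G \<omega> v)"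
    using g[of "head G"] g[of "tail G"]
    by (simp add: codiff_def right_diff_distrib sum_subtractf image_subset_iff)
  finally show ?thesis .
qed

text \<open>Adjointness against the indicator of v. It makes the codifferential visibly linear and
  identifies harmonic forms with those orthogonal to the differentials of all vertex
  indicators.\<close>

lemma codiff_eq_sum:
  assumes "v \<in> verts G"
  shows "codiff G \<omega> v = (\<Sum>e\<in>arcs G. \<omega> e * diff G (delta (verts G) v) e)"
  unfolding sum_diff_eq_sum_codiff using assms
  by (simp add: delta_def if_distrib[of "\<lambda>x. x * _"] cong: if_cong)

text \<open>A harmonic form is orthogonal to exact ones, hence here to itself, and its sum of
  squares vanishes. Independence of choices in the pairing and injectivity of
  \<open>P_mod_incl\<close> both come down to this.\<close>

lemma harmonic_exact_eq_zero:
  assumes "\<eta> \<in> carrier (harmonic G)" "\<And>e. e \<in> arcs G \<Longrightarrow> \<eta> e = diff G f e" "e \<in> arcs G"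
  shows "\<eta> e = 0"
proof -
  have "(\<Sum>e\<in>arcs G. \<eta> e * \<eta> e) = (\<Sum>e\<in>arcs G. \<eta> e * diff G f e)"
    using assms(2) by simp
  also have "\<dots> = 0"
    using assms(1) by (simp add: sum_diff_eq_sum_codiff carrier_harmonic)
  finally show ?thesis
    using assms(3) by (subst (asm) sum_nonneg_eq_0_iff) auto
qed

text \<open>Project \<omega> onto the span of the differentials of vertex indicators. With
  denominators cleared, the remainder is orthogonal to all of them, hence harmonic, and the
  projection is df with f given by the coefficients c.\<close>

lemma pairing_data_exists: "\<exists>n \<eta> f. pairing_data G \<omega> (n, \<eta>, f)"
proof -
  obtain n :: nat and c where n: "n \<ge> 1" and c: "\<And>v. v \<in> verts G \<Longrightarrow>
      (\<Sum>e\<in>arcs G. (int n * \<omega> e - (\<Sum>u\<in>verts G. c u * diff G (delta (verts G) u) e))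
        * diff G (delta (verts G) v) e) = 0"
    using integral_orthogonal_projection[of "arcs G" "verts G" \<omega> "\<lambda>v. diff G (delta (verts G) v)"]
    by auto
  define f where "f = restrict c (verts G)"
  have f: "(\<Sum>u\<in>verts G. c u * diff G (delta (verts G) u) e) = diff G f e" if "e \<in> arcs G" for e
    using that
    by (simp add: f_def diff_def delta_def algebra_simps sum_subtractf if_distrib[of "\<lambda>x. _ * x"]
        sum.delta' cong: if_cong)
  define \<eta> where "\<eta> = (\<lambda>e\<in>arcs G. int n * \<omega> e - diff G f e)"
  have "codiff G \<eta> v = 0" if "v \<in> verts G" for v
    unfolding codiff_eq_sum[OF that] using c[OF that] f by (simp add: \<eta>_def cong: sum.cong)
  then have "pairing_data G \<omega> (n, \<eta>, f)"
    using n by (simp add: pairing_data_def carrier_harmonic \<eta>_def f_def)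
  then show ?thesis by blast
qed

lemma subgroup_harmonic: "subgroup (carrier (harmonic G)) (int_fun (arcs G))"
proof (rule group.subgroupI[OF group_int_fun])
  have "(\<lambda>e\<in>arcs G. 0) \<in> carrier (harmonic G)"
    by (simp add: carrier_harmonic codiff_eq_sum)
  then show "carrier (harmonic G) \<noteq> {}" by blast
qed (auto simp: carrier_harmonic mult_int_fun inv_int_fun codiff_eq_sum algebra_simps sum.distrib
    sum_negf cong: sum.cong)

lemma comm_group_harmonic: "comm_group (harmonic G)"
proof -
  have "harmonic G = (int_fun (arcs G))\<lparr>carrier := carrier (harmonic G)\<rparr>"
    by (simp add: harmonic_def)
  then have "group (harmonic G)"
    using subgroup.subgroup_is_group[OF subgroup_harmonic group_int_fun] by simp
  then show ?thesis
    by (rule group.group_comm_groupI) (simp add: mult_harmonic mult_int_fun add.commute)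
qed

end

section \<open>Consequences of connectedness\<close>

locale connected_digraph = fin_digraph +
  assumes connected: "Digraph_Component.connected G"
begin

text \<open>Along an undirected path, an arc traversed from tail to head is added and an arc
  traversed backwards is subtracted.\<close>

lemma boundary_path:
  assumes "u \<in> verts G" "v \<in> verts G"
  shows "\<exists>\<gamma>. Poly_Mapping.keys \<gamma> \<subseteq> arcs G \<and> boundary G \<gamma> = frag_of v - frag_of u"
proof -
  have "(u, v) \<in> rtrancl_on (verts G) ((arcs_ends G)\<^sup>s)"
    using connected assms by (simp add: connected_conv)
  then show ?thesis
  proof (induction rule: rtrancl_on_induct)
    case base
    then show ?case by (intro exI[of _ 0]) (simp add: boundary_def)
  next
    case (step x y)
    then obtain \<gamma> where \<gamma>: "Poly_Mapping.keys \<gamma> \<subseteq> arcs G" "boundary G \<gamma> = frag_of x - frag_of u" by blast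
    obtain e where e: "e \<in> arcs G" "(tail G e = x \<and> head G e = y) \<or> (tail G e = y \<and> head G e = x)"
      using step.hyps by (auto simp: symcl_def arcs_ends_conv)
    then consider "boundary G (frag_of e) = frag_of y - frag_of x"
      | "boundary G (frag_of e) = frag_of x - frag_of y" by auto
    then show ?case
    proof cases
      case 1
      then show ?thesis
        using \<gamma> e keys_add[of \<gamma> "frag_of e"]
        by (intro exI[of _ "\<gamma> + frag_of e"]) (auto simp del: boundary_frag_of simp: boundary_add)
    next
      case 2
      then show ?thesis
        using \<gamma> e keys_diff[of \<gamma> "frag_of e"]
        by (intro exI[of _ "\<gamma> - frag_of e"]) (auto simp del: boundary_frag_of simp: boundary_diff)
    qed
  qed
qed

lemma boundary_surj_deg0:
  assumes "Poly_Mapping.keys x \<subseteq> verts G" "chain_degree x = 0"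
  obtains \<gamma> where "Poly_Mapping.keys \<gamma> \<subseteq> arcs G" "boundary G \<gamma> = x"
proof -
  obtain v where v: "v \<in> verts G" using connected by (auto simp: connected_conv)
  \<comment> \<open>Generators do not have degree zero, so the induction concerns arbitrary chains,
    corrected by their degree times a base vertex; the degree is written as evaluation of 1 to have
    its additivity at hand.\<close>
  have "\<exists>\<gamma>. Poly_Mapping.keys \<gamma> \<subseteq> arcs G \<and> boundary G \<gamma> = x - frag_cmul (chain_eval (\<lambda>_. 1) x) (frag_of v)"
    using assms(1)
  proof (rule free_Abelian_group_induct)
    show "\<exists>\<gamma>. Poly_Mapping.keys \<gamma> \<subseteq> arcs G \<and> boundary G \<gamma> = 0 - frag_cmul (chain_eval (\<lambda>_. 1) 0) (frag_of v)"
      by (intro exI[of _ 0]) (simp add: boundary_def)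
  next
    fix u assume "u \<in> verts G"
    then show "\<exists>\<gamma>. Poly_Mapping.keys \<gamma> \<subseteq> arcs G \<and>
        boundary G \<gamma> = frag_of u - frag_cmul (chain_eval (\<lambda>_. 1) (frag_of u)) (frag_of v)"
      using boundary_path[OF v] by simp
  next
    fix x y
    assume "\<exists>\<gamma>. Poly_Mapping.keys \<gamma> \<subseteq> arcs G \<and> boundary G \<gamma> = x - frag_cmul (chain_eval (\<lambda>_. 1) x) (frag_of v)"
      and "\<exists>\<gamma>. Poly_Mapping.keys \<gamma> \<subseteq> arcs G \<and> boundary G \<gamma> = y - frag_cmul (chain_eval (\<lambda>_. 1) y) (frag_of v)"
    then obtain \<gamma> \<delta> where "Poly_Mapping.keys \<gamma> \<subseteq> arcs G" "Poly_Mapping.keys \<delta> \<subseteq> arcs G"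
      "boundary G \<gamma> = x - frag_cmul (chain_eval (\<lambda>_. 1) x) (frag_of v)"
      "boundary G \<delta> = y - frag_cmul (chain_eval (\<lambda>_. 1) y) (frag_of v)" by blast
    then show "\<exists>\<gamma>. Poly_Mapping.keys \<gamma> \<subseteq> arcs G \<and>
        boundary G \<gamma> = x - y - frag_cmul (chain_eval (\<lambda>_. 1) (x - y)) (frag_of v)"
      using keys_diff[of \<gamma> \<delta>]
      by (intro exI[of _ "\<gamma> - \<delta>"]) (auto simp: boundary_diff chain_eval_diff frag_cmul_diff_distrib)
  qed
  then show ?thesis
    using that assms(2) chain_eval_const[of 1 x] by auto
qed

text \<open>Stokes along a chain joining u to v: the difference of the two values is the integral of
  df, which is zero.\<close>

lemma closed_imp_constant:
  assumes "\<And>e. e \<in> arcs G \<Longrightarrow> diff G f e = 0" "u \<in> verts G" "v \<in> verts G"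
  shows "f u = f v"
proof -
  obtain \<gamma> where \<gamma>: "Poly_Mapping.keys \<gamma> \<subseteq> arcs G" "boundary G \<gamma> = frag_of v - frag_of u"
    using boundary_path assms(2,3) by blast
  have "chain_eval (diff G f) \<gamma> = chain_eval (\<lambda>_. 0) \<gamma>"
    by (rule chain_eval_cong) (use assms(1) \<gamma>(1) in auto)
  then show ?thesis
    using chain_eval_diff_boundary[OF \<gamma>(1), of f] \<gamma>(2) by (simp add: chain_eval_diff chain_eval_const)
qed

end

subsection \<open>The groups P and J\<close>

text \<open>
  The unique extension of \<open>\<phi>\<close> to a homomorphism \<open>\<int>\<^sup>E \<rightarrow> \<rat>\<close> that vanishes on exact forms; modulo \<open>\<int>\<close>
  it is the pairing with the class of \<open>\<phi>\<close>.
\<close>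

definition rat_extension :: "('v, 'e) pre_digraph \<Rightarrow> (('e \<Rightarrow> int) \<Rightarrow> int) \<Rightarrow> ('e \<Rightarrow> int) \<Rightarrow> rat"
  where "rat_extension G \<phi> \<omega> = (let (n, \<eta>, f) = (SOME y. pairing_data G \<omega> y) in of_int (\<phi> \<eta>) / of_nat n)"

lemma pairing_eq_rat_extension: "pairing G j x = rat_class (rat_extension G (rep j) (rep (rep x)))"
  by (simp add: pairing_def rat_extension_def Let_def case_prod_beta)

context fin_digraph
begin

lemma diff_hom: "diff G \<in> hom (int_fun (verts G)) (int_fun (arcs G))"
  by (rule homI) (auto simp: diff_def mult_int_fun fun_eq_iff)

lemma subgroup_exact_forms: "subgroup (exact_forms G) (int_fun (arcs G))"
  unfolding exact_forms_def
  by (rule subgroup_hom_image[OF group_int_fun group_int_fun diff_hom group.subgroup_self[OF group_int_fun]])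

lemma double_quotient_P: "double_quotient (int_fun (arcs G)) (exact_forms G) (carrier (harmonic G))"
  by (intro double_quotient.intro double_quotient_axioms.intro comm_group_int_fun
      subgroup_exact_forms subgroup_harmonic)

lemma double_quotient_P_eqs:
  "double_quotient.B (int_fun (arcs G)) (exact_forms G) = H1 G"
  "double_quotient.R (int_fun (arcs G)) (exact_forms G) (carrier (harmonic G)) = P_rel G"
  "double_quotient.Q (int_fun (arcs G)) (exact_forms G) (carrier (harmonic G)) = P_group G"
  "double_quotient.cl (int_fun (arcs G)) (exact_forms G) (carrier (harmonic G)) = P_class G"
  using double_quotient_P
  by (simp_all add: double_quotient.B_def double_quotient.R_def double_quotient.Q_def
      double_quotient.cl_def H1_def P_rel_def P_group_def fun_eq_iff)

lemmas comm_group_P = double_quotient.comm_group_Q[OF double_quotient_P, unfolded double_quotient_P_eqs]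
  and P_class_hom = double_quotient.cl_hom[OF double_quotient_P, unfolded double_quotient_P_eqs]
  and P_class_epi = double_quotient.cl_epi[OF double_quotient_P, unfolded double_quotient_P_eqs]
  and P_rep_rep = double_quotient.rep_rep[OF double_quotient_P, unfolded double_quotient_P_eqs]

lemma P_class_eq_one_iff:
  assumes "\<omega> \<in> carrier (int_fun (arcs G))"
  shows "P_class G \<omega> = \<one>\<^bsub>P_group G\<^esub> \<longleftrightarrow>
    (\<exists>f\<in>carrier (int_fun (verts G)). \<exists>\<eta>\<in>carrier (harmonic G). \<omega> = diff G f \<otimes>\<^bsub>int_fun (arcs G)\<^esub> \<eta>)"
  using double_quotient.cl_eq_one_iff[OF double_quotient_P assms] unfolding double_quotient_P_eqs
  by (auto simp: exact_forms_def)

lemma pairing_dataD: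
  assumes "pairing_data G \<omega> (n, \<eta>, f)" "\<omega> \<in> carrier (int_fun (arcs G))"
  shows "n \<ge> 1" "\<eta> \<in> carrier (harmonic G)" "f \<in> carrier (int_fun (verts G))"
    "\<omega> [^]\<^bsub>int_fun (arcs G)\<^esub> n = diff G f \<otimes>\<^bsub>int_fun (arcs G)\<^esub> \<eta>"
  using assms by (auto simp: pairing_data_def pow_int_fun mult_int_fun fun_eq_iff)

text \<open>In n\<omega> = \<eta> + df both summands are trivial in P, so n kills the class of
  \<omega>. This is the hypothesis of \<open>dual_to_Ext1_iso\<close>.\<close>

lemma P_torsion:
  assumes "x \<in> carrier (P_group G)"
  shows "\<exists>n::nat. n \<ge> 1 \<and> x [^]\<^bsub>P_group G\<^esub> n = \<one>\<^bsub>P_group G\<^esub>"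
proof -
  let ?\<omega> = "rep (rep x)"
  have \<omega>: "?\<omega> \<in> carrier (int_fun (arcs G))" "P_class G ?\<omega> = x" using P_rep_rep[OF assms] by auto
  obtain n \<eta> f where d: "pairing_data G ?\<omega> (n, \<eta>, f)" using pairing_data_exists by blast
  have "x [^]\<^bsub>P_group G\<^esub> n = P_class G (?\<omega> [^]\<^bsub>int_fun (arcs G)\<^esub> n)"
    using group_hom.hom_nat_pow[of "int_fun (arcs G)" "P_group G" "P_class G" ?\<omega> n] \<omega>
      P_class_hom group_int_fun[of "arcs G"] comm_group.axioms(2)[OF comm_group_P]
    by (simp add: group_hom_def group_hom_axioms_def)
  also have "\<dots> = \<one>\<^bsub>P_group G\<^esub>"
    using P_class_eq_one_iff[of "?\<omega> [^]\<^bsub>int_fun (arcs G)\<^esub> n"] pairing_dataD[OF d \<omega>(1)] \<omega>(1)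
      monoid.nat_pow_closed[OF group.is_monoid[OF group_int_fun]] by blast
  finally show ?thesis using pairing_dataD(1)[OF d \<omega>(1)] by blast
qed

section \<open>Functionals on harmonic forms and their rational extension\<close>

lemma carrier_harmonic_dual:
  "\<phi> \<in> carrier (harmonic_dual G) \<longleftrightarrow>
    \<phi> \<in> hom (harmonic G) integer_group \<and> \<phi> \<in> extensional (carrier (harmonic G))"
  by (simp add: harmonic_dual_def carrier_hom_group)

lemma group_harmonic: "group (harmonic G)"
  by (rule comm_group.axioms(2)[OF comm_group_harmonic])

lemma comm_group_harmonic_dual: "comm_group (harmonic_dual G)"
  unfolding harmonic_dual_def by (rule comm_group_hom_group[OF group_harmonic abelian_integer_group])

lemma harmonic_combination:
  assumes "\<eta> \<in> carrier (harmonic G)" "\<theta> \<in> carrier (harmonic G)"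
  shows "(\<lambda>e\<in>arcs G. k * \<eta> e + l * \<theta> e) \<in> carrier (harmonic G)"
proof -
  have "codiff G (\<lambda>e\<in>arcs G. k * \<eta> e + l * \<theta> e) v = k * codiff G \<eta> v + l * codiff G \<theta> v"
    if "v \<in> verts G" for v
    using that by (simp add: codiff_eq_sum algebra_simps sum.distrib sum_distrib_left cong: sum.cong)
  then show ?thesis using assms by (simp add: carrier_harmonic)
qed

text \<open>Scaling is obtained from powers in the group of harmonic forms, whence the natural
  coefficients; the denominators in \<open>pairing_data\<close> are of this kind.\<close>

lemma harmonic_dual_combination:
  assumes \<phi>: "\<phi> \<in> carrier (harmonic_dual G)"
    and \<eta>: "\<eta> \<in> carrier (harmonic G)" and \<theta>: "\<theta> \<in> carrier (harmonic G)"
  shows "\<phi> (\<lambda>e\<in>arcs G. int k * \<eta> e + int l * \<theta> e) = int k * \<phi> \<eta> + int l * \<phi> \<theta>"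
proof -
  have hom: "\<phi> \<in> hom (harmonic G) integer_group" using \<phi> by (simp add: carrier_harmonic_dual)
  have pow: "x [^]\<^bsub>harmonic G\<^esub> (n::nat) = (\<lambda>e\<in>arcs G. int n * x e)" if "x \<in> carrier (harmonic G)" for x n
    using that by (induction n) (auto simp: mult_harmonic mult_int_fun one_harmonic fun_eq_iff algebra_simps)
  have \<phi>pow: "\<phi> (\<lambda>e\<in>arcs G. int n * x e) = int n * \<phi> x" if "x \<in> carrier (harmonic G)" for x n
    using group_hom.hom_nat_pow[of "harmonic G" integer_group \<phi> x n] that hom group_harmonic pow[OF that, of n]
    by (simp add: group_hom_def group_hom_axioms_def)
  have mul: "(\<lambda>e\<in>arcs G. int n * x e) \<in> carrier (harmonic G)" if "x \<in> carrier (harmonic G)" for x n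
    using harmonic_combination[OF that that, of "int n" 0] by simp
  have "(\<lambda>e\<in>arcs G. int k * \<eta> e + int l * \<theta> e)
      = (\<lambda>e\<in>arcs G. int k * \<eta> e) \<otimes>\<^bsub>harmonic G\<^esub> (\<lambda>e\<in>arcs G. int l * \<theta> e)"
    by (auto simp: mult_harmonic mult_int_fun)
  then have "\<phi> (\<lambda>e\<in>arcs G. int k * \<eta> e + int l * \<theta> e)
      = \<phi> (\<lambda>e\<in>arcs G. int k * \<eta> e) + \<phi> (\<lambda>e\<in>arcs G. int l * \<theta> e)"
    using hom_mult[OF hom mul[OF \<eta>, of k] mul[OF \<theta>, of l]] by simp
  then show ?thesis using \<phi>pow \<eta> \<theta> by simp
qed

text \<open>For two decompositions of multiples n\<omega> and m\<omega>, cross-multiplying shows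
  that m\<eta> - n\<theta> equals the differential of ng - mf. Being harmonic as well as exact, it
  is zero, so the two quotients agree.\<close>

lemma rat_extension_eq:
  assumes \<phi>: "\<phi> \<in> carrier (harmonic_dual G)" and d: "pairing_data G \<omega> (n, \<eta>, f)"
  shows "rat_extension G \<phi> \<omega> = of_int (\<phi> \<eta>) / of_nat n"
proof -
  obtain m \<theta> g where d': "(SOME y. pairing_data G \<omega> y) = (m, \<theta>, g)" by (metis prod_cases3)
  have "pairing_data G \<omega> (m, \<theta>, g)"
    using someI[of "pairing_data G \<omega>", OF d] by (simp add: d')
  then have m: "m \<ge> 1" and \<theta>: "\<theta> \<in> carrier (harmonic G)"
    and m\<omega>: "\<And>e. e \<in> arcs G \<Longrightarrow> int m * \<omega> e = \<theta> e + diff G g e"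
    by (auto simp: pairing_data_def)
  have n: "n \<ge> 1" and \<eta>: "\<eta> \<in> carrier (harmonic G)"
    and n\<omega>: "\<And>e. e \<in> arcs G \<Longrightarrow> int n * \<omega> e = \<eta> e + diff G f e"
    using d by (auto simp: pairing_data_def)
  have eq: "int m * \<eta> e = int n * \<theta> e" if e: "e \<in> arcs G" for e
  proof -
    let ?\<zeta> = "\<lambda>e\<in>arcs G. int m * \<eta> e + (- int n) * \<theta> e" and ?h = "\<lambda>v. int n * g v - int m * f v"
    have "?\<zeta> e = 0"
    proof (rule harmonic_exact_eq_zero[OF harmonic_combination[OF \<eta> \<theta>] _ e])
      fix e assume e: "e \<in> arcs G"
      have "int m * (\<eta> e + diff G f e) = int n * (\<theta> e + diff G g e)"
        using n\<omega>[OF e] m\<omega>[OF e] by (metis mult.left_commute)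
      then show "?\<zeta> e = diff G ?h e"
        using e by (simp add: diff_def algebra_simps)
    qed
    then show ?thesis using e by simp
  qed
  have "int m * \<phi> \<eta> = \<phi> (\<lambda>e\<in>arcs G. int m * \<eta> e)"
    using harmonic_dual_combination[OF \<phi> \<eta> \<eta>, of m 0] by simp
  also have "\<dots> = \<phi> (\<lambda>e\<in>arcs G. int n * \<theta> e)"
    using eq by (metis (no_types, lifting) restrict_ext)
  also have "\<dots> = int n * \<phi> \<theta>"
    using harmonic_dual_combination[OF \<phi> \<theta> \<theta>, of n 0] by simp
  finally have "rat_of_int (\<phi> \<theta>) * of_nat n = of_int (\<phi> \<eta>) * of_nat m"
    by (metis mult.commute of_int_mult of_int_of_nat_eq)
  then have "rat_of_int (\<phi> \<theta>) / of_nat m = of_int (\<phi> \<eta>) / of_nat n"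
    using m n by (simp add: frac_eq_eq)
  then show ?thesis by (simp add: rat_extension_def d')
qed

lemma rat_extension_harmonic:
  assumes "\<phi> \<in> carrier (harmonic_dual G)" "\<eta> \<in> carrier (harmonic G)"
  shows "rat_extension G \<phi> \<eta> = of_int (\<phi> \<eta>)"
proof -
  have "pairing_data G \<eta> (1, \<eta>, \<lambda>v\<in>verts G. 0)"
    using assms by (simp add: pairing_data_def diff_def)
  from rat_extension_eq[OF assms(1) this] show ?thesis by simp
qed

lemma rat_extension_exact:
  assumes "\<phi> \<in> carrier (harmonic_dual G)" "f \<in> carrier (int_fun (verts G))"
  shows "rat_extension G \<phi> (diff G f) = 0"
proof -
  have 0: "(\<lambda>e\<in>arcs G. 0) \<in> carrier (harmonic G)"
    using monoid.one_closed[OF group.is_monoid[OF group_harmonic]] by (simp add: one_harmonic)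
  have "pairing_data G (diff G f) (1, \<lambda>e\<in>arcs G. 0, f)"
    using assms 0 by (simp add: pairing_data_def)
  moreover have "\<phi> (\<lambda>e\<in>arcs G. 0) = 0"
    using assms(1) hom_one[of \<phi> "harmonic G" integer_group] group_harmonic
    by (simp add: carrier_harmonic_dual one_harmonic)
  ultimately show ?thesis
    using rat_extension_eq[OF assms(1)] by simp
qed

text \<open>Multiplying each decomposition by the denominator of the other gives a decomposition of
  the sum with denominator nm.\<close>

lemma rat_extension_hom:
  assumes \<phi>: "\<phi> \<in> carrier (harmonic_dual G)"
  shows "rat_extension G \<phi> \<in> hom (int_fun (arcs G)) rat_group"
proof (rule homI)
  fix \<omega> \<omega>'
  obtain n \<eta> f where d: "pairing_data G \<omega> (n, \<eta>, f)" using pairing_data_exists by blast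
  obtain m \<theta> g where d': "pairing_data G \<omega>' (m, \<theta>, g)" using pairing_data_exists by blast
  let ?\<zeta> = "\<lambda>e\<in>arcs G. int m * \<eta> e + int n * \<theta> e" and ?h = "\<lambda>v\<in>verts G. int m * f v + int n * g v"
  have \<eta>: "\<eta> \<in> carrier (harmonic G)" and \<theta>: "\<theta> \<in> carrier (harmonic G)"
    and n: "n \<ge> 1" and m: "m \<ge> 1"
    using d d' by (auto simp: pairing_data_def)
  have "int (n * m) * (\<omega> e + \<omega>' e) = ?\<zeta> e + diff G ?h e" if "e \<in> arcs G" for e
  proof -
    have "int (n * m) * (\<omega> e + \<omega>' e) = int m * (int n * \<omega> e) + int n * (int m * \<omega>' e)"
      by (simp add: algebra_simps)
    also have "\<dots> = int m * (\<eta> e + diff G f e) + int n * (\<theta> e + diff G g e)"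
      using d d' that by (simp add: pairing_data_def)
    also have "\<dots> = ?\<zeta> e + diff G ?h e"
      using that by (simp add: diff_def algebra_simps)
    finally show ?thesis .
  qed
  then have "pairing_data G (\<omega> \<otimes>\<^bsub>int_fun (arcs G)\<^esub> \<omega>') (n * m, ?\<zeta>, ?h)"
    using n m harmonic_combination[OF \<eta> \<theta>, of "int m" "int n"]
    by (simp add: pairing_data_def mult_int_fun del: of_nat_mult)
  from rat_extension_eq[OF \<phi> this] show
    "rat_extension G \<phi> (\<omega> \<otimes>\<^bsub>int_fun (arcs G)\<^esub> \<omega>') = rat_extension G \<phi> \<omega> \<otimes>\<^bsub>rat_group\<^esub> rat_extension G \<phi> \<omega>'"
    using n m by (simp add: rat_extension_eq[OF \<phi> d] rat_extension_eq[OF \<phi> d'] harmonic_dual_combination[OF \<phi> \<eta> \<theta>] field_simps)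
qed simp

text \<open>A nonzero multiple of \<omega> is harmonic plus exact, and the rationals are
  torsion-free. Later identities recognise the extension through this lemma instead of computing
  it.\<close>

lemma rat_extension_unique:
  assumes \<phi>: "\<phi> \<in> carrier (harmonic_dual G)" and \<Psi>: "\<Psi> \<in> hom (int_fun (arcs G)) rat_group"
    and ex: "\<And>f. f \<in> carrier (int_fun (verts G)) \<Longrightarrow> \<Psi> (diff G f) = 0"
    and ha: "\<And>\<eta>. \<eta> \<in> carrier (harmonic G) \<Longrightarrow> \<Psi> \<eta> = of_int (\<phi> \<eta>)"
    and \<omega>: "\<omega> \<in> carrier (int_fun (arcs G))"
  shows "rat_extension G \<phi> \<omega> = \<Psi> \<omega>"
proof -
  obtain n \<eta> f where d: "pairing_data G \<omega> (n, \<eta>, f)" using pairing_data_exists by blast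
  note D = pairing_dataD[OF d \<omega>]
  have "of_nat n * \<Psi> \<omega> = \<Psi> (diff G f \<otimes>\<^bsub>int_fun (arcs G)\<^esub> \<eta>)"
    using hom_rat_pow[OF group_int_fun \<Psi> \<omega>, of n] D(4) by simp
  also have "\<dots> = of_int (\<phi> \<eta>)"
    using hom_mult[OF \<Psi>, of "diff G f" \<eta>] D ex ha by (simp add: carrier_harmonic)
  finally have "of_nat n * \<Psi> \<omega> = of_int (\<phi> \<eta>)" .
  then show ?thesis
    unfolding rat_extension_eq[OF \<phi> d] using D(1) by (metis nonzero_mult_div_cancel_left not_one_le_zero of_nat_eq_0_iff)
qed

section \<open>Periods, the Jacobian and the pairing on classes\<close>

lemma carrier_cycles1: "\<gamma> \<in> cycles1 G \<longleftrightarrow> Poly_Mapping.keys \<gamma> \<subseteq> arcs G \<and> boundary G \<gamma> = 0"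
  by (simp add: cycles1_def kernel_def)

lemma integrate_in:
  assumes "Poly_Mapping.keys \<gamma> \<subseteq> arcs G"
  shows "integrate G \<gamma> \<in> carrier (harmonic_dual G)"
  unfolding integrate_def harmonic_dual_def
proof (rule restrict_in_hom_group[OF group.is_monoid[OF group_harmonic]])
  show "(\<lambda>\<omega>. chain_eval \<omega> \<gamma>) \<in> hom (harmonic G) integer_group"
    using chain_eval_int_fun_hom[OF assms] by (auto simp: hom_def mult_harmonic carrier_harmonic)
qed

lemma integrate_hom: "integrate G \<in> hom (free_Abelian_group (arcs G)) (harmonic_dual G)"
  by (rule homI)
    (auto simp: integrate_in, auto simp: integrate_def harmonic_dual_def mult_hom_group chain_eval_add)

lemma subgroup_cycles1: "subgroup (cycles1 G) (free_Abelian_group (arcs G))"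
proof -
  have "boundary G \<in> hom (free_Abelian_group (arcs G)) (free_Abelian_group (verts G))"
    using keys_boundary by (simp add: hom_def boundary_add)
  then interpret group_hom "free_Abelian_group (arcs G)" "free_Abelian_group (verts G)" "boundary G"
    by (simp add: group_hom_def group_hom_axioms_def)
  show ?thesis unfolding cycles1_def by (rule subgroup_kernel)
qed

lemma subgroup_periods: "subgroup (integrate G ` cycles1 G) (harmonic_dual G)"
  by (rule subgroup_hom_image[OF group_free_Abelian_group _ integrate_hom subgroup_cycles1])
    (rule comm_group.axioms(2)[OF comm_group_harmonic_dual])

lemma comm_group_Jac: "comm_group (Jac G)"
  unfolding Jac_def by (rule comm_group.abelian_FactGroup[OF comm_group_harmonic_dual subgroup_periods])

lemma Jac_class_hom: "Jac_class G \<in> hom (harmonic_dual G) (Jac G)"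
  unfolding Jac_def by (rule comm_group.r_coset_hom[OF comm_group_harmonic_dual subgroup_periods])

lemma Jac_rep:
  assumes "j \<in> carrier (Jac G)"
  shows "rep j \<in> carrier (harmonic_dual G)" "Jac_class G (rep j) = j"
  using comm_group.rep_coset[OF comm_group_harmonic_dual subgroup_periods] assms by (auto simp: Jac_def)

lemma mult_harmonic_dual:
  "\<phi> \<otimes>\<^bsub>harmonic_dual G\<^esub> \<psi> = (\<lambda>\<eta>\<in>carrier (harmonic G). \<phi> \<eta> + \<psi> \<eta>)"
  by (simp add: harmonic_dual_def mult_hom_group)

lemma rat_extension_mult:
  assumes \<phi>: "\<phi> \<in> carrier (harmonic_dual G)" and \<psi>: "\<psi> \<in> carrier (harmonic_dual G)"
    and \<omega>: "\<omega> \<in> carrier (int_fun (arcs G))"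
  shows "rat_extension G (\<phi> \<otimes>\<^bsub>harmonic_dual G\<^esub> \<psi>) \<omega> = rat_extension G \<phi> \<omega> + rat_extension G \<psi> \<omega>"
proof (rule rat_extension_unique[OF _ _ _ _ \<omega>])
  show "\<phi> \<otimes>\<^bsub>harmonic_dual G\<^esub> \<psi> \<in> carrier (harmonic_dual G)"
    using monoid.m_closed[OF group.is_monoid[OF comm_group.axioms(2)[OF comm_group_harmonic_dual]] \<phi> \<psi>] .
  show "(\<lambda>\<omega>. rat_extension G \<phi> \<omega> + rat_extension G \<psi> \<omega>) \<in> hom (int_fun (arcs G)) rat_group"
    using rat_extension_hom[OF \<phi>] rat_extension_hom[OF \<psi>] by (simp add: hom_def)
qed (use \<phi> \<psi> in \<open>auto simp: rat_extension_exact rat_extension_harmonic mult_harmonic_dual\<close>)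

text \<open>Evaluation at a cycle vanishes on exact forms by Stokes, so it is the extension. Its
  values are integers, which is why periods pair trivially with P.\<close>

lemma rat_extension_integrate_cycle:
  assumes "\<gamma> \<in> cycles1 G" "\<omega> \<in> carrier (int_fun (arcs G))"
  shows "rat_extension G (integrate G \<gamma>) \<omega> = of_int (chain_eval \<omega> \<gamma>)"
proof (rule rat_extension_unique[OF integrate_in _ _ _ assms(2)])
  show \<gamma>: "Poly_Mapping.keys \<gamma> \<subseteq> arcs G" using assms(1) by (simp add: carrier_cycles1)
  show "(\<lambda>\<omega>. rat_of_int (chain_eval \<omega> \<gamma>)) \<in> hom (int_fun (arcs G)) rat_group"
    by (rule of_int_hom[OF chain_eval_int_fun_hom[OF \<gamma>]])
  show "rat_of_int (chain_eval (diff G f) \<gamma>) = 0" for f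
    using assms(1) by (simp add: chain_eval_diff_boundary carrier_cycles1)
qed (simp add: integrate_def)

text \<open>Two representatives differ by df + \<eta>; the extension vanishes on df and takes the
  integer value \<phi>(\<eta>) on \<eta>.\<close>

lemma rat_extension_cong_P_class:
  assumes \<phi>: "\<phi> \<in> carrier (harmonic_dual G)"
    and \<omega>: "\<omega> \<in> carrier (int_fun (arcs G))" and \<omega>': "\<omega>' \<in> carrier (int_fun (arcs G))"
    and eq: "P_class G \<omega> = P_class G \<omega>'"
  shows "rat_class (rat_extension G \<phi> \<omega>) = rat_class (rat_extension G \<phi> \<omega>')"
proof -
  interpret A: comm_group "int_fun (arcs G)" by (rule comm_group_int_fun)
  have "P_class G (\<omega> \<otimes>\<^bsub>int_fun (arcs G)\<^esub> inv\<^bsub>int_fun (arcs G)\<^esub> \<omega>') = \<one>\<^bsub>P_group G\<^esub>"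
    using hom_eq_iff_quotient_one[OF comm_group_int_fun comm_group_P P_class_hom \<omega> \<omega>'] eq by simp
  then obtain f \<eta> where f: "f \<in> carrier (int_fun (verts G))" "\<eta> \<in> carrier (harmonic G)"
    "\<omega> \<otimes>\<^bsub>int_fun (arcs G)\<^esub> inv\<^bsub>int_fun (arcs G)\<^esub> \<omega>' = diff G f \<otimes>\<^bsub>int_fun (arcs G)\<^esub> \<eta>"
    using P_class_eq_one_iff[of "\<omega> \<otimes>\<^bsub>int_fun (arcs G)\<^esub> inv\<^bsub>int_fun (arcs G)\<^esub> \<omega>'"] \<omega> \<omega>' by auto
  have "rat_extension G \<phi> \<omega> - rat_extension G \<phi> \<omega>' = rat_extension G \<phi> (\<omega> \<otimes>\<^bsub>int_fun (arcs G)\<^esub> inv\<^bsub>int_fun (arcs G)\<^esub> \<omega>')"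
    using hom_mult[OF rat_extension_hom[OF \<phi>] \<omega> A.inv_closed[OF \<omega>']]
      hom_inv_comm[OF comm_group_int_fun comm_group_rat_group rat_extension_hom[OF \<phi>] \<omega>'] by simp
  also have "\<dots> = of_int (\<phi> \<eta>)"
    unfolding f(3) using hom_mult[OF rat_extension_hom[OF \<phi>], of "diff G f" \<eta>] f
    by (simp add: rat_extension_exact[OF \<phi>] rat_extension_harmonic[OF \<phi>] carrier_harmonic)
  finally show ?thesis by (simp add: rat_class_eq_iff)
qed

lemma rat_extension_cong_Jac_class:
  assumes \<phi>: "\<phi> \<in> carrier (harmonic_dual G)" and \<psi>: "\<psi> \<in> carrier (harmonic_dual G)"
    and eq: "Jac_class G \<phi> = Jac_class G \<psi>" and \<omega>: "\<omega> \<in> carrier (int_fun (arcs G))"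
  shows "rat_class (rat_extension G \<phi> \<omega>) = rat_class (rat_extension G \<psi> \<omega>)"
proof -
  interpret D: comm_group "harmonic_dual G" by (rule comm_group_harmonic_dual)
  obtain \<gamma> where \<gamma>: "\<gamma> \<in> cycles1 G" "\<phi> \<otimes>\<^bsub>harmonic_dual G\<^esub> inv\<^bsub>harmonic_dual G\<^esub> \<psi> = integrate G \<gamma>"
    using D.r_coset_eq_iff[OF subgroup_periods \<phi> \<psi>] eq by auto
  have \<gamma>_in: "integrate G \<gamma> \<in> carrier (harmonic_dual G)"
    using \<gamma>(1) by (intro integrate_in) (simp add: carrier_cycles1)
  have "\<phi> = integrate G \<gamma> \<otimes>\<^bsub>harmonic_dual G\<^esub> \<psi>"
    using \<phi> \<psi> by (simp add: \<gamma>(2)[symmetric] D.m_assoc)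
  then have "rat_extension G \<phi> \<omega> = of_int (chain_eval \<omega> \<gamma>) + rat_extension G \<psi> \<omega>"
    using rat_extension_mult[OF \<gamma>_in \<psi> \<omega>] rat_extension_integrate_cycle[OF \<gamma>(1) \<omega>] by simp
  then show ?thesis by (simp add: rat_class_eq_iff)
qed

text \<open>The definition evaluates at representatives of nested cosets; the two congruences above
  replace them by any given \<phi> and \<omega>.\<close>

lemma pairing_classes:
  assumes \<phi>: "\<phi> \<in> carrier (harmonic_dual G)" and \<omega>: "\<omega> \<in> carrier (int_fun (arcs G))"
  shows "pairing G (Jac_class G \<phi>) (P_class G \<omega>) = rat_class (rat_extension G \<phi> \<omega>)"
proof -
  have j: "rep (Jac_class G \<phi>) \<in> carrier (harmonic_dual G)" "Jac_class G (rep (Jac_class G \<phi>)) = Jac_class G \<phi>"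
    using Jac_rep hom_in_carrier[OF Jac_class_hom \<phi>] by auto
  have x: "rep (rep (P_class G \<omega>)) \<in> carrier (int_fun (arcs G))"
    "P_class G (rep (rep (P_class G \<omega>))) = P_class G \<omega>"
    using P_rep_rep hom_in_carrier[OF P_class_hom \<omega>] by auto
  show ?thesis
    unfolding pairing_eq_rat_extension
    using rat_extension_cong_Jac_class[OF j(1) \<phi> j(2) x(1)] rat_extension_cong_P_class[OF \<phi> x(1) \<omega> x(2)] by simp
qed

lemma Jac_to_dual_class:
  assumes "\<phi> \<in> carrier (harmonic_dual G)" "\<omega> \<in> carrier (int_fun (arcs G))"
  shows "Jac_to_dual G (Jac_class G \<phi>) (P_class G \<omega>) = rat_class (rat_extension G \<phi> \<omega>)"
  using pairing_classes[OF assms] hom_in_carrier[OF P_class_hom assms(2)] by (simp add: Jac_to_dual_def)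

text \<open>The extension modulo \<int> is a homomorphism on all forms that is trivial wherever the
  class in P is, so it factors through \<open>P_class\<close>.\<close>

lemma Jac_to_dual_in:
  assumes j: "j \<in> carrier (Jac G)"
  shows "Jac_to_dual G j \<in> carrier (hom_group (P_group G) rat_mod_int)"
proof -
  define \<phi> where "\<phi> = rep j"
  have \<phi>: "\<phi> \<in> carrier (harmonic_dual G)" and j\<phi>: "j = Jac_class G \<phi>"
    using Jac_rep[OF j] by (auto simp: \<phi>_def)
  have "(\<lambda>\<omega>. rat_class (rat_extension G \<phi> \<omega>)) \<in> hom (int_fun (arcs G)) rat_mod_int"
    using Group.hom_compose[OF rat_extension_hom[OF \<phi>] rat_class_hom] by (simp add: comp_def)
  moreover have "rat_class (rat_extension G \<phi> \<omega>) = \<one>\<^bsub>rat_mod_int\<^esub>"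
    if \<omega>: "\<omega> \<in> carrier (int_fun (arcs G))" and one: "P_class G \<omega> = \<one>\<^bsub>P_group G\<^esub>" for \<omega>
  proof -
    obtain f \<eta> where f: "f \<in> carrier (int_fun (verts G))" "\<eta> \<in> carrier (harmonic G)"
      "\<omega> = diff G f \<otimes>\<^bsub>int_fun (arcs G)\<^esub> \<eta>"
      using P_class_eq_one_iff[OF \<omega>] one by auto
    then have "rat_extension G \<phi> \<omega> = of_int (\<phi> \<eta>)"
      using hom_mult[OF rat_extension_hom[OF \<phi>], of "diff G f" \<eta>]
      by (simp add: rat_extension_exact[OF \<phi>] rat_extension_harmonic[OF \<phi>] carrier_harmonic)
    then show ?thesis by (simp add: rat_class_eq_one_iff)
  qed
  ultimately obtain k where k: "k \<in> hom (P_group G) rat_mod_int"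
    "\<And>\<omega>. \<omega> \<in> carrier (int_fun (arcs G)) \<Longrightarrow> k (P_class G \<omega>) = rat_class (rat_extension G \<phi> \<omega>)"
    using hom_factor_through_epi[OF comm_group_int_fun comm_group_P comm_group_rat_mod_int P_class_epi]
    by metis
  have "Jac_to_dual G j x = k x" if "x \<in> carrier (P_group G)" for x
    using P_rep_rep[OF that] k(2) Jac_to_dual_class[OF \<phi>] j\<phi> by metis
  then have "Jac_to_dual G j = restrict k (carrier (P_group G))"
    by (auto simp: fun_eq_iff Jac_to_dual_def)
  then show ?thesis
    using restrict_in_hom_group[OF group.is_monoid[OF comm_group.axioms(2)[OF comm_group_P]] k(1)] by simp
qed

end

context connected_digraph
begin

text \<open>Surjectivity: a lift \<open>\<Psi>: \<int>\<^sup>E \<rightarrow> \<rat>\<close> of a character is integral on exact forms, where it is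
  evaluation at a degree-zero 0-chain; subtracting evaluation at a 1-chain bounding it makes \<open>\<Psi>\<close>
  vanish on exact forms.\<close>

theorem Jac_to_dual_iso: "Jac_to_dual G \<in> iso (Jac G) (hom_group (P_group G) rat_mod_int)"
proof (rule isoI_comm_group)
  let ?A = "int_fun (arcs G)" and ?V = "int_fun (verts G)"
  let ?X = "hom_group (P_group G) rat_mod_int"
  interpret A: comm_group ?A by (rule comm_group_int_fun)
  show "comm_group (Jac G)" by (rule comm_group_Jac)
  show "comm_group ?X"
    by (rule comm_group_hom_group[OF comm_group.axioms(2)[OF comm_group_P] comm_group_rat_mod_int])
  have in_X_eqI: "\<chi> = \<chi>'" if "\<chi> \<in> carrier ?X" "\<chi>' \<in> carrier ?X"
    "\<And>\<omega>. \<omega> \<in> carrier ?A \<Longrightarrow> \<chi> (P_class G \<omega>) = \<chi>' (P_class G \<omega>)" for \<chi> \<chi>'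
  proof (rule extensionalityI[of _ "carrier (P_group G)"])
    show "\<chi> x = \<chi>' x" if "x \<in> carrier (P_group G)" for x
      using that(1) P_rep_rep[OF that] \<open>\<And>\<omega>. \<omega> \<in> carrier ?A \<Longrightarrow> \<chi> (P_class G \<omega>) = \<chi>' (P_class G \<omega>)\<close> by metis
  qed (use that in \<open>auto simp: carrier_hom_group\<close>)
  show "Jac_to_dual G \<in> hom (Jac G) ?X"
  proof (rule homI[OF Jac_to_dual_in])
    fix i j assume ij: "i \<in> carrier (Jac G)" "j \<in> carrier (Jac G)"
    define \<phi> \<psi> where "\<phi> = rep i" and "\<psi> = rep j"
    have \<phi>: "\<phi> \<in> carrier (harmonic_dual G)" "i = Jac_class G \<phi>"
      and \<psi>: "\<psi> \<in> carrier (harmonic_dual G)" "j = Jac_class G \<psi>"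
      using Jac_rep ij by (auto simp: \<phi>_def \<psi>_def)
    have \<phi>\<psi>: "\<phi> \<otimes>\<^bsub>harmonic_dual G\<^esub> \<psi> \<in> carrier (harmonic_dual G)"
      using monoid.m_closed[OF group.is_monoid[OF comm_group.axioms(2)[OF comm_group_harmonic_dual]] \<phi>(1) \<psi>(1)] .
    have ij_eq: "i \<otimes>\<^bsub>Jac G\<^esub> j = Jac_class G (\<phi> \<otimes>\<^bsub>harmonic_dual G\<^esub> \<psi>)"
      using hom_mult[OF Jac_class_hom \<phi>(1) \<psi>(1)] \<phi>(2) \<psi>(2) by simp
    show "Jac_to_dual G (i \<otimes>\<^bsub>Jac G\<^esub> j) = Jac_to_dual G i \<otimes>\<^bsub>?X\<^esub> Jac_to_dual G j"
    proof (rule in_X_eqI)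
      show "Jac_to_dual G (i \<otimes>\<^bsub>Jac G\<^esub> j) \<in> carrier ?X"
        using Jac_to_dual_in ij group.is_monoid[OF comm_group.axioms(2)[OF comm_group_Jac]]
        by (simp add: monoid.m_closed)
      show "Jac_to_dual G i \<otimes>\<^bsub>?X\<^esub> Jac_to_dual G j \<in> carrier ?X"
        using Jac_to_dual_in ij group.is_monoid[OF comm_group.axioms(2)[OF \<open>comm_group ?X\<close>]]
        by (simp add: monoid.m_closed)
      fix \<omega> assume \<omega>: "\<omega> \<in> carrier ?A"
      then have "(Jac_to_dual G i \<otimes>\<^bsub>?X\<^esub> Jac_to_dual G j) (P_class G \<omega>)
          = rat_class (rat_extension G \<phi> \<omega>) \<otimes>\<^bsub>rat_mod_int\<^esub> rat_class (rat_extension G \<psi> \<omega>)"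
        using hom_in_carrier[OF P_class_hom \<omega>] Jac_to_dual_class[OF \<phi>(1) \<omega>] Jac_to_dual_class[OF \<psi>(1) \<omega>]
        by (simp add: mult_hom_group \<phi>(2) \<psi>(2))
      then show "Jac_to_dual G (i \<otimes>\<^bsub>Jac G\<^esub> j) (P_class G \<omega>)
          = (Jac_to_dual G i \<otimes>\<^bsub>?X\<^esub> Jac_to_dual G j) (P_class G \<omega>)"
        using Jac_to_dual_class[OF \<phi>\<psi> \<omega>] rat_extension_mult[OF \<phi>(1) \<psi>(1) \<omega>] by (simp add: ij_eq rat_class_add)
    qed
  qed
  show "j = \<one>\<^bsub>Jac G\<^esub>" if j: "j \<in> carrier (Jac G)" and one: "Jac_to_dual G j = \<one>\<^bsub>?X\<^esub>" for j
  proof -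
    define \<phi> where "\<phi> = rep j"
    have \<phi>: "\<phi> \<in> carrier (harmonic_dual G)" "j = Jac_class G \<phi>"
      using Jac_rep j by (auto simp: \<phi>_def)
    have int: "rat_of_int \<lfloor>rat_extension G \<phi> \<omega>\<rfloor> = rat_extension G \<phi> \<omega>" if \<omega>: "\<omega> \<in> carrier ?A" for \<omega>
    proof -
      have "rat_class (rat_extension G \<phi> \<omega>) = \<one>\<^bsub>rat_mod_int\<^esub>"
        using Jac_to_dual_class[OF \<phi>(1) \<omega>] one \<phi>(2) hom_in_carrier[OF P_class_hom \<omega>]
        by (simp add: one_hom_group)
      then show ?thesis by (simp add: rat_class_eq_one_iff)
    qed
    \<comment> \<open>A trivial character leaves only integral values, so taking floors is exact and
      yields an integral functional on all forms.\<close>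
    have "(\<lambda>\<omega>. \<lfloor>rat_extension G \<phi> \<omega>\<rfloor>) \<in> hom ?A integer_group"
    proof (rule homI)
      fix x y assume xy: "x \<in> carrier ?A" "y \<in> carrier ?A"
      have "rat_of_int \<lfloor>rat_extension G \<phi> (x \<otimes>\<^bsub>?A\<^esub> y)\<rfloor> = rat_of_int (\<lfloor>rat_extension G \<phi> x\<rfloor> + \<lfloor>rat_extension G \<phi> y\<rfloor>)"
        unfolding of_int_add int[OF xy(1)] int[OF xy(2)] int[OF A.m_closed[OF xy]]
        using hom_mult[OF rat_extension_hom[OF \<phi>(1)] xy] by simp
      then show "\<lfloor>rat_extension G \<phi> (x \<otimes>\<^bsub>?A\<^esub> y)\<rfloor> = \<lfloor>rat_extension G \<phi> x\<rfloor> \<otimes>\<^bsub>integer_group\<^esub> \<lfloor>rat_extension G \<phi> y\<rfloor>"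
        by (simp only: of_int_eq_iff mult_integer_group)
    qed simp
    then obtain \<gamma> where \<gamma>: "Poly_Mapping.keys \<gamma> \<subseteq> arcs G"
      "\<And>\<omega>. \<omega> \<in> carrier ?A \<Longrightarrow> \<lfloor>rat_extension G \<phi> \<omega>\<rfloor> = chain_eval \<omega> \<gamma>"
      using int_fun_hom_eq_chain_eval[OF finite_arcs] by blast
    \<comment> \<open>By Stokes, the coefficient at v is the value of the extension on the
      differential of the indicator of v, hence zero.\<close>
    have "Poly_Mapping.lookup (boundary G \<gamma>) v = 0" for v
    proof (cases "v \<in> verts G")
      case True
      then show ?thesis
        using \<gamma>(2)[of "diff G (delta (verts G) v)"] rat_extension_exact[OF \<phi>(1), of "delta (verts G) v"]
          chain_eval_diff_boundary[OF \<gamma>(1), of "delta (verts G) v"] chain_eval_delta[OF keys_boundary[OF \<gamma>(1)] True]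
        by simp
    next
      case False
      then show ?thesis using keys_boundary[OF \<gamma>(1)] by (meson in_keys_iff subsetD)
    qed
    then have "boundary G \<gamma> = 0" by (intro poly_mapping_eqI) simp
    then have cyc: "\<gamma> \<in> cycles1 G" using \<gamma>(1) by (simp add: carrier_cycles1)
    have "\<phi> = integrate G \<gamma>"
    proof (rule extensionalityI[of _ "carrier (harmonic G)"])
      fix \<eta> assume \<eta>: "\<eta> \<in> carrier (harmonic G)"
      then show "\<phi> \<eta> = integrate G \<gamma> \<eta>"
        using \<gamma>(2)[of \<eta>] rat_extension_harmonic[OF \<phi>(1) \<eta>] by (simp add: integrate_def carrier_harmonic)
    qed (use \<phi>(1) in \<open>auto simp: carrier_harmonic_dual integrate_def\<close>)
    then have "Jac_class G \<phi> = integrate G ` cycles1 G"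
      using cyc group.coset_join2[OF comm_group.axioms(2)[OF comm_group_harmonic_dual] \<phi>(1) subgroup_periods]
      by blast
    then show ?thesis by (simp add: \<phi>(2) Jac_def)
  qed
  show "\<exists>j\<in>carrier (Jac G). Jac_to_dual G j = \<chi>" if \<chi>: "\<chi> \<in> carrier ?X" for \<chi>
  proof -
    have \<chi>hom: "\<chi> \<in> hom (P_group G) rat_mod_int" using \<chi> by (simp add: carrier_hom_group)
    \<comment> \<open>The forms are free on the indicators of arcs, so \<Psi> is obtained by lifting
      the values of \<chi> on these classes.\<close>
    have "\<forall>e. \<exists>q. rat_class q = \<chi> (P_class G (delta (arcs G) e))"
      by (intro allI rat_class_surj hom_in_carrier[OF \<chi>hom] hom_in_carrier[OF P_class_hom] delta_in)
    from choice[OF this] obtain s where s: "\<And>e. rat_class (s e) = \<chi> (P_class G (delta (arcs G) e))"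
      by blast
    define \<Psi> where "\<Psi> \<omega> = (\<Sum>e\<in>arcs G. of_int (\<omega> e) * s e)" for \<omega> :: "'b \<Rightarrow> int"
    have \<Psi>: "\<Psi> \<in> hom ?A rat_group"
      by (rule homI) (auto simp: \<Psi>_def mult_int_fun algebra_simps sum.distrib)
    have \<Psi>\<delta>: "\<Psi> (delta (arcs G) e) = s e" if "e \<in> arcs G" for e
      using that by (simp add: \<Psi>_def delta_def if_distrib[of of_int] if_distrib[of "\<lambda>x. x * _"] cong: if_cong)
    have \<Psi>\<chi>: "rat_class (\<Psi> \<omega>) = \<chi> (P_class G \<omega>)" if "\<omega> \<in> carrier ?A" for \<omega>
    proof -
      have "(rat_class \<circ> \<Psi>) \<omega> = (\<chi> \<circ> P_class G) \<omega>"
        by (rule int_fun_hom_eqI[OF finite_arcs comm_group_rat_mod_int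
              Group.hom_compose[OF \<Psi> rat_class_hom] Group.hom_compose[OF P_class_hom \<chi>hom] _ that])
          (simp add: \<Psi>\<delta> s)
      then show ?thesis by simp
    qed
    have int: "\<Psi> \<omega> \<in> \<int>" if "\<omega> \<in> carrier ?A" "P_class G \<omega> = \<one>\<^bsub>P_group G\<^esub>" for \<omega>
      using \<Psi>\<chi>[OF that(1)] that(2) hom_one[OF \<chi>hom] comm_group.axioms(2)[OF comm_group_P]
        comm_group.axioms(2)[OF comm_group_rat_mod_int] rat_class_eq_one_iff by metis
    have zero_harm: "(\<lambda>e\<in>arcs G. 0) \<in> carrier (harmonic G)"
      using monoid.one_closed[OF group.is_monoid[OF group_harmonic]] by (simp add: one_harmonic)
    have int_exact: "rat_of_int \<lfloor>\<Psi> (diff G f)\<rfloor> = \<Psi> (diff G f)" if f: "f \<in> carrier ?V" for f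
    proof -
      have "diff G f = diff G f \<otimes>\<^bsub>?A\<^esub> (\<lambda>e\<in>arcs G. 0)"
        by (auto simp: mult_int_fun diff_def)
      then have "P_class G (diff G f) = \<one>\<^bsub>P_group G\<^esub>"
        using P_class_eq_one_iff[OF diff_in, of f] f zero_harm by blast
      then show ?thesis using int[OF diff_in] by simp
    qed
    interpret V: comm_group ?V by (rule comm_group_int_fun)
    have "(\<lambda>f. \<lfloor>\<Psi> (diff G f)\<rfloor>) \<in> hom ?V integer_group"
    proof (rule homI)
      fix f g assume fg: "f \<in> carrier ?V" "g \<in> carrier ?V"
      have "rat_of_int \<lfloor>\<Psi> (diff G (f \<otimes>\<^bsub>?V\<^esub> g))\<rfloor> = rat_of_int (\<lfloor>\<Psi> (diff G f)\<rfloor> + \<lfloor>\<Psi> (diff G g)\<rfloor>)"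
        unfolding of_int_add int_exact[OF fg(1)] int_exact[OF fg(2)] int_exact[OF V.m_closed[OF fg]]
        using hom_mult[OF diff_hom fg] hom_mult[OF \<Psi> diff_in diff_in, of f g] by simp
      then show "\<lfloor>\<Psi> (diff G (f \<otimes>\<^bsub>?V\<^esub> g))\<rfloor> = \<lfloor>\<Psi> (diff G f)\<rfloor> \<otimes>\<^bsub>integer_group\<^esub> \<lfloor>\<Psi> (diff G g)\<rfloor>"
        by (simp only: of_int_eq_iff mult_integer_group)
    qed simp
    then obtain c where c: "Poly_Mapping.keys c \<subseteq> verts G"
      "\<And>f. f \<in> carrier ?V \<Longrightarrow> \<lfloor>\<Psi> (diff G f)\<rfloor> = chain_eval f c"
      using int_fun_hom_eq_chain_eval[OF finite_verts] by blast
    \<comment> \<open>The degree is the value of the constant function 1 on c, and that function has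
      zero differential.\<close>
    have "chain_degree c = 0"
    proof -
      have "chain_degree c = chain_eval (\<lambda>v\<in>verts G. 1) c"
      proof -
        have "chain_eval (\<lambda>v\<in>verts G. 1) c = chain_eval (\<lambda>_. 1) c"
          by (rule chain_eval_cong) (use c(1) in auto)
        then show ?thesis by (simp add: chain_eval_const)
      qed
      also have "\<dots> = \<lfloor>\<Psi> (diff G (\<lambda>v\<in>verts G. 1))\<rfloor>" using c(2) by simp
      also have "\<dots> = 0" by (simp add: \<Psi>_def diff_def)
      finally show ?thesis .
    qed
    then obtain \<gamma> where \<gamma>: "Poly_Mapping.keys \<gamma> \<subseteq> arcs G" "boundary G \<gamma> = c"
      using boundary_surj_deg0[OF c(1)] by blast
    define \<Psi>' where "\<Psi>' \<omega> = \<Psi> \<omega> - of_int (chain_eval \<omega> \<gamma>)" for \<omega>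
    have \<Psi>': "\<Psi>' \<in> hom ?A rat_group"
      using \<Psi> chain_eval_int_fun_hom[OF \<gamma>(1)] by (simp add: hom_def \<Psi>'_def)
    have \<Psi>'_exact: "\<Psi>' (diff G f) = 0" if "f \<in> carrier ?V" for f
      using int_exact[OF that] c(2)[OF that] chain_eval_diff_boundary[OF \<gamma>(1), of f] \<gamma>(2)
      by (simp add: \<Psi>'_def)
    \<comment> \<open>A harmonic form is trivial in P, so \<Psi> is integral on it; evaluation at
      \<gamma> changes the value by an integer.\<close>
    have \<Psi>'_harm: "rat_of_int \<lfloor>\<Psi>' \<eta>\<rfloor> = \<Psi>' \<eta>" if \<eta>: "\<eta> \<in> carrier (harmonic G)" for \<eta>
    proof -
      have \<eta>A: "\<eta> \<in> carrier ?A" using \<eta> by (simp add: carrier_harmonic)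
      have "\<eta> = diff G (\<lambda>v\<in>verts G. 0) \<otimes>\<^bsub>?A\<^esub> \<eta>"
        using \<eta>A by (auto simp: mult_int_fun diff_def carrier_int_fun extensional_def fun_eq_iff)
      then have "P_class G \<eta> = \<one>\<^bsub>P_group G\<^esub>"
        using P_class_eq_one_iff[OF \<eta>A] \<eta> restrict_in_int_fun by metis
      then show ?thesis using int[OF \<eta>A] by (simp add: \<Psi>'_def)
    qed
    define \<phi> where "\<phi> = (\<lambda>\<eta>\<in>carrier (harmonic G). \<lfloor>\<Psi>' \<eta>\<rfloor>)"
    have \<phi>: "\<phi> \<in> carrier (harmonic_dual G)"
      unfolding \<phi>_def harmonic_dual_def
    proof (rule restrict_in_hom_group[OF group.is_monoid[OF group_harmonic] homI])
      fix x y assume xy: "x \<in> carrier (harmonic G)" "y \<in> carrier (harmonic G)"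
      have xy': "x \<otimes>\<^bsub>harmonic G\<^esub> y \<in> carrier (harmonic G)"
        using xy group.is_monoid[OF group_harmonic] by (simp add: monoid.m_closed)
      have "rat_of_int \<lfloor>\<Psi>' (x \<otimes>\<^bsub>harmonic G\<^esub> y)\<rfloor> = rat_of_int (\<lfloor>\<Psi>' x\<rfloor> + \<lfloor>\<Psi>' y\<rfloor>)"
        unfolding of_int_add \<Psi>'_harm[OF xy(1)] \<Psi>'_harm[OF xy(2)] \<Psi>'_harm[OF xy']
        using hom_mult[OF \<Psi>', of x y] xy by (simp add: mult_harmonic carrier_harmonic)
      then show "\<lfloor>\<Psi>' (x \<otimes>\<^bsub>harmonic G\<^esub> y)\<rfloor> = \<lfloor>\<Psi>' x\<rfloor> \<otimes>\<^bsub>integer_group\<^esub> \<lfloor>\<Psi>' y\<rfloor>"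
        by (simp only: of_int_eq_iff mult_integer_group)
    qed simp
    have j: "Jac_class G \<phi> \<in> carrier (Jac G)" by (rule hom_in_carrier[OF Jac_class_hom \<phi>])
    have "Jac_to_dual G (Jac_class G \<phi>) = \<chi>"
    proof (rule in_X_eqI[OF Jac_to_dual_in[OF j] \<chi>])
      fix \<omega> assume \<omega>: "\<omega> \<in> carrier ?A"
      have "rat_extension G \<phi> \<omega> = \<Psi>' \<omega>"
        by (rule rat_extension_unique[OF \<phi> \<Psi>' \<Psi>'_exact _ \<omega>]) (simp_all add: \<phi>_def \<Psi>'_harm del: of_int_floor_cancel)
      then have "rat_class (rat_extension G \<phi> \<omega>) = rat_class (\<Psi> \<omega>)"
        by (simp add: rat_class_eq_iff \<Psi>'_def)
      then show "Jac_to_dual G (Jac_class G \<phi>) (P_class G \<omega>) = \<chi> (P_class G \<omega>)"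
        using Jac_to_dual_class[OF \<phi> \<omega>] \<Psi>\<chi>[OF \<omega>] by simp
    qed
    then show ?thesis using j by blast
  qed
qed

end

subsection \<open>Functions modulo constants\<close>

abbreviation fmc_class :: "'i set \<Rightarrow> ('i \<Rightarrow> int) \<Rightarrow> ('i \<Rightarrow> int) set"
  where "fmc_class I g \<equiv> const_funs I #>\<^bsub>int_fun I\<^esub> g"

lemma subgroup_const_funs: "subgroup (const_funs I) (int_fun I)"
proof (rule group.subgroupI[OF group_int_fun])
  fix x y assume "x \<in> const_funs I" "y \<in> const_funs I"
  then obtain a b where ab: "x = (\<lambda>i\<in>I. a)" "y = (\<lambda>i\<in>I. b)" by (auto simp: const_funs_def)
  have "inv\<^bsub>int_fun I\<^esub> x = (\<lambda>i\<in>I. - a)" "x \<otimes>\<^bsub>int_fun I\<^esub> y = (\<lambda>i\<in>I. a + b)"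
    by (auto simp: ab inv_int_fun mult_int_fun fun_eq_iff)
  then show "inv\<^bsub>int_fun I\<^esub> x \<in> const_funs I" "x \<otimes>\<^bsub>int_fun I\<^esub> y \<in> const_funs I"
    by (auto simp: const_funs_def)
qed (auto simp: const_funs_def)

lemma comm_group_fun_mod_const: "comm_group (fun_mod_const I)"
  unfolding fun_mod_const_def
  by (rule comm_group.abelian_FactGroup[OF comm_group_int_fun subgroup_const_funs])

lemma fmc_class_hom: "fmc_class I \<in> hom (int_fun I) (fun_mod_const I)"
  unfolding fun_mod_const_def by (rule comm_group.r_coset_hom[OF comm_group_int_fun subgroup_const_funs])

lemma fmc_rep:
  assumes "X \<in> carrier (fun_mod_const I)"
  shows "rep X \<in> carrier (int_fun I)" "fmc_class I (rep X) = X"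
  using comm_group.rep_coset[OF comm_group_int_fun subgroup_const_funs assms[unfolded fun_mod_const_def]] .

lemma fmc_class_eq_one_iff:
  assumes "g \<in> carrier (int_fun I)"
  shows "fmc_class I g = \<one>\<^bsub>fun_mod_const I\<^esub> \<longleftrightarrow> g \<in> const_funs I"
  using group.coset_join1[OF group_int_fun[of I], of "const_funs I" g]
    group.coset_join2[OF group_int_fun assms subgroup_const_funs]
    subgroup.subset[OF subgroup_const_funs, of I] subgroup_const_funs[of I] assms
  by (auto simp: fun_mod_const_def)

lemma fmc_class_eq_iff:
  assumes "g \<in> carrier (int_fun I)" "g' \<in> carrier (int_fun I)"
  shows "fmc_class I g = fmc_class I g' \<longleftrightarrow> (\<exists>a. \<forall>i\<in>I. g i = g' i + a)"
proof -
  have "fmc_class I g = fmc_class I g' \<longleftrightarrow> (\<lambda>i\<in>I. g i - g' i) \<in> const_funs I"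
    using comm_group.r_coset_eq_iff[OF comm_group_int_fun subgroup_const_funs assms] assms
    by (simp add: inv_int_fun mult_int_fun cong: restrict_cong)
  also have "\<dots> \<longleftrightarrow> (\<exists>a. \<forall>i\<in>I. g i = g' i + a)"
  proof
    assume "(\<lambda>i\<in>I. g i - g' i) \<in> const_funs I"
    then obtain a where a: "(\<lambda>i\<in>I. g i - g' i) = (\<lambda>i\<in>I. a)" by (auto simp: const_funs_def)
    have "g i = g' i + a" if "i \<in> I" for i
      using fun_cong[OF a, of i] that by simp
    then show "\<exists>a. \<forall>i\<in>I. g i = g' i + a" by blast
  next
    assume "\<exists>a. \<forall>i\<in>I. g i = g' i + a"
    then obtain a where "\<forall>i\<in>I. g i = g' i + a" by blast
    then have "(\<lambda>i\<in>I. g i - g' i) = (\<lambda>i\<in>I. a)" by (auto simp: fun_eq_iff)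
    then show "(\<lambda>i\<in>I. g i - g' i) \<in> const_funs I" by (auto simp: const_funs_def)
  qed
  finally show ?thesis .
qed

section \<open>Chains of degree zero as the dual of functions modulo constants\<close>

lemma carrier_chains_deg0:
  "D \<in> carrier (chains_deg0 I) \<longleftrightarrow> Poly_Mapping.keys D \<subseteq> I \<and> chain_degree D = 0"
  by (simp add: chains_deg0_def)

lemma chain_degree_eq_eval: "chain_degree c = chain_eval (\<lambda>_. 1) c"
  by (simp add: chain_eval_const)

lemma comm_group_chains_deg0: "comm_group (chains_deg0 I)"
proof -
  have "subgroup {c \<in> carrier (free_Abelian_group I). chain_degree c = 0} (free_Abelian_group I)"
  proof (rule group.subgroupI[OF group_free_Abelian_group])
    have "0 \<in> {c \<in> carrier (free_Abelian_group I). chain_degree c = 0}"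
      by (simp add: chain_degree_def)
    then show "{c \<in> carrier (free_Abelian_group I). chain_degree c = 0} \<noteq> {}" by blast
  next
    fix x assume "x \<in> {c \<in> carrier (free_Abelian_group I). chain_degree c = 0}"
    then show "inv\<^bsub>free_Abelian_group I\<^esub> x \<in> {c \<in> carrier (free_Abelian_group I). chain_degree c = 0}"
      using chain_eval_diff[of "\<lambda>_. 1" 0 x] by (simp add: chain_degree_eq_eval)
  next
    fix x y
    assume "x \<in> {c \<in> carrier (free_Abelian_group I). chain_degree c = 0}"
      "y \<in> {c \<in> carrier (free_Abelian_group I). chain_degree c = 0}"
    then show "x \<otimes>\<^bsub>free_Abelian_group I\<^esub> y \<in> {c \<in> carrier (free_Abelian_group I). chain_degree c = 0}"
      using keys_add[of x y] by (auto simp: chain_degree_eq_eval chain_eval_add)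
  qed auto
  from subgroup.subgroup_is_group[OF this] have "group (chains_deg0 I)"
    by (simp add: chains_deg0_def)
  then show ?thesis
    by (rule group.group_comm_groupI) (simp add: chains_deg0_def add.commute)
qed

text \<open>The chosen representative differs from g by a constant a, which contributes a times the
  degree of D, that is, zero.\<close>

lemma deg0_to_dual_class:
  assumes D: "D \<in> carrier (chains_deg0 I)" and g: "g \<in> carrier (int_fun I)"
  shows "deg0_to_dual I D (fmc_class I g) = chain_eval g D"
proof -
  have X: "fmc_class I g \<in> carrier (fun_mod_const I)" by (rule hom_in_carrier[OF fmc_class_hom g])
  obtain a where a: "\<And>i. i \<in> I \<Longrightarrow> rep (fmc_class I g) i = g i + a"
    using fmc_class_eq_iff[OF fmc_rep(1)[OF X] g] fmc_rep(2)[OF X] by auto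
  have "chain_eval (rep (fmc_class I g)) D = chain_eval (\<lambda>i. g i + a) D"
    by (rule chain_eval_cong) (use a D in \<open>auto simp: carrier_chains_deg0\<close>)
  then show ?thesis
    using X D by (simp add: deg0_to_dual_def chain_eval_fun_add chain_eval_const carrier_chains_deg0)
qed

lemma deg0_to_dual_in:
  assumes D: "D \<in> carrier (chains_deg0 I)"
  shows "deg0_to_dual I D \<in> carrier (hom_group (fun_mod_const I) integer_group)"
proof -
  have "deg0_to_dual I D \<in> hom (fun_mod_const I) integer_group"
  proof (rule homI)
    fix X Y assume XY: "X \<in> carrier (fun_mod_const I)" "Y \<in> carrier (fun_mod_const I)"
    note X = fmc_rep[OF XY(1)] and Y = fmc_rep[OF XY(2)]
    have g: "rep X \<otimes>\<^bsub>int_fun I\<^esub> rep Y \<in> carrier (int_fun I)"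
      by (simp add: mult_int_fun)
    have "X \<otimes>\<^bsub>fun_mod_const I\<^esub> Y = fmc_class I (rep X \<otimes>\<^bsub>int_fun I\<^esub> rep Y)"
      using hom_mult[OF fmc_class_hom X(1) Y(1)] X(2) Y(2) by simp
    then have "deg0_to_dual I D (X \<otimes>\<^bsub>fun_mod_const I\<^esub> Y) = chain_eval (rep X \<otimes>\<^bsub>int_fun I\<^esub> rep Y) D"
      using deg0_to_dual_class[OF D g] by simp
    also have "\<dots> = chain_eval (rep X) D + chain_eval (rep Y) D"
      using hom_mult[OF chain_eval_int_fun_hom X(1) Y(1), of D] D by (simp add: carrier_chains_deg0)
    finally show "deg0_to_dual I D (X \<otimes>\<^bsub>fun_mod_const I\<^esub> Y)
        = deg0_to_dual I D X \<otimes>\<^bsub>integer_group\<^esub> deg0_to_dual I D Y"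
      using XY by (simp add: deg0_to_dual_def)
  qed simp
  then show ?thesis by (simp add: carrier_hom_group deg0_to_dual_def)
qed

text \<open>Indicators recover the coefficients of D. Conversely, a functional pulled back to all
  functions on the finite set I is evaluation at some D, and its vanishing on the constant 1 says
  that D has degree zero.\<close>

theorem deg0_to_dual_iso:
  assumes "finite I"
  shows "deg0_to_dual I \<in> iso (chains_deg0 I) (hom_group (fun_mod_const I) integer_group)"
proof (rule isoI_comm_group[OF comm_group_chains_deg0])
  let ?H = "hom_group (fun_mod_const I) integer_group"
  show "comm_group ?H"
    by (rule comm_group_hom_group[OF comm_group.axioms(2)[OF comm_group_fun_mod_const] abelian_integer_group])
  show "deg0_to_dual I \<in> hom (chains_deg0 I) ?H"
    by (rule homI[OF deg0_to_dual_in])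
      (auto simp: deg0_to_dual_def mult_hom_group chains_deg0_def chain_eval_add)
  show "D = \<one>\<^bsub>chains_deg0 I\<^esub>" if D: "D \<in> carrier (chains_deg0 I)" and one: "deg0_to_dual I D = \<one>\<^bsub>?H\<^esub>" for D
  proof -
    have "Poly_Mapping.lookup D i = 0" for i
    proof (cases "i \<in> I")
      case True
      then show ?thesis
        using deg0_to_dual_class[OF D delta_in, of i] one D chain_eval_delta[of D I i]
          hom_in_carrier[OF fmc_class_hom delta_in, of I i]
        by (simp add: one_hom_group carrier_chains_deg0)
    next
      case False
      then show ?thesis using D by (meson carrier_chains_deg0 in_keys_iff subsetD)
    qed
    then show ?thesis by (auto simp: chains_deg0_def intro: poly_mapping_eqI)
  qed
  show "\<exists>D\<in>carrier (chains_deg0 I). deg0_to_dual I D = h" if h: "h \<in> carrier ?H" for h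
  proof -
    have hhom: "h \<in> hom (fun_mod_const I) integer_group" using h by (simp add: carrier_hom_group)
    obtain D where D: "Poly_Mapping.keys D \<subseteq> I"
      "\<And>g. g \<in> carrier (int_fun I) \<Longrightarrow> h (fmc_class I g) = chain_eval g D"
      using int_fun_hom_eq_chain_eval[OF assms Group.hom_compose[OF fmc_class_hom hhom]] by auto
    have "(\<lambda>i\<in>I. 1) \<in> const_funs I" by (auto simp: const_funs_def)
    then have "fmc_class I (\<lambda>i\<in>I. 1) = \<one>\<^bsub>fun_mod_const I\<^esub>"
      using fmc_class_eq_one_iff[of "\<lambda>i\<in>I. 1" I] by simp
    then have "chain_eval (\<lambda>i\<in>I. 1) D = 0"
      using D(2)[of "\<lambda>i\<in>I. 1"] hom_one[OF hhom comm_group.axioms(2)[OF comm_group_fun_mod_const]] by simp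
    moreover have "chain_eval (\<lambda>i\<in>I. 1) D = chain_eval (\<lambda>_. 1) D"
      by (rule chain_eval_cong) (use D(1) in auto)
    ultimately have D0: "D \<in> carrier (chains_deg0 I)"
      using D(1) by (simp add: carrier_chains_deg0 chain_degree_eq_eval)
    have "deg0_to_dual I D = h"
    proof (rule extensionalityI[of _ "carrier (fun_mod_const I)"])
      fix X assume "X \<in> carrier (fun_mod_const I)"
      from fmc_rep[OF this] show "deg0_to_dual I D X = h X"
        using D(2) deg0_to_dual_class[OF D0] by metis
    qed (use h in \<open>auto simp: carrier_hom_group deg0_to_dual_def\<close>)
    then show ?thesis using D0 by blast
  qed
qed

subsection \<open>The extension of P by the modulus\<close>

lemma comm_group_DirProd:
  assumes "comm_group G" "comm_group H"
  shows "comm_group (G \<times>\<times> H)"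
proof -
  interpret G: comm_group G by fact
  interpret H: comm_group H by fact
  show ?thesis
    by (rule group.group_comm_groupI[OF DirProd_group[OF G.group_axioms H.group_axioms]])
      (auto simp: G.m_comm H.m_comm)
qed

locale modulus_digraph = connected_digraph +
  fixes I :: "'i set" and \<rho> :: "'i \<Rightarrow> 'a"
  assumes finite_I: "finite I" and \<rho>_in: "\<rho> \<in> I \<rightarrow> verts G"
begin

abbreviation "A \<equiv> int_fun (arcs G)"
abbreviation "Z \<equiv> A \<times>\<times> int_fun I"
abbreviation "pcl z \<equiv> P_mod_class G I \<rho> z"

lemma comm_group_Z: "comm_group Z"
  by (rule comm_group_DirProd[OF comm_group_int_fun comm_group_int_fun])

text \<open>These are the coboundaries of the extended graph, hence the image of a homomorphism in
  the pair of f on V and the value a at the added vertex.\<close>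

lemma subgroup_exact_forms_mod: "subgroup (exact_forms_mod G I \<rho>) Z"
proof -
  let ?h = "\<lambda>(f, a). (diff G f, \<lambda>i\<in>I. f (\<rho> i) - a)"
  let ?V = "int_fun (verts G) \<times>\<times> integer_group"
  have V: "group ?V" by (rule DirProd_group[OF group_int_fun group_integer_group])
  have "?h \<in> hom ?V Z"
  proof (rule homI)
    fix x y assume "x \<in> carrier ?V" "y \<in> carrier ?V"
    then obtain f a g b where xy: "x = (f, a)" "y = (g, b)" "f \<in> carrier (int_fun (verts G))" "g \<in> carrier (int_fun (verts G))"
      by auto
    have "diff G (f \<otimes>\<^bsub>int_fun (verts G)\<^esub> g) = diff G f \<otimes>\<^bsub>A\<^esub> diff G g"
      using hom_mult[OF diff_hom] xy by simp
    then show "?h (x \<otimes>\<^bsub>?V\<^esub> y) = ?h x \<otimes>\<^bsub>Z\<^esub> ?h y"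
      using \<rho>_in by (auto simp: xy(1,2) mult_int_fun fun_eq_iff)
  qed auto
  from subgroup_hom_image[OF V comm_group.axioms(2)[OF comm_group_Z] this group.subgroup_self[OF V]]
  have "subgroup (?h ` carrier ?V) Z" .
  also have "?h ` carrier ?V = exact_forms_mod G I \<rho>"
    by (auto simp: exact_forms_mod_def)
  finally show ?thesis .
qed

lemma subgroup_harmonic_mod: "subgroup (carrier (harmonic G) \<times> {\<one>\<^bsub>int_fun I\<^esub>}) Z"
  by (rule DirProd_subgroups[OF group_int_fun subgroup_harmonic group_int_fun
        group.triv_subgroup[OF group_int_fun]])

lemma double_quotient_P_mod:
  "double_quotient Z (exact_forms_mod G I \<rho>) (carrier (harmonic G) \<times> {\<one>\<^bsub>int_fun I\<^esub>})"
  by (intro double_quotient.intro double_quotient_axioms.intro comm_group_Z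
      subgroup_exact_forms_mod subgroup_harmonic_mod)

lemma double_quotient_P_mod_eqs:
  "double_quotient.B Z (exact_forms_mod G I \<rho>) = H1_mod G I \<rho>"
  "double_quotient.R Z (exact_forms_mod G I \<rho>) (carrier (harmonic G) \<times> {\<one>\<^bsub>int_fun I\<^esub>}) = P_mod_rel G I \<rho>"
  "double_quotient.Q Z (exact_forms_mod G I \<rho>) (carrier (harmonic G) \<times> {\<one>\<^bsub>int_fun I\<^esub>}) = P_mod G I \<rho>"
  "double_quotient.cl Z (exact_forms_mod G I \<rho>) (carrier (harmonic G) \<times> {\<one>\<^bsub>int_fun I\<^esub>}) = P_mod_class G I \<rho>"
proof -
  note dq = double_quotient_P_mod
  show B: "double_quotient.B Z (exact_forms_mod G I \<rho>) = H1_mod G I \<rho>"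
    using dq by (simp add: double_quotient.B_def H1_mod_def)
  show R: "double_quotient.R Z (exact_forms_mod G I \<rho>) (carrier (harmonic G) \<times> {\<one>\<^bsub>int_fun I\<^esub>}) = P_mod_rel G I \<rho>"
    unfolding double_quotient.R_def[OF dq] P_mod_rel_def by auto
  show "double_quotient.Q Z (exact_forms_mod G I \<rho>) (carrier (harmonic G) \<times> {\<one>\<^bsub>int_fun I\<^esub>}) = P_mod G I \<rho>"
    unfolding double_quotient.Q_def[OF dq] B R P_mod_def ..
  show "double_quotient.cl Z (exact_forms_mod G I \<rho>) (carrier (harmonic G) \<times> {\<one>\<^bsub>int_fun I\<^esub>}) = P_mod_class G I \<rho>"
    by (rule ext) (simp only: double_quotient.cl_def[OF dq] B R)
qed

lemmas comm_group_P_mod = double_quotient.comm_group_Q[OF double_quotient_P_mod, unfolded double_quotient_P_mod_eqs]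
  and pcl_hom = double_quotient.cl_hom[OF double_quotient_P_mod, unfolded double_quotient_P_mod_eqs]
  and pcl_epi = double_quotient.cl_epi[OF double_quotient_P_mod, unfolded double_quotient_P_mod_eqs]
  and P_mod_rep_rep = double_quotient.rep_rep[OF double_quotient_P_mod, unfolded double_quotient_P_mod_eqs]

text \<open>The same f occurs in both coordinates. This coupling is what the sequence and the map
  \<open>T\<close> have to respect.\<close>

lemma pcl_eq_one_iff:
  assumes "\<omega> \<in> carrier A" "g \<in> carrier (int_fun I)"
  shows "pcl (\<omega>, g) = \<one>\<^bsub>P_mod G I \<rho>\<^esub> \<longleftrightarrow>
    (\<exists>f\<in>carrier (int_fun (verts G)). \<exists>a. \<exists>\<eta>\<in>carrier (harmonic G).
      \<omega> = diff G f \<otimes>\<^bsub>A\<^esub> \<eta> \<and> g = (\<lambda>i\<in>I. f (\<rho> i) - a))"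
proof -
  have 1: "(\<lambda>i\<in>I. f (\<rho> i) - a) \<otimes>\<^bsub>int_fun I\<^esub> \<one>\<^bsub>int_fun I\<^esub> = (\<lambda>i\<in>I. f (\<rho> i) - a)" for f a
    by (auto simp: mult_int_fun one_int_fun)
  have "(\<omega>, g) \<in> carrier Z" using assms by simp
  from double_quotient.cl_eq_one_iff[OF double_quotient_P_mod this]
  have "pcl (\<omega>, g) = \<one>\<^bsub>P_mod G I \<rho>\<^esub> \<longleftrightarrow> (\<exists>n\<in>exact_forms_mod G I \<rho>.
      \<exists>k\<in>carrier (harmonic G) \<times> {\<one>\<^bsub>int_fun I\<^esub>}. (\<omega>, g) = n \<otimes>\<^bsub>Z\<^esub> k)"
    unfolding double_quotient_P_mod_eqs .
  also have "\<dots> \<longleftrightarrow> (\<exists>f\<in>carrier (int_fun (verts G)). \<exists>a. \<exists>\<eta>\<in>carrier (harmonic G).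
      (\<omega>, g) = (diff G f, \<lambda>i\<in>I. f (\<rho> i) - a) \<otimes>\<^bsub>Z\<^esub> (\<eta>, \<one>\<^bsub>int_fun I\<^esub>))"
    by (auto simp: exact_forms_mod_def)
  finally show ?thesis by (simp add: 1)
qed

lemma zero_harmonic: "\<one>\<^bsub>A\<^esub> \<in> carrier (harmonic G)"
  using subgroup.one_closed[OF subgroup_harmonic] .

text \<open>Changing g by a constant changes (0, g) by the coboundary of a function supported at the
  added vertex.\<close>

lemma P_mod_incl_class:
  assumes g: "g \<in> carrier (int_fun I)"
  shows "P_mod_incl G I \<rho> (fmc_class I g) = pcl (\<one>\<^bsub>A\<^esub>, g)"
proof -
  interpret A: comm_group A by (rule comm_group_int_fun)
  interpret F: comm_group "int_fun I" by (rule comm_group_int_fun)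
  have X: "fmc_class I g \<in> carrier (fun_mod_const I)" by (rule hom_in_carrier[OF fmc_class_hom g])
  let ?g = "rep (fmc_class I g)"
  note g' = fmc_rep[OF X]
  obtain a where a: "\<And>i. i \<in> I \<Longrightarrow> ?g i = g i + a"
    using fmc_class_eq_iff[OF g'(1) g] g'(2) by auto
  \<comment> \<open>Relations have second entry f o \<rho> minus a constant, so with f = 0 the
    difference a requires the value -a.\<close>
  have "?g \<otimes>\<^bsub>int_fun I\<^esub> inv\<^bsub>int_fun I\<^esub> g = (\<lambda>i\<in>I. (\<lambda>v\<in>verts G. 0) (\<rho> i) - (- a))"
    using g a \<rho>_in by (auto simp: mult_int_fun inv_int_fun fun_eq_iff)
  moreover have "\<one>\<^bsub>A\<^esub> = diff G (\<lambda>v\<in>verts G. 0) \<otimes>\<^bsub>A\<^esub> \<one>\<^bsub>A\<^esub>"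
    by (auto simp: mult_int_fun one_int_fun diff_def)
  ultimately have "pcl (\<one>\<^bsub>A\<^esub>, ?g \<otimes>\<^bsub>int_fun I\<^esub> inv\<^bsub>int_fun I\<^esub> g) = \<one>\<^bsub>P_mod G I \<rho>\<^esub>"
    using pcl_eq_one_iff[of "\<one>\<^bsub>A\<^esub>" "?g \<otimes>\<^bsub>int_fun I\<^esub> inv\<^bsub>int_fun I\<^esub> g"] g g'(1) zero_harmonic
      restrict_in_int_fun by (metis A.one_closed F.inv_closed F.m_closed)
  then have "pcl (\<one>\<^bsub>A\<^esub>, ?g) = pcl (\<one>\<^bsub>A\<^esub>, g)"
    using hom_eq_iff_quotient_one[OF comm_group_Z comm_group_P_mod pcl_hom, of "(\<one>\<^bsub>A\<^esub>, ?g)" "(\<one>\<^bsub>A\<^esub>, g)"]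
      g g'(1) inv_DirProd[OF A.group_axioms F.group_axioms, of "\<one>\<^bsub>A\<^esub>" g] by simp
  then show ?thesis by (simp add: P_mod_incl_def)
qed

text \<open>Forgetting the second coordinate takes the decomposition in
  \<open>pcl_eq_one_iff\<close> to the one in \<open>P_class_eq_one_iff\<close>.\<close>

lemma P_mod_proj_class:
  assumes \<omega>: "\<omega> \<in> carrier A" and g: "g \<in> carrier (int_fun I)"
  shows "P_mod_proj G (pcl (\<omega>, g)) = P_class G \<omega>"
proof -
  interpret A: comm_group A by (rule comm_group_int_fun)
  interpret F: comm_group "int_fun I" by (rule comm_group_int_fun)
  have "pcl (\<omega>, g) \<in> carrier (P_mod G I \<rho>)"
    by (rule hom_in_carrier[OF pcl_hom]) (use \<omega> g in simp)
  from P_mod_rep_rep[OF this] obtain \<omega>' g' where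
    r: "rep (rep (pcl (\<omega>, g))) = (\<omega>', g')" and \<omega>': "\<omega>' \<in> carrier A" "g' \<in> carrier (int_fun I)"
    and eq: "pcl (\<omega>', g') = pcl (\<omega>, g)"
    by (metis mem_Times_iff DirProd_def partial_object.select_convs(1) prod.collapse)
  have "pcl (\<omega>' \<otimes>\<^bsub>A\<^esub> inv\<^bsub>A\<^esub> \<omega>, g' \<otimes>\<^bsub>int_fun I\<^esub> inv\<^bsub>int_fun I\<^esub> g) = \<one>\<^bsub>P_mod G I \<rho>\<^esub>"
    using hom_eq_iff_quotient_one[OF comm_group_Z comm_group_P_mod pcl_hom, of "(\<omega>', g')" "(\<omega>, g)"] eq
      \<omega> g \<omega>' inv_DirProd[OF A.group_axioms F.group_axioms, of \<omega> g] by simp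
  then have "P_class G (\<omega>' \<otimes>\<^bsub>A\<^esub> inv\<^bsub>A\<^esub> \<omega>) = \<one>\<^bsub>P_group G\<^esub>"
    using pcl_eq_one_iff[of "\<omega>' \<otimes>\<^bsub>A\<^esub> inv\<^bsub>A\<^esub> \<omega>" "g' \<otimes>\<^bsub>int_fun I\<^esub> inv\<^bsub>int_fun I\<^esub> g"]
      P_class_eq_one_iff[of "\<omega>' \<otimes>\<^bsub>A\<^esub> inv\<^bsub>A\<^esub> \<omega>"] \<omega> g \<omega>' by auto
  then have "P_class G \<omega>' = P_class G \<omega>"
    using hom_eq_iff_quotient_one[OF comm_group_int_fun comm_group_P P_class_hom \<omega>'(1) \<omega>] by simp
  then show ?thesis by (simp add: P_mod_proj_def r)
qed

lemma P_mod_cases: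
  assumes "Y \<in> carrier (P_mod G I \<rho>)"
  obtains \<omega> g where "\<omega> \<in> carrier A" "g \<in> carrier (int_fun I)" "Y = pcl (\<omega>, g)"
proof -
  have "Y \<in> pcl ` carrier Z"
    using assms pcl_epi by (simp add: epi_def)
  then obtain z where "z \<in> carrier Z" "Y = pcl z" by blast
  then show ?thesis using that by (cases z) auto
qed

text \<open>If (0, g) is trivial, then \<eta> = d(-f) is harmonic and exact, hence zero; f is then
  constant by connectedness and so is g. Exactness in the middle comes from subtracting the relation
  that kills the first coordinate.\<close>

theorem P_mod_ses: "is_ses (fun_mod_const I) (P_mod G I \<rho>) (P_group G) (P_mod_incl G I \<rho>) (P_mod_proj G)"
proof -
  interpret A: comm_group A by (rule comm_group_int_fun)
  interpret F: comm_group "int_fun I" by (rule comm_group_int_fun)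
  let ?i = "P_mod_incl G I \<rho>" and ?p = "P_mod_proj G"
  have Z_in: "(\<omega>, g) \<in> carrier Z" if "\<omega> \<in> carrier A" "g \<in> carrier (int_fun I)" for \<omega> g
    using that by simp
  have i: "?i X = pcl (\<one>\<^bsub>A\<^esub>, rep X)" for X by (simp add: P_mod_incl_def)
  have i_hom: "?i \<in> hom (fun_mod_const I) (P_mod G I \<rho>)"
  proof (rule homI)
    fix X assume "X \<in> carrier (fun_mod_const I)"
    then show "?i X \<in> carrier (P_mod G I \<rho>)"
      unfolding i using fmc_rep by (intro hom_in_carrier[OF pcl_hom]) simp
  next
    fix X Y assume XY: "X \<in> carrier (fun_mod_const I)" "Y \<in> carrier (fun_mod_const I)"
    note X = fmc_rep[OF XY(1)] and Y = fmc_rep[OF XY(2)]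
    have "X \<otimes>\<^bsub>fun_mod_const I\<^esub> Y = fmc_class I (rep X \<otimes>\<^bsub>int_fun I\<^esub> rep Y)"
      using hom_mult[OF fmc_class_hom X(1) Y(1)] X(2) Y(2) by simp
    then have "?i (X \<otimes>\<^bsub>fun_mod_const I\<^esub> Y) = pcl (\<one>\<^bsub>A\<^esub>, rep X \<otimes>\<^bsub>int_fun I\<^esub> rep Y)"
      using P_mod_incl_class[OF F.m_closed[OF X(1) Y(1)]] by simp
    also have "\<dots> = ?i X \<otimes>\<^bsub>P_mod G I \<rho>\<^esub> ?i Y"
      unfolding i using hom_mult[OF pcl_hom Z_in Z_in, of "\<one>\<^bsub>A\<^esub>" "rep X" "\<one>\<^bsub>A\<^esub>" "rep Y"] X Y by simp
    finally show "?i (X \<otimes>\<^bsub>fun_mod_const I\<^esub> Y) = ?i X \<otimes>\<^bsub>P_mod G I \<rho>\<^esub> ?i Y" .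
  qed
  have i_ker: "X = \<one>\<^bsub>fun_mod_const I\<^esub>" if X: "X \<in> carrier (fun_mod_const I)" and one: "?i X = \<one>\<^bsub>P_mod G I \<rho>\<^esub>" for X
  proof -
    note g = fmc_rep[OF X]
    obtain f a \<eta> where f: "f \<in> carrier (int_fun (verts G))" "\<eta> \<in> carrier (harmonic G)"
      "\<one>\<^bsub>A\<^esub> = diff G f \<otimes>\<^bsub>A\<^esub> \<eta>" "rep X = (\<lambda>i\<in>I. f (\<rho> i) - a)"
      using one pcl_eq_one_iff[OF A.one_closed g(1)] by (auto simp: i)
    have \<eta>: "\<eta> e = - diff G f e" if "e \<in> arcs G" for e
      using fun_cong[OF f(3), of e] that by (simp add: one_int_fun mult_int_fun)
    have "diff G f e = 0" if e: "e \<in> arcs G" for e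
    proof -
      have "\<eta> e = 0"
        by (rule harmonic_exact_eq_zero[OF f(2) _ e, of "\<lambda>v. - f v"]) (simp add: \<eta>, simp add: diff_def)
      then show ?thesis using \<eta>[OF e] by simp
    qed
    then have const: "f u = f v" if "u \<in> verts G" "v \<in> verts G" for u v
      using closed_imp_constant that by blast
    obtain v where v: "v \<in> verts G" using connected by (auto simp: connected_conv)
    have "rep X = (\<lambda>i\<in>I. f v - a)"
      unfolding f(4) using const[OF _ v] \<rho>_in by (auto simp: fun_eq_iff)
    then have "rep X \<in> const_funs I" by (auto simp: const_funs_def)
    then show ?thesis using fmc_class_eq_one_iff[OF g(1)] g(2) by simp
  qed
  have i_mon: "?i \<in> mon (fun_mod_const I) (P_mod G I \<rho>)"
  proof -
    interpret i: group_hom "fun_mod_const I" "P_mod G I \<rho>" ?i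
      using i_hom comm_group_fun_mod_const[of I] comm_group_P_mod
      by (simp add: group_hom_def group_hom_axioms_def comm_group.axioms(2))
    show ?thesis using i_hom i_ker i.inj_on_one_iff by (auto simp: mon_def)
  qed
  have p_hom: "?p \<in> hom (P_mod G I \<rho>) (P_group G)"
  proof (rule homI)
    fix Y assume "Y \<in> carrier (P_mod G I \<rho>)"
    then show "?p Y \<in> carrier (P_group G)"
      by (elim P_mod_cases) (simp add: P_mod_proj_class hom_in_carrier[OF P_class_hom])
  next
    fix Y W assume Y: "Y \<in> carrier (P_mod G I \<rho>)" and W: "W \<in> carrier (P_mod G I \<rho>)"
    obtain \<omega> g where y: "\<omega> \<in> carrier A" "g \<in> carrier (int_fun I)" "Y = pcl (\<omega>, g)"
      using Y by (rule P_mod_cases)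
    obtain \<omega>' g' where w: "\<omega>' \<in> carrier A" "g' \<in> carrier (int_fun I)" "W = pcl (\<omega>', g')"
      using W by (rule P_mod_cases)
    have "Y \<otimes>\<^bsub>P_mod G I \<rho>\<^esub> W = pcl (\<omega> \<otimes>\<^bsub>A\<^esub> \<omega>', g \<otimes>\<^bsub>int_fun I\<^esub> g')"
      using hom_mult[OF pcl_hom Z_in[OF y(1,2)] Z_in[OF w(1,2)]] y w by simp
    then show "?p (Y \<otimes>\<^bsub>P_mod G I \<rho>\<^esub> W) = ?p Y \<otimes>\<^bsub>P_group G\<^esub> ?p W"
      using y w hom_mult[OF P_class_hom y(1) w(1)] by (simp add: P_mod_proj_class)
  qed
  have p_epi: "?p \<in> epi (P_mod G I \<rho>) (P_group G)"
  proof -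
    have "x \<in> ?p ` carrier (P_mod G I \<rho>)" if x: "x \<in> carrier (P_group G)" for x
    proof -
      note r = P_rep_rep[OF x]
      have "x = ?p (pcl (rep (rep x), \<one>\<^bsub>int_fun I\<^esub>))"
        using P_mod_proj_class[OF r(1) F.one_closed] r(2) by simp
      then show ?thesis
        using hom_in_carrier[OF pcl_hom Z_in[OF r(1) F.one_closed]] by blast
    qed
    then show ?thesis using p_hom hom_in_carrier[OF p_hom] by (auto simp: epi_def)
  qed
  have "kernel (P_mod G I \<rho>) (P_group G) ?p = ?i ` carrier (fun_mod_const I)"
  proof (intro equalityI subsetI)
    fix Y assume "Y \<in> kernel (P_mod G I \<rho>) (P_group G) ?p"
    then have Y: "Y \<in> carrier (P_mod G I \<rho>)" and one: "?p Y = \<one>\<^bsub>P_group G\<^esub>" by (auto simp: kernel_def)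
    obtain \<omega> g where y: "\<omega> \<in> carrier A" "g \<in> carrier (int_fun I)" "Y = pcl (\<omega>, g)"
      using Y by (rule P_mod_cases)
    obtain f \<eta> where f: "f \<in> carrier (int_fun (verts G))" "\<eta> \<in> carrier (harmonic G)" "\<omega> = diff G f \<otimes>\<^bsub>A\<^esub> \<eta>"
      using one P_class_eq_one_iff[OF y(1)] y by (auto simp: P_mod_proj_class)
    \<comment> \<open>With \<omega> = df + \<eta>, the pair (\<omega>, f o \<rho>) is a relation
      with a = 0, and g' is what remains in the second coordinate.\<close>
    define g' where "g' = (\<lambda>i\<in>I. g i - f (\<rho> i))"
    have g': "g' \<in> carrier (int_fun I)" by (simp add: g'_def)
    have "pcl (\<omega>, \<lambda>i\<in>I. f (\<rho> i) - 0) = \<one>\<^bsub>P_mod G I \<rho>\<^esub>"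
      using f by (subst pcl_eq_one_iff[OF y(1) restrict_in_int_fun]) blast
    moreover have "(\<omega>, g) = (\<omega>, \<lambda>i\<in>I. f (\<rho> i) - 0) \<otimes>\<^bsub>Z\<^esub> (\<one>\<^bsub>A\<^esub>, g')"
      using y by (auto simp: g'_def mult_int_fun one_int_fun carrier_int_fun extensional_def fun_eq_iff)
    ultimately have "Y = \<one>\<^bsub>P_mod G I \<rho>\<^esub> \<otimes>\<^bsub>P_mod G I \<rho>\<^esub> pcl (\<one>\<^bsub>A\<^esub>, g')"
      using hom_mult[OF pcl_hom Z_in[OF y(1), of "\<lambda>i\<in>I. f (\<rho> i) - 0"] Z_in[OF A.one_closed g']] y(3) by simp
    also have "\<dots> = ?i (fmc_class I g')"
      using monoid.l_one[OF group.is_monoid[OF comm_group.axioms(2)[OF comm_group_P_mod]]]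
        hom_in_carrier[OF pcl_hom Z_in[OF A.one_closed g']] P_mod_incl_class[OF g'] by simp
    finally show "Y \<in> ?i ` carrier (fun_mod_const I)"
      using hom_in_carrier[OF fmc_class_hom g'] by blast
  next
    fix Y assume "Y \<in> ?i ` carrier (fun_mod_const I)"
    then obtain X where X: "X \<in> carrier (fun_mod_const I)" "Y = ?i X" by blast
    have "?p Y = P_class G \<one>\<^bsub>A\<^esub>"
      using P_mod_proj_class[OF A.one_closed fmc_rep(1)[OF X(1)]] by (simp add: X(2) i)
    also have "\<dots> = \<one>\<^bsub>P_group G\<^esub>"
      by (rule hom_one[OF P_class_hom A.group_axioms comm_group.axioms(2)[OF comm_group_P]])
    finally show "Y \<in> kernel (P_mod G I \<rho>) (P_group G) ?p"
      using hom_in_carrier[OF i_hom X(1)] by (simp add: kernel_def X(2))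
  qed
  then show ?thesis
    using comm_group_fun_mod_const comm_group_P_mod comm_group_P i_mon p_epi by (simp add: is_ses_def)
qed

section \<open>Comparison of the connecting homomorphism with the Abel-Jacobi map\<close>

theorem connecting_to_Jac_eq_AJ:
  assumes D: "D \<in> carrier (chains_deg0 I)"
  shows "AJ G (push_chain \<rho> D) \<in> carrier (Jac G)"
    and "connecting_to_Jac G I \<rho> D = AJ G (push_chain \<rho> D)"
proof -
  interpret A: comm_group A by (rule comm_group_int_fun)
  interpret F: comm_group "int_fun I" by (rule comm_group_int_fun)
  have D': "Poly_Mapping.keys D \<subseteq> I" "chain_degree D = 0" using D by (auto simp: carrier_chains_deg0)
  let ?x = "push_chain \<rho> D"
  \<comment> \<open>The same choice as in the definition of \<open>AJ\<close>, so that the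
    Abel-Jacobi value is literally the class of integration along \<gamma>.\<close>
  define \<gamma> where "\<gamma> = (SOME \<gamma>. \<gamma> \<in> carrier (free_Abelian_group (arcs G)) \<and> boundary G \<gamma> = ?x)"
  have "chain_degree ?x = 0"
    using D' chain_eval_push_chain[of "\<lambda>_. 1" \<rho> D] by (simp add: chain_degree_eq_eval)
  then obtain \<gamma>' where "Poly_Mapping.keys \<gamma>' \<subseteq> arcs G" "boundary G \<gamma>' = ?x"
    using boundary_surj_deg0[OF keys_push_chain[OF \<rho>_in D'(1)]] by blast
  then have "\<gamma> \<in> carrier (free_Abelian_group (arcs G)) \<and> boundary G \<gamma> = ?x"
    unfolding \<gamma>_def by - (rule someI[of _ \<gamma>'], simp)
  then have \<gamma>: "Poly_Mapping.keys \<gamma> \<subseteq> arcs G" "boundary G \<gamma> = ?x" by auto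
  define \<phi> where "\<phi> = integrate G \<gamma>"
  have \<phi>: "\<phi> \<in> carrier (harmonic_dual G)" unfolding \<phi>_def by (rule integrate_in[OF \<gamma>(1)])
  define j where "j = Jac_class G \<phi>"
  have AJ: "AJ G ?x = j" by (simp add: AJ_def j_def \<phi>_def \<gamma>_def)
  have j: "j \<in> carrier (Jac G)" unfolding j_def by (rule hom_in_carrier[OF Jac_class_hom \<phi>])
  define \<chi> where "\<chi> = Jac_to_dual G j"
  have \<chi>_in: "\<chi> \<in> carrier (hom_group (P_group G) rat_mod_int)"
    unfolding \<chi>_def by (rule Jac_to_dual_in[OF j])
  define T where "T = (\<lambda>(\<omega>, g). rat_of_int (chain_eval g D) - of_int (chain_eval \<omega> \<gamma>) + rat_extension G \<phi> \<omega>)"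
  have ev\<gamma>: "chain_eval (x \<otimes>\<^bsub>A\<^esub> y) \<gamma> = chain_eval x \<gamma> + chain_eval y \<gamma>"
    if "x \<in> carrier A" "y \<in> carrier A" for x y
    using hom_mult[OF chain_eval_int_fun_hom[OF \<gamma>(1)] that] by simp
  have evD: "chain_eval (x \<otimes>\<^bsub>int_fun I\<^esub> y) D = chain_eval x D + chain_eval y D"
    if "x \<in> carrier (int_fun I)" "y \<in> carrier (int_fun I)" for x y
    using hom_mult[OF chain_eval_int_fun_hom[OF D'(1)] that] by simp
  have hv: "rat_extension G \<phi> (x \<otimes>\<^bsub>A\<^esub> y) = rat_extension G \<phi> x + rat_extension G \<phi> y"
    if "x \<in> carrier A" "y \<in> carrier A" for x y
    using hom_mult[OF rat_extension_hom[OF \<phi>] that] by simp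
  have T: "T \<in> hom Z rat_group"
    by (rule homI) (auto simp: T_def ev\<gamma> evD hv)
  have "T z = \<one>\<^bsub>rat_group\<^esub>" if z_in: "z \<in> carrier Z" and one: "pcl z = \<one>\<^bsub>P_mod G I \<rho>\<^esub>" for z
  proof -
    obtain \<omega> g where z: "z = (\<omega>, g)" "\<omega> \<in> carrier A" "g \<in> carrier (int_fun I)" using z_in by auto
    obtain f a \<eta> where f: "f \<in> carrier (int_fun (verts G))" "\<eta> \<in> carrier (harmonic G)"
      "\<omega> = diff G f \<otimes>\<^bsub>A\<^esub> \<eta>" "g = (\<lambda>i\<in>I. f (\<rho> i) - a)"
      using pcl_eq_one_iff[OF z(2,3)] one z(1) by auto
    have "chain_eval g D = chain_eval (\<lambda>i. f (\<rho> i) + (- a)) D"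
      by (rule chain_eval_cong) (use f(4) D'(1) in auto)
    also have "\<dots> = chain_eval f ?x"
      unfolding chain_eval_fun_add chain_eval_const by (simp add: D'(2) chain_eval_push_chain)
    finally have 1: "chain_eval g D = chain_eval f ?x" .
    have \<eta>: "\<eta> \<in> carrier A" using f(2) by (simp add: carrier_harmonic)
    have 2: "chain_eval \<omega> \<gamma> = chain_eval f ?x + chain_eval \<eta> \<gamma>"
      using ev\<gamma>[OF diff_in \<eta>] chain_eval_diff_boundary[OF \<gamma>(1)] \<gamma>(2) f(3) by simp
    have 3: "rat_extension G \<phi> \<omega> = of_int (chain_eval \<eta> \<gamma>)"
      using hv[OF diff_in \<eta>] f rat_extension_exact[OF \<phi> f(1)] rat_extension_harmonic[OF \<phi> f(2)]
      by (simp add: \<phi>_def integrate_def)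
    show ?thesis by (simp add: T_def z(1) 1 2 3)
  qed
  then obtain T' where T': "T' \<in> hom (P_mod G I \<rho>) rat_group"
    "\<And>z. z \<in> carrier Z \<Longrightarrow> T' (pcl z) = T z"
    by (rule hom_factor_through_epi[OF comm_group_Z comm_group_P_mod comm_group_rat_group pcl_epi T]) blast+
  have h: "deg0_to_dual I D \<in> hom (fun_mod_const I) integer_group"
    using deg0_to_dual_in[OF D] by (simp add: carrier_hom_group)
  have "P_connecting G I \<rho> (deg0_to_dual I D) = dual_to_Ext1 (P_group G) \<chi>"
    unfolding P_connecting_def
  proof (rule connecting_contra_eq_dual_to_Ext1[OF P_mod_ses h T'(1)])
    fix X assume X: "X \<in> carrier (fun_mod_const I)"
    have "chain_eval \<one>\<^bsub>A\<^esub> \<gamma> = 0"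
      using hom_one[OF chain_eval_int_fun_hom[OF \<gamma>(1)]] group_int_fun by simp
    moreover have "rat_extension G \<phi> \<one>\<^bsub>A\<^esub> = 0"
      using hom_one[OF rat_extension_hom[OF \<phi>]] group_int_fun comm_group.axioms(2)[OF comm_group_rat_group] by simp
    ultimately show "T' (P_mod_incl G I \<rho> X) = of_int (deg0_to_dual I D X)"
      using T'(2)[of "(\<one>\<^bsub>A\<^esub>, rep X)"] fmc_rep(1)[OF X] X
      by (simp add: P_mod_incl_def T_def deg0_to_dual_def)
  next
    show "\<chi> \<in> hom (P_group G) rat_mod_int" using \<chi>_in by (simp add: carrier_hom_group)
  next
    fix Y assume "Y \<in> carrier (P_mod G I \<rho>)"
    then obtain \<omega> g where y: "\<omega> \<in> carrier A" "g \<in> carrier (int_fun I)" "Y = pcl (\<omega>, g)"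
      by (rule P_mod_cases)
    have "\<chi> (P_mod_proj G Y) = rat_class (rat_extension G \<phi> \<omega>)"
      using Jac_to_dual_class[OF \<phi> y(1)] P_mod_proj_class[OF y(1,2)] by (simp add: \<chi>_def j_def y(3))
    also have "\<dots> = rat_class (T (\<omega>, g))"
      by (simp add: rat_class_eq_iff T_def)
    also have "\<dots> = rat_class (T' Y)" using T'(2)[of "(\<omega>, g)"] y by simp
    finally show "\<chi> (P_mod_proj G Y) = rat_class (T' Y)" .
  qed
  \<comment> \<open>The connecting class is now the image of j under two injective maps, so both
    occurrences of \<open>inv_into\<close> cancel and return j.\<close>
  moreover have "inj_on (dual_to_Ext1 (P_group G)) (carrier (hom_group (P_group G) rat_mod_int))"
    using dual_to_Ext1_iso[OF comm_group_P P_torsion] by (auto simp: iso_def bij_betw_def)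
  moreover have "inj_on (Jac_to_dual G) (carrier (Jac G))"
    using Jac_to_dual_iso by (auto simp: iso_def bij_betw_def)
  ultimately show "connecting_to_Jac G I \<rho> D = AJ G (push_chain \<rho> D)"
    using \<chi>_in j by (simp add: connecting_to_Jac_def AJ \<chi>_def)
  show "AJ G (push_chain \<rho> D) \<in> carrier (Jac G)" using j by (simp add: AJ)
qed

end

text \<open>The conjuncts before the last give the composite its meaning: exactness of the sequence,
  the identification of its source, and bijectivity of the two maps that
  \<open>connecting_to_Jac\<close> inverts by \<open>inv_into\<close>. The sign is quantified before
  D, hence uniform; it is witnessed by 1.\<close>

theorem theorem3p7p6:
  fixes G :: "('v, 'e) pre_digraph" and I :: "'i set" and \<rho> :: "'i \<Rightarrow> 'v"
  assumes "fin_digraph G"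
    and "Digraph_Component.connected G"
    and "finite I" and "I \<noteq> {}"
    and "\<rho> \<in> I \<rightarrow> verts G"
  shows "is_ses (fun_mod_const I) (P_mod G I \<rho>) (P_group G) (P_mod_incl G I \<rho>) (P_mod_proj G) \<and>
    deg0_to_dual I \<in> iso (chains_deg0 I) (hom_group (fun_mod_const I) integer_group) \<and>
    P_connecting G I \<rho> \<in>
      hom (hom_group (fun_mod_const I) integer_group) (Ext1 (P_group G) integer_group) \<and>
    dual_to_Ext1 (P_group G) \<in>
      iso (hom_group (P_group G) rat_mod_int) (Ext1 (P_group G) integer_group) \<and>
    Jac_to_dual G \<in> iso (Jac G) (hom_group (P_group G) rat_mod_int) \<and>
    (\<exists>\<epsilon>\<in>{1, - 1 :: int}. \<forall>D\<in>carrier (chains_deg0 I).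
      connecting_to_Jac G I \<rho> D = AJ G (push_chain \<rho> D) [^]\<^bsub>Jac G\<^esub> \<epsilon>)"
proof -
  interpret modulus_digraph G I \<rho>
    using assms by (intro modulus_digraph.intro connected_digraph.intro connected_digraph_axioms.intro
        modulus_digraph_axioms.intro)
  have "connecting_to_Jac G I \<rho> D = AJ G (push_chain \<rho> D) [^]\<^bsub>Jac G\<^esub> (1 :: int)"
    if D: "D \<in> carrier (chains_deg0 I)" for D
    using connecting_to_Jac_eq_AJ[OF D] group.int_pow_1[OF comm_group.axioms(2)[OF comm_group_Jac]] by simp
  then show ?thesis
    using P_mod_ses deg0_to_dual_iso[OF finite_I] Jac_to_dual_iso dual_to_Ext1_iso[OF comm_group_P P_torsion]
      connecting_contra_hom[OF P_mod_ses abelian_integer_group]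
    by (auto simp: P_connecting_def)
qed

end
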